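(* Let $\Omega=(a,b)$ with $a<b$ real and $|\Omega|=b-a<\infty$. Let $\mathbf X$ be the one-dimensional rotationally invariant (symmetric) $\alpha$-stable process, let $Q_\Omega^{(\alpha)}(t)$ be its spectral heat content over $\Omega$, and let $\overline X_1=\sup\{X_s:0\le s\le 1\}$ for $\mathbf X$ started from $0$. (a) If $1<\alpha\le 2$, then $$\lim_{t\downarrow 0}\frac{|\Omega|-Q^{(\alpha)}_{\Omega}(t)}{t^{1/\alpha}}=2\,\mathbb{E}\left[\overline X_1\right].$$ (b) If $\alpha=1$, then $$\lim_{t\downarrow 0}\frac{|\Omega|-Q^{(1)}_{\Omega}(t)}{t\ln\left(\frac1t\right)}=\frac{2}{\pi}.$$ (c) If $0<\alpha<1$, then $$\lim_{t\downarrow 0}\frac{|\Omega|-Q^{(\alpha)}_{\Omega}(t)}{t}=A_{\alpha,1}\,\mathcal P_\alpha(\Omega).$$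
   Context: For $0<\alpha\le 2$, $\mathbf X=\{X_s\}_{s\ge0}$ is the one-dimensional rotationally invariant (symmetric) $\alpha$-stable Lévy process with càdlàg paths, normalized by $\mathbb E^0[e^{i\xi X_t}]=e^{-t|\xi|^\alpha}$ for $\xi\in\mathbb R$, $t\ge 0$; its transition density is $p_t^{(\alpha)}(x,y)=p_t^{(\alpha)}(|x-y|)$ (for $\alpha=2$, $p^{(2)}_1(z)=(4\pi)^{-1/2}e^{-z^2/4}$; for $0<\alpha<2$, $\lim_{t\downarrow0}p_t^{(\alpha)}(|x-y|)/t=A_{\alpha,1}|x-y|^{-1-\alpha}$ for $x\ne y$). $\mathbb P^x,\mathbb E^x$ denote probability and expectation for the process started at $x$, and $\mathbb P=\mathbb P^0$, $\mathbb E=\mathbb E^0$. First exit time: $\tau_\Omega^{(\alpha)}=\inf\{s\ge0: X_s\in\Omega^c\}$. Spectral heat content: $Q_\Omega^{(\alpha)}(t)=\int_\Omega \mathbb P^x(\tau_\Omega^{(\alpha)}>t)\,dx$, $t>0$. Constants: $A_{\alpha,1}=\alpha\,2^{\alpha-1}\,\pi^{-3/2}\,\sin\left(\frac{\pi\alpha}{2}\right)\Gamma\left(\frac{1+\alpha}{2}\right)\Gamma\left(\frac{\alpha}{2}\right)$, and the fractional $\alpha$-perimeter is, for $0<\alpha<1$, $\mathcal P_\alpha(\Omega)=\int_\Omega\int_{\Omega^c}\frac{dx\,dy}{|x-y|^{1+\alpha}}$. *)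

theory Defs
  imports "HOL-Probability.Probability"
begin

definition cadlag :: "(real \<Rightarrow> real) \<Rightarrow> bool" where
  "cadlag w \<longleftrightarrow>
     (\<forall>t\<ge>0. continuous (at_right t) w) \<and> (\<forall>t>0. \<exists>l. (w \<longlongrightarrow> l) (at_left t))"

text \<open>The time set is the half-line of nonnegative reals; the values of \<open>X s\<close> for \<open>s < 0\<close> are
  unconstrained and play no role anywhere.\<close>

locale levy_process = prob_space M
  for M :: "'a measure" +
  fixes X :: "real \<Rightarrow> 'a \<Rightarrow> real"
  assumes rv: "\<And>t. 0 \<le> t \<Longrightarrow> random_variable borel (X t)"
    and start: "AE \<omega> in M. X 0 \<omega> = 0"
    and indep_increments: "\<And>(n::nat) (t :: nat \<Rightarrow> real). 0 \<le> t 0 \<Longrightarrow> strict_mono_on {..n} t \<Longrightarrow>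
      indep_vars (\<lambda>_. borel) (\<lambda>i \<omega>. X (t (Suc i)) \<omega> - X (t i) \<omega>) {..<n}"
    and stationary_increments: "\<And>s h. 0 \<le> s \<Longrightarrow> 0 \<le> h \<Longrightarrow>
      distr M borel (\<lambda>\<omega>. X (s + h) \<omega> - X s \<omega>) = distr M borel (\<lambda>\<omega>. X h \<omega> - X 0 \<omega>)"
    and cadlag_paths: "\<And>\<omega>. \<omega> \<in> space M \<Longrightarrow> cadlag (\<lambda>t. X t \<omega>)"

locale symmetric_stable_process = levy_process M X
  for M :: "'a measure" and X :: "real \<Rightarrow> 'a \<Rightarrow> real" +
  fixes \<alpha> :: real
  assumes index: "0 < \<alpha>" "\<alpha> \<le> 2"
    and char_stable: "\<And>t \<xi>. 0 \<le> t \<Longrightarrow>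
      char (distr M borel (X t)) \<xi> = of_real (exp (- (t * \<bar>\<xi>\<bar> powr \<alpha>)))"

text \<open>The exit time takes values in the extended reals, where the infimum of the empty set
  is \<open>\<infinity>\<close>.\<close>

definition exit_time :: "real set \<Rightarrow> (real \<Rightarrow> real) \<Rightarrow> ereal" where
  "exit_time \<Omega> w = Inf (ereal ` {s. 0 \<le> s \<and> w s \<in> - \<Omega>})"

text \<open>The process started at \<open>x\<close> is \<open>x + X\<close>, where \<open>X\<close> starts at \<open>0\<close>. For a cadlag process the
  event \<open>exit_time > t\<close> belongs in general only to the completion of the underlying probability
  space (it involves an uncountable union over times), and \<^const>\<open>measure\<close> is \<open>0\<close> on
  non-measurable sets; hence the completion. On a complete space it changes nothing.\<close>

definition spectral_heat_content ::
    "'a measure \<Rightarrow> (real \<Rightarrow> 'a \<Rightarrow> real) \<Rightarrow> real set \<Rightarrow> real \<Rightarrow> real" where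
  "spectral_heat_content M X \<Omega> t =
     (LINT x:\<Omega>|lebesgue.
        measure (completion M) {\<omega> \<in> space M. ereal t < exit_time \<Omega> (\<lambda>s. x + X s \<omega>)})"

text \<open>This is the constant \<open>A\<^sub>\<alpha>\<^sub>,\<^sub>1\<close> in the Levy density \<open>A\<^sub>\<alpha>\<^sub>,\<^sub>1 |x|\<^sup>-\<^sup>1\<^sup>-\<^sup>\<alpha>\<close>.\<close>

definition stable_const :: "real \<Rightarrow> real" where
  "stable_const \<alpha> = \<alpha> * 2 powr (\<alpha> - 1) * pi powr (- (3 / 2)) * sin (pi * \<alpha> / 2) *
     Gamma ((1 + \<alpha>) / 2) * Gamma (\<alpha> / 2)"

definition fractional_perimeter :: "real \<Rightarrow> real set \<Rightarrow> ennreal" where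
  "fractional_perimeter \<alpha> \<Omega> =
     (\<integral>\<^sup>+x\<in>\<Omega>. (\<integral>\<^sup>+y\<in>- \<Omega>. ennreal (1 / \<bar>x - y\<bar> powr (1 + \<alpha>)) \<partial>lborel) \<partial>lborel)"

end

theory Submission
  imports Defs "HOL-Real_Asymp.Real_Asymp"
begin

text \<open>
  Put \<open>L = b - a\<close> and let \<open>R\<^sub>t\<close> be the range \<open>sup X - inf X\<close> of the path over \<open>[0,t]\<close>. By Fubini,
  \<open>|\<Omega>| - Q(t) = E min(L, R\<^sub>t)\<close>. The identity
  \<open>min(L, |x|) = (2/\<pi>) \<integral>\<^sub>0\<^sup>\<infinity> (1 - cos xu) (1 - cos Lu) u\<^sup>-\<^sup>2 du\<close> turns the characteristic function into
  \<open>E min(L, |X\<^sub>t|) = (2/\<pi>) \<integral>\<^sub>0\<^sup>\<infinity> (1 - exp(-t u\<^sup>\<alpha>)) (1 - cos Lu) u\<^sup>-\<^sup>2 du\<close>, so that no transition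
  density is needed.

  For \<open>\<alpha> < 1\<close> the last integral is at most \<open>C t\<close> and asymptotic to \<open>C t\<close>. The lower bound for
  \<open>E min(L, R\<^sub>t)\<close> is \<open>R\<^sub>t \<ge> |X\<^sub>t|\<close>; the upper bound \<open>C t\<close> holds because \<open>min(L, _)\<close> is subadditive and
  \<open>R\<^sub>t\<close> is the limit of ranges of dyadic skeletons, each dominated by the sum of the \<open>|increments|\<close>.

  For \<open>\<alpha> \<ge> 1\<close>, scaling gives \<open>R\<^sub>t = t\<^sup>1\<^sup>/\<^sup>\<alpha> R\<^sub>1\<close> in law, and Ottaviani's inequality gives, for every
  \<open>\<eta> > 0\<close>, a constant \<open>K\<close> with \<open>E min(T, R\<^sub>1) \<le> K + (1 + \<eta>) E min(T, |X\<^sub>1|)\<close> for all \<open>T\<close>. If \<open>\<alpha> > 1\<close>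
  this makes \<open>R\<^sub>1\<close> integrable, and \<open>E R\<^sub>1 = 2 E sup X\<close> by symmetry; if \<open>\<alpha> = 1\<close> it transfers the
  logarithmic asymptotics of \<open>E min(L, |X\<^sub>t|)\<close> to \<open>R\<^sub>t\<close>.
\<close>

subsection \<open>Laplace, Gamma and cosine integrals\<close>

text \<open>The truncation \<open>min L\<close> is essential: for \<alpha> \<le> 1 the range is not
  integrable, so every comparison has to be made with bounded functionals. The regimes need
  different upper bounds. Subdividing time costs nothing when the truncated moment is linear in
  \<open>t\<close>, but for \<alpha> = 1 it behaves like \<open>t ln (1 / t)\<close>, and the sum
  over ever finer increments diverges. A reflection bound \<open>P (max > l) <= 2 P (X > l)\<close>
  would double the constant \<open>2 / pi\<close> of the critical case. Ottaviani's inequality with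
  a shift proportional to the level loses only factors close to 1, at the price of an additive
  constant; after scaling this constant contributes \<open>K t\<close>, negligible against
  \<open>t ln (1 / t)\<close> and harmless where only integrability is wanted. Suprema over
  uncountable time sets are reached through dyadic skeletons throughout: measurability, the scaling
  law and the maximal inequality are facts about finitely many independent increments, followed by a
  limit.\<close>

lemma nn_integral_Ioi_eq_Ici:
  "(\<integral>\<^sup>+x\<in>{0::real<..}. f x \<partial>lborel) = (\<integral>\<^sup>+x\<in>{0..}. f x \<partial>lborel)"
  by (rule nn_integral_cong_AE, rule AE_mp[OF AE_lborel_singleton[of "0::real"]])
     (auto split: split_indicator)

lemma nn_integral_laplace_one_minus_cos:
  assumes s: "(s::real) > 0"
  shows "(\<integral>\<^sup>+x\<in>{0<..}. ennreal (exp (- (s * x)) * (1 - cos (c * x))) \<partial>lborel) =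
    ennreal (c\<^sup>2 / (s * (s\<^sup>2 + c\<^sup>2)))"
proof -
  \<comment> \<open>\<open>F\<close> is the sum of the elementary antiderivatives of
    \<open>exp (- (s * x))\<close> and of \<open>- exp (- (s * x)) * cos (c * x)\<close>; it
    vanishes at infinity, so the integral is \<open>- F 0\<close>.\<close>
  define F where "F = (\<lambda>x. - exp (- (s * x)) / s
      - exp (- (s * x)) * (c * sin (c * x) - s * cos (c * x)) / (s\<^sup>2 + c\<^sup>2))"
  have pos: "s\<^sup>2 + c\<^sup>2 > 0" using s by (simp add: add_pos_nonneg)
  have "(\<integral>\<^sup>+x\<in>{0<..}. ennreal (exp (- (s * x)) * (1 - cos (c * x))) \<partial>lborel) = ennreal (0 - F 0)"
    unfolding nn_integral_Ioi_eq_Ici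
  proof (rule nn_integral_FTC_atLeast)
    fix x :: real assume "0 \<le> x"
    show "(F has_real_derivative exp (- (s * x)) * (1 - cos (c * x))) (at x)"
      unfolding F_def using s pos
      by (auto intro!: derivative_eq_intros simp: divide_simps) (simp add: algebra_simps power2_eq_square)
  next
    have e: "((\<lambda>x. exp (- (s * x))) \<longlongrightarrow> 0) at_top"
      using s by real_asymp
    have "((\<lambda>x. (\<bar>c\<bar> + s) * exp (- (s * x))) \<longlongrightarrow> 0) at_top"
      using tendsto_mult_left[OF e, of "\<bar>c\<bar> + s"] by simp
    then have "((\<lambda>x. exp (- (s * x)) * (c * sin (c * x) - s * cos (c * x))) \<longlongrightarrow> 0) at_top"
    proof (rule Lim_null_comparison[rotated], intro always_eventually allI)
      fix x
      have "\<bar>c * sin (c * x) - s * cos (c * x)\<bar> \<le> \<bar>c * sin (c * x)\<bar> + \<bar>s * cos (c * x)\<bar>"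
        by linarith
      also have "\<dots> \<le> \<bar>c\<bar> * 1 + s * 1"
        unfolding abs_mult using s by (intro add_mono mult_mono) auto
      finally show "norm (exp (- (s * x)) * (c * sin (c * x) - s * cos (c * x))) \<le> (\<bar>c\<bar> + s) * exp (- (s * x))"
        by (simp add: abs_mult mult.commute)
    qed
    then show "(F \<longlongrightarrow> 0) at_top"
      unfolding F_def using tendsto_diff[OF tendsto_minus[OF tendsto_divide_zero[OF e, of s]] tendsto_divide_zero[of _ _ "s\<^sup>2 + c\<^sup>2"]]
      by fastforce
  qed auto
  also have "0 - F 0 = c\<^sup>2 / (s * (s\<^sup>2 + c\<^sup>2))"
    unfolding F_def using s pos by (simp add: divide_simps) (simp add: algebra_simps power2_eq_square)
  finally show ?thesis .
qed

text \<open>Euler's integral with the variable rescaled by \<open>u\<close>. Its role is to express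
  a power of \<open>u\<close> as a mixture of exponentials, which turns later integrals over
  \<open>u\<close> into Laplace transforms.\<close>

lemma nn_integral_powr_exp:
  assumes "(u::real) > 0" "b > 0"
  shows "(\<integral>\<^sup>+s\<in>{0<..}. ennreal (s powr (b - 1) * exp (- (s * u))) \<partial>lborel) =
    ennreal (Gamma b / u powr b)"
proof -
  have "ennreal (Gamma b) = (\<integral>\<^sup>+s. ennreal (indicator {0..} s * s powr (b - 1) / exp s) \<partial>lborel)"
    by (rule Gamma_conv_nn_integral_real[OF assms(2)])
  also have "\<dots> = \<bar>u\<bar> * (\<integral>\<^sup>+s. ennreal (indicator {0..} (0 + u * s) * (0 + u * s) powr (b - 1) / exp (0 + u * s)) \<partial>lborel)"
    using assms by (intro nn_integral_real_affine) auto
  also have "\<dots> = (\<integral>\<^sup>+s. ennreal (u powr b) * (ennreal (s powr (b - 1) * exp (- (s * u))) * indicator {0<..} s) \<partial>lborel)"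
    using assms
    apply (subst nn_integral_cmult[symmetric], simp)
    apply (intro nn_integral_cong)
    apply (auto split: split_indicator simp: ennreal_mult[symmetric] powr_mult powr_diff exp_minus field_simps zero_le_mult_iff)
    done
  also have "\<dots> = ennreal (u powr b) * (\<integral>\<^sup>+s\<in>{0<..}. ennreal (s powr (b - 1) * exp (- (s * u))) \<partial>lborel)"
    by (rule nn_integral_cmult) auto
  finally have eq: "ennreal (Gamma b) = \<dots>" .
  have "ennreal (Gamma b / u powr b) = ennreal (1 / u powr b) * ennreal (Gamma b)"
    by (subst ennreal_mult[symmetric]) (use assms in \<open>auto intro: less_imp_le Gamma_real_pos\<close>)
  also have "\<dots> = ennreal (1 / u powr b * u powr b) * (\<integral>\<^sup>+s\<in>{0<..}. ennreal (s powr (b - 1) * exp (- (s * u))) \<partial>lborel)"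
    unfolding eq by (subst ennreal_mult) (auto simp: mult.assoc)
  finally show ?thesis using assms by simp
qed

text \<open>Bridge between two integrals: order of integration is exchanged for the nonnegative
  integral, while substitution and signed linear combinations are carried out for the gauge
  integral.\<close>

lemma has_integral_iff_set_nn_integral:
  fixes f :: "real \<Rightarrow> real"
  assumes "S \<in> sets borel" "f \<in> borel_measurable borel" "\<And>x. x \<in> S \<Longrightarrow> 0 \<le> f x" "0 \<le> r"
  shows "(f has_integral r) S \<longleftrightarrow> (\<integral>\<^sup>+x\<in>S. ennreal (f x) \<partial>lborel) = ennreal r"
proof -
  note [measurable] = assms(1,2)
  have "(\<lambda>x. f x * indicator S x) \<in> borel_measurable borel" by measurable
  then have m: "(\<lambda>x. f x * indicator S x) \<in> borel_measurable lborel" by simp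
  have "(f has_integral r) S \<longleftrightarrow> ((\<lambda>x. f x * indicator S x) has_integral r) UNIV"
    by (subst has_integral_restrict_UNIV[symmetric])
       (intro arg_cong2[where f = "\<lambda>g S. (g has_integral r) S"], auto simp: indicator_def)
  also have "\<dots> \<longleftrightarrow> (\<integral>\<^sup>+x. ennreal (f x * indicator S x) \<partial>lborel) = ennreal r"
    using assms m measurable_completion[OF m]
    by (subst has_integral_iff_nn_integral_lebesgue) (auto split: split_indicator simp: nn_integral_completion)
  also have "(\<integral>\<^sup>+x. ennreal (f x * indicator S x) \<partial>lborel) = (\<integral>\<^sup>+x\<in>S. ennreal (f x) \<partial>lborel)"
    by (intro nn_integral_cong) (auto split: split_indicator)
  finally show ?thesis .
qed

text \<open>The substitution \<open>v = s^2\<close> reduces this to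
  \<open>nn_integral_powr_exp\<close> with exponent \<open>b / 2\<close>.\<close>

lemma nn_integral_powr_gauss:
  assumes "(r::real) > 0" "b > 0"
  shows "(\<integral>\<^sup>+s\<in>{0<..}. ennreal (s powr (b - 1) * exp (- (r * s\<^sup>2))) \<partial>lborel) =
    ennreal (Gamma (b / 2) / (2 * r powr (b / 2)))"
proof -
  define f where "f = (\<lambda>v::real. v powr (b / 2 - 1) * exp (- (v * r)))"
  have G: "Gamma (b / 2) > 0" using assms by (intro Gamma_real_pos) auto
  have f: "(f has_integral (Gamma (b / 2) / r powr (b / 2))) {0<..}"
    unfolding f_def using assms G
    by (subst has_integral_iff_set_nn_integral) (auto intro!: nn_integral_powr_exp)
  have im: "(\<lambda>s::real. s\<^sup>2) ` {0<..} = {0<..}"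
    by (auto simp: image_iff) (metis real_sqrt_gt_zero real_sqrt_pow2 less_imp_le greaterThan_iff)
  have f': "f absolutely_integrable_on {0<..}"
    using f by (intro nonnegative_absolutely_integrable_1) (auto simp: f_def)
  have "((\<lambda>s. \<bar>2 * s\<bar> * f (s\<^sup>2)) absolutely_integrable_on {0<..} \<and>
      integral {0<..} (\<lambda>s. \<bar>2 * s\<bar> * f (s\<^sup>2)) = Gamma (b / 2) / r powr (b / 2))"
    apply (subst has_absolute_integral_change_of_variables_1'[where g = "\<lambda>s. s\<^sup>2"])
    subgoal by simp
    subgoal by (auto intro!: derivative_eq_intros)
    subgoal by (auto simp: inj_on_def)
    subgoal unfolding im using f' f by auto
    done
  then have "((\<lambda>s. \<bar>2 * s\<bar> * f (s\<^sup>2)) has_integral (Gamma (b / 2) / r powr (b / 2))) {0<..}"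
    using set_lebesgue_integral_eq_integral(1) by (metis has_integral_integral)
  then have "((\<lambda>s. (1 / 2) * (\<bar>2 * s\<bar> * f (s\<^sup>2))) has_integral ((1 / 2) * (Gamma (b / 2) / r powr (b / 2)))) {0<..}"
    by (rule has_integral_mult_right)
  then have "((\<lambda>s. s powr (b - 1) * exp (- (r * s\<^sup>2))) has_integral ((1 / 2) * (Gamma (b / 2) / r powr (b / 2)))) {0<..}"
  proof (rule has_integral_cong[THEN iffD1, rotated])
    show "1 / 2 * (\<bar>2 * s\<bar> * f (s\<^sup>2)) = s powr (b - 1) * exp (- (r * s\<^sup>2))" if "s \<in> {0<..}" for s
    proof -
      have "(s\<^sup>2) powr (b / 2 - 1) = s powr (b - 2)"
        using that by (simp add: powr_powr algebra_simps flip: powr_numeral)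
      then have "s * (s\<^sup>2) powr (b / 2 - 1) = s powr (b - 1)"
        using that by (simp add: powr_power powr_mult_base)
      then show ?thesis
        using that by (simp add: f_def mult.commute)
    qed
  qed
  then show ?thesis
    using assms G by (subst (asm) has_integral_iff_set_nn_integral) auto
qed


lemma set_nn_integral_cmult:
  assumes "(c::real) \<ge> 0" "f \<in> borel_measurable M" "A \<in> sets M"
  shows "(\<integral>\<^sup>+x\<in>A. ennreal (c * f x) \<partial>M) = ennreal c * (\<integral>\<^sup>+x\<in>A. ennreal (f x) \<partial>M)"
  using assms by (subst nn_integral_cmult[symmetric]) (auto simp: ennreal_mult' mult.assoc)

text \<open>Isolates Tonelli's theorem for the evaluations below, each of which introduces a kernel
  \<open>k\<close> whose inner integral is elementary in either order.\<close>

lemma set_nn_integral_swap: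
  fixes k :: "real \<Rightarrow> real \<Rightarrow> real"
  assumes k: "case_prod k \<in> borel_measurable (borel \<Otimes>\<^sub>M borel)"
    and A: "A \<in> sets borel" and B: "B \<in> sets borel"
    and f: "\<And>x. x \<in> A \<Longrightarrow> (\<integral>\<^sup>+y\<in>B. ennreal (k x y) \<partial>lborel) = ennreal (f x)"
    and g: "\<And>y. y \<in> B \<Longrightarrow> (\<integral>\<^sup>+x\<in>A. ennreal (k x y) \<partial>lborel) = ennreal (g y)"
  shows "(\<integral>\<^sup>+x\<in>A. ennreal (f x) \<partial>lborel) = (\<integral>\<^sup>+y\<in>B. ennreal (g y) \<partial>lborel)"
proof -
  note [measurable] = A B
  have [measurable]: "(\<lambda>p. k (fst p) (snd p)) \<in> borel_measurable (borel \<Otimes>\<^sub>M borel)"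
    using k by (simp add: case_prod_beta')
  have k': "(\<lambda>y. k x y) \<in> borel_measurable borel" "(\<lambda>y. k y x) \<in> borel_measurable borel" for x
    using measurable_Pair2[OF k, of x] measurable_Pair1[OF k, of x] by auto
  have "(\<integral>\<^sup>+x\<in>A. ennreal (f x) \<partial>lborel) =
      (\<integral>\<^sup>+x. \<integral>\<^sup>+y. ennreal (k x y) * indicator B y * indicator A x \<partial>lborel \<partial>lborel)"
    using k' by (intro nn_integral_cong) (auto simp: f[symmetric] split: split_indicator)
  also have "\<dots> = (\<integral>\<^sup>+y. \<integral>\<^sup>+x. ennreal (k x y) * indicator B y * indicator A x \<partial>lborel \<partial>lborel)"
    by (rule lborel_pair.Fubini'[symmetric]) measurable
  also have "\<dots> = (\<integral>\<^sup>+y\<in>B. ennreal (g y) \<partial>lborel)"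
    using k' by (intro nn_integral_cong) (auto simp: g[symmetric] split: split_indicator)
  finally show ?thesis .
qed

text \<open>Two kernels in succession: the power of \<open>u\<close> is written as a Laplace
  integral in \<open>s\<close>, then \<open>1 / (s^2 + c^2)\<close> as an integral of exponentials
  in \<open>r\<close>. All that remains are Gamma integrals; \<open>b < 2\<close> keeps the last
  exponent \<open>1 - b / 2\<close> positive.\<close>

lemma nn_integral_one_minus_cos_powr:
  assumes c: "(c::real) > 0" and b: "0 < b" "b < 2"
  shows "(\<integral>\<^sup>+u\<in>{0<..}. ennreal ((1 - cos (c * u)) / u powr (1 + b)) \<partial>lborel) =
    ennreal (c powr b * (Gamma (b / 2) * Gamma (1 - b / 2)) / (2 * Gamma (1 + b)))"
proof -
  let ?S = "{0::real<..}"
  define G where "G = Gamma (b / 2) * Gamma (1 - b / 2) / 2"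
  have pos: "Gamma (1 + b) > 0" "Gamma (b / 2) > 0" "Gamma (1 - b / 2) > 0"
    using b by (auto intro!: Gamma_real_pos)
  have "(\<integral>\<^sup>+u\<in>?S. ennreal ((1 - cos (c * u)) * (Gamma (1 + b) / u powr (1 + b))) \<partial>lborel) =
    (\<integral>\<^sup>+s\<in>?S. ennreal (s powr b * (c\<^sup>2 / (s * (s\<^sup>2 + c\<^sup>2)))) \<partial>lborel)"
  proof (rule set_nn_integral_swap)
    fix u :: real assume u: "u \<in> ?S"
    show "(\<integral>\<^sup>+s\<in>?S. ennreal ((1 - cos (c * u)) * (s powr b * exp (- (s * u)))) \<partial>lborel) =
      ennreal ((1 - cos (c * u)) * (Gamma (1 + b) / u powr (1 + b)))"
      using u b nn_integral_powr_exp[of u "1 + b"]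
      by (subst set_nn_integral_cmult) (simp_all add: ennreal_mult'[symmetric])
  next
    fix s :: real assume s: "s \<in> ?S"
    have "(\<integral>\<^sup>+u\<in>?S. ennreal ((1 - cos (c * u)) * (s powr b * exp (- (s * u)))) \<partial>lborel) =
      (\<integral>\<^sup>+u\<in>?S. ennreal (s powr b * (exp (- (s * u)) * (1 - cos (c * u)))) \<partial>lborel)"
      by (simp add: algebra_simps)
    also have "\<dots> = ennreal (s powr b * (c\<^sup>2 / (s * (s\<^sup>2 + c\<^sup>2))))"
      using s nn_integral_laplace_one_minus_cos[of s c]
      by (subst set_nn_integral_cmult) (simp_all add: ennreal_mult'[symmetric])
    finally show "(\<integral>\<^sup>+u\<in>?S. ennreal ((1 - cos (c * u)) * (s powr b * exp (- (s * u)))) \<partial>lborel) = \<dots>" .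
  qed auto
  also have "\<dots> = (\<integral>\<^sup>+s\<in>?S. ennreal (c\<^sup>2 * s powr (b - 1) * (1 / (s\<^sup>2 + c\<^sup>2))) \<partial>lborel)"
    by (intro nn_integral_cong) (auto simp: powr_diff split: split_indicator)
  \<comment> \<open>The kernel contains \<open>r powr (1 - 1)\<close>, which is 1 on the positive
    axis; this form lets \<open>nn_integral_powr_exp\<close> match with exponent 1.\<close>
  also have "\<dots> = (\<integral>\<^sup>+r\<in>?S. ennreal (c\<^sup>2 * exp (- (r * c\<^sup>2)) * (Gamma (b / 2) / (2 * r powr (b / 2)))) \<partial>lborel)"
  proof (rule set_nn_integral_swap)
    fix s :: real assume s: "s \<in> ?S"
    have "s\<^sup>2 + c\<^sup>2 > 0" using s by (simp add: add_pos_nonneg)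
    then show "(\<integral>\<^sup>+r\<in>?S. ennreal ((c\<^sup>2 * s powr (b - 1)) * (r powr (1 - 1) * exp (- (r * (s\<^sup>2 + c\<^sup>2))))) \<partial>lborel) =
      ennreal ((c\<^sup>2 * s powr (b - 1)) * (1 / (s\<^sup>2 + c\<^sup>2)))"
      using s nn_integral_powr_exp[of "s\<^sup>2 + c\<^sup>2" 1]
      by (subst set_nn_integral_cmult) (simp_all add: ennreal_mult'[symmetric])
  next
    fix r :: real assume r: "r \<in> ?S"
    have "(\<integral>\<^sup>+s\<in>?S. ennreal ((c\<^sup>2 * s powr (b - 1)) * (r powr (1 - 1) * exp (- (r * (s\<^sup>2 + c\<^sup>2))))) \<partial>lborel) =
      (\<integral>\<^sup>+s\<in>?S. ennreal ((c\<^sup>2 * exp (- (r * c\<^sup>2))) * (s powr (b - 1) * exp (- (r * s\<^sup>2)))) \<partial>lborel)"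
      using r by (simp add: algebra_simps exp_add exp_diff exp_minus inverse_eq_divide)
    also have "\<dots> = ennreal (c\<^sup>2 * exp (- (r * c\<^sup>2)) * (Gamma (b / 2) / (2 * r powr (b / 2))))"
      using r b nn_integral_powr_gauss[of r b]
      by (subst set_nn_integral_cmult) (simp_all add: ennreal_mult'[symmetric])
    finally show "(\<integral>\<^sup>+s\<in>?S. ennreal ((c\<^sup>2 * s powr (b - 1)) * (r powr (1 - 1) * exp (- (r * (s\<^sup>2 + c\<^sup>2))))) \<partial>lborel) = \<dots>" .
  qed auto
  also have "\<dots> = (\<integral>\<^sup>+r\<in>?S. ennreal ((c\<^sup>2 * Gamma (b / 2) / 2) * (r powr ((1 - b / 2) - 1) * exp (- (r * c\<^sup>2)))) \<partial>lborel)"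
    by (intro nn_integral_cong) (auto simp: powr_minus field_simps split: split_indicator)
  also have "\<dots> = ennreal ((c\<^sup>2 * Gamma (b / 2) / 2) * (Gamma (1 - b / 2) / (c\<^sup>2) powr (1 - b / 2)))"
    using b c pos nn_integral_powr_exp[of "c\<^sup>2" "1 - b / 2"]
    by (subst set_nn_integral_cmult) (simp_all add: ennreal_mult'[symmetric])
  also have "(c\<^sup>2) powr (1 - b / 2) = c\<^sup>2 / c powr b"
    using c by (simp add: powr_diff powr_powr flip: powr_numeral)
  finally have "(\<integral>\<^sup>+u\<in>?S. ennreal (Gamma (1 + b) * ((1 - cos (c * u)) / u powr (1 + b))) \<partial>lborel) =
      ennreal (c powr b * G)"
    using c by (simp add: algebra_simps G_def)
  then have eq: "ennreal (Gamma (1 + b)) * (\<integral>\<^sup>+u\<in>?S. ennreal ((1 - cos (c * u)) / u powr (1 + b)) \<partial>lborel) =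
      ennreal (c powr b * G)"
    using pos by (subst (asm) set_nn_integral_cmult) auto
  have "ennreal (c powr b * G / Gamma (1 + b)) = ennreal (1 / Gamma (1 + b)) * ennreal (c powr b * G)"
    using pos by (subst ennreal_mult[symmetric]) (auto simp: G_def)
  also have "\<dots> = ennreal (1 / Gamma (1 + b) * Gamma (1 + b)) *
      (\<integral>\<^sup>+u\<in>?S. ennreal ((1 - cos (c * u)) / u powr (1 + b)) \<partial>lborel)"
    unfolding eq[symmetric] using pos by (subst ennreal_mult) (auto simp: mult.assoc)
  finally show ?thesis
    using pos by (simp add: G_def)
qed

text \<open>The exponent \<open>b = 1\<close> of the preceding formula, where the square of
  \<open>Gamma (1 / 2)\<close> is \<open>pi\<close>; evenness of the cosine produces the absolute
  value.\<close>

lemma has_integral_one_minus_cos: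
  "((\<lambda>u. (1 - cos (x * u)) / u\<^sup>2) has_integral (pi / 2 * \<bar>x\<bar>)) {0<..}"
proof (cases "x = 0")
  case False
  have *: "cos (\<bar>x\<bar> * u) = cos (x * u)" for u
    by (cases "x \<ge> 0") (auto simp: abs_if)
  have G: "Gamma (1 / 2 :: real) * Gamma (1 / 2) = pi"
    using Gamma_one_half_real by simp
  have "(\<integral>\<^sup>+u\<in>{0<..}. ennreal ((1 - cos (x * u)) / u\<^sup>2) \<partial>lborel) =
      (\<integral>\<^sup>+u\<in>{0<..}. ennreal ((1 - cos (\<bar>x\<bar> * u)) / u powr (1 + 1)) \<partial>lborel)"
    unfolding * by (intro nn_integral_cong) (auto split: split_indicator)
  also have "\<dots> = ennreal (pi / 2 * \<bar>x\<bar>)"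
    using False G Gamma_numeral[of "Num.Bit0 Num.One", where 'a = real]
    by (subst nn_integral_one_minus_cos_powr) (auto simp: algebra_simps)
  finally show ?thesis
    by (subst has_integral_iff_set_nn_integral) auto
qed simp

text \<open>Product-to-sum formulas split the numerator into terms \<open>1 - cos (y * u)\<close>
  with \<open>y\<close> equal to \<open>x\<close>, \<open>L\<close>, \<open>x + L\<close> and
  \<open>x - L\<close>. The value follows because \<open>(|x + L| + |x - L|) / 2\<close> is the
  maximum of \<open>|x|\<close> and \<open>L\<close>.\<close>

lemma has_integral_min_abs:
  assumes "L \<ge> 0"
  shows "((\<lambda>u. (1 - cos (x * u)) * (1 - cos (L * u)) / u\<^sup>2) has_integral (pi / 2 * min L \<bar>x\<bar>)) {0<..}"
proof -
  have "((\<lambda>u. (1 - cos (x * u)) / u\<^sup>2 + (1 - cos (L * u)) / u\<^sup>2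
        - (1 / 2) * ((1 - cos ((x + L) * u)) / u\<^sup>2) - (1 / 2) * ((1 - cos ((x - L) * u)) / u\<^sup>2))
      has_integral (pi / 2 * \<bar>x\<bar> + pi / 2 * \<bar>L\<bar> - (1 / 2) * (pi / 2 * \<bar>x + L\<bar>) - (1 / 2) * (pi / 2 * \<bar>x - L\<bar>))) {0<..}"
    by (intro has_integral_add has_integral_diff has_integral_mult_right has_integral_one_minus_cos)
  also have "pi / 2 * \<bar>x\<bar> + pi / 2 * \<bar>L\<bar> - (1 / 2) * (pi / 2 * \<bar>x + L\<bar>) - (1 / 2) * (pi / 2 * \<bar>x - L\<bar>)
      = pi / 2 * (\<bar>x\<bar> + \<bar>L\<bar> - \<bar>x + L\<bar> / 2 - \<bar>x - L\<bar> / 2)"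
    by (simp add: algebra_simps)
  also have "\<bar>x\<bar> + \<bar>L\<bar> - \<bar>x + L\<bar> / 2 - \<bar>x - L\<bar> / 2 = min L \<bar>x\<bar>"
    using assms by (auto simp: abs_if min_def field_simps)
  finally show ?thesis
  proof (rule has_integral_cong[THEN iffD1, rotated])
    fix u :: real
    have "(1 - cos (x * u)) / u\<^sup>2 + (1 - cos (L * u)) / u\<^sup>2
        - (1 / 2) * ((1 - cos ((x + L) * u)) / u\<^sup>2) - (1 / 2) * ((1 - cos ((x - L) * u)) / u\<^sup>2) =
      ((1 - cos (x * u)) + (1 - cos (L * u)) - (1 - cos (x * u + L * u)) / 2 - (1 - cos (x * u - L * u)) / 2) / u\<^sup>2"
      by (simp add: add_divide_distrib diff_divide_distrib ring_distribs)
    also have "(1 - cos (x * u)) + (1 - cos (L * u)) - (1 - cos (x * u + L * u)) / 2 - (1 - cos (x * u - L * u)) / 2 =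
      (1 - cos (x * u)) * (1 - cos (L * u))"
      unfolding cos_add cos_diff by (simp add: field_simps)
    finally show "(1 - cos (x * u)) / u\<^sup>2 + (1 - cos (L * u)) / u\<^sup>2
        - (1 / 2) * ((1 - cos ((x + L) * u)) / u\<^sup>2) - (1 / 2) * ((1 - cos ((x - L) * u)) / u\<^sup>2) =
      (1 - cos (x * u)) * (1 - cos (L * u)) / u\<^sup>2" .
  qed
qed

lemma set_nn_integral_Ioi_split:
  assumes "t > (0::real)" "f \<in> borel_measurable borel"
  shows "(\<integral>\<^sup>+x\<in>{0<..}. f x \<partial>lborel) = (\<integral>\<^sup>+x\<in>{0..t}. f x \<partial>lborel) + (\<integral>\<^sup>+x\<in>{t..}. f x \<partial>lborel)"
proof -
  have "(\<integral>\<^sup>+x\<in>{0<..}. f x \<partial>lborel) = (\<integral>\<^sup>+x. f x * indicator {0..t} x + f x * indicator {t..} x \<partial>lborel)"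
  proof (rule nn_integral_cong_AE,
      use AE_lborel_singleton[of "0::real"] AE_lborel_singleton[of t] in eventually_elim)
    case (elim x)
    then show ?case using assms(1) by (auto split: split_indicator)
  qed
  then show ?thesis using assms(2) by (simp add: nn_integral_add)
qed

text \<open>Laplace representations with the weight \<open>min s t\<close>; for \<open>\<alpha> = 1\<close> they evaluate
  \<open>E min(L, |X\<^sub>t|)\<close> in closed form.\<close>

lemma nn_integral_min_exp:
  assumes t: "t > 0" and x: "(x::real) > 0"
  shows "(\<integral>\<^sup>+s\<in>{0<..}. ennreal (min s t * exp (- (s * x))) \<partial>lborel) = ennreal ((1 - exp (- (t * x))) / x\<^sup>2)"
proof -
  define F where "F = (\<lambda>s. - (s * exp (- (s * x)) / x) - exp (- (s * x)) / x\<^sup>2)"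
  define H where "H = (\<lambda>s. - (t * exp (- (s * x)) / x))"
  have "(\<integral>\<^sup>+s\<in>{0..t}. ennreal (min s t * exp (- (s * x))) \<partial>lborel) =
      (\<integral>\<^sup>+s\<in>{0..t}. ennreal (s * exp (- (s * x))) \<partial>lborel)"
    by (intro nn_integral_cong) (auto split: split_indicator)
  also have "\<dots> = F t - F 0"
    using t x unfolding F_def
    by (intro nn_integral_FTC_Icc)
       (auto intro!: derivative_eq_intros simp: field_simps power2_eq_square has_real_derivative_iff_has_vector_derivative[symmetric])
  finally have 1: "(\<integral>\<^sup>+s\<in>{0..t}. ennreal (min s t * exp (- (s * x))) \<partial>lborel) = ennreal (F t - F 0)" .
  have "(\<integral>\<^sup>+s\<in>{t..}. ennreal (min s t * exp (- (s * x))) \<partial>lborel) =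
      (\<integral>\<^sup>+s\<in>{t..}. ennreal (t * exp (- (s * x))) \<partial>lborel)"
    by (intro nn_integral_cong) (auto split: split_indicator)
  also have "\<dots> = ennreal (0 - H t)"
  proof (rule nn_integral_FTC_atLeast)
    show "(H \<longlongrightarrow> 0) at_top" unfolding H_def using x by real_asymp
  qed (use t x in \<open>auto intro!: derivative_eq_intros simp: H_def\<close>)
  finally have 2: "(\<integral>\<^sup>+s\<in>{t..}. ennreal (min s t * exp (- (s * x))) \<partial>lborel) = ennreal (0 - H t)" .
  have "F t - F 0 = (1 - exp (- (t * x))) / x\<^sup>2 - t * exp (- (t * x)) / x"
    by (simp add: F_def diff_divide_distrib)
  moreover have "ennreal (F t - F 0) + ennreal (0 - H t) = ennreal (F t - F 0 + (0 - H t))"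
  proof (rule ennreal_plus[symmetric])
    \<comment> \<open>Nonnegativity has to be settled before adding, since \<open>ennreal\<close>
      sends negative reals to 0; it amounts to \<open>1 + t * x <= exp (t * x)\<close>.\<close>
    have "exp (- (t * x)) * (1 + t * x) \<le> exp (- (t * x)) * exp (t * x)"
      using exp_ge_add_one_self[of "t * x"] by (intro mult_left_mono) auto
    also have "exp (- (t * x)) * exp (t * x) = 1" by (simp flip: exp_add)
    finally have "1 - exp (- (t * x)) - t * x * exp (- (t * x)) \<ge> 0"
      by (simp add: algebra_simps)
    moreover have "F t - F 0 = (1 - exp (- (t * x)) - t * x * exp (- (t * x))) / x\<^sup>2"
      using x by (simp add: F_def field_simps power2_eq_square)
    ultimately show "0 \<le> F t - F 0" by simp
  qed (use t x in \<open>simp add: H_def\<close>)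
  ultimately show ?thesis
    using t x unfolding set_nn_integral_Ioi_split[OF t, of "\<lambda>s. ennreal (min s t * exp (- (s * x)))", simplified] 1 2
    by (simp add: H_def)
qed

lemma nn_integral_min_rational:
  assumes t: "t > 0" and L: "(L::real) > 0"
  shows "(\<integral>\<^sup>+s\<in>{0<..}. ennreal (min s t * (L\<^sup>2 / (s * (s\<^sup>2 + L\<^sup>2)))) \<partial>lborel) =
    ennreal (L * arctan (t / L) + t / 2 * ln (1 + (L / t)\<^sup>2))"
proof -
  define F where "F = (\<lambda>s. L * arctan (s / L))"
  define H where "H = (\<lambda>s. - (t / 2 * ln (1 + (L / s)\<^sup>2)))"
  have pos: "s\<^sup>2 + L\<^sup>2 > 0" "1 + (s / L)\<^sup>2 > 0" for s
    using L by (auto simp: add_nonneg_pos add_pos_nonneg)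
  have "(\<integral>\<^sup>+s\<in>{0..t}. ennreal (min s t * (L\<^sup>2 / (s * (s\<^sup>2 + L\<^sup>2)))) \<partial>lborel) =
      (\<integral>\<^sup>+s\<in>{0..t}. ennreal (L\<^sup>2 / (s\<^sup>2 + L\<^sup>2)) \<partial>lborel)"
  \<comment> \<open>At \<open>s = 0\<close> the left integrand is 0, through division by zero, while
    the right one is 1, so the two agree only almost everywhere.\<close>
  proof (rule nn_integral_cong_AE, use AE_lborel_singleton[of "0::real"] in eventually_elim)
    case (elim s)
    then show ?case
      by (cases "s \<in> {0..t}") (simp_all add: min_absorb1)
  qed
  also have "\<dots> = F t - F 0"
  proof (rule nn_integral_FTC_Icc)
    fix s
    have "((\<lambda>s. L * arctan (s / L)) has_real_derivative L * (inverse (1 + (s / L)\<^sup>2) * (1 / L))) (at s)"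
      by (auto intro!: derivative_eq_intros)
    also have "L * (inverse (1 + (s / L)\<^sup>2) * (1 / L)) = 1 / (1 + (s / L)\<^sup>2)"
      using L by (simp add: inverse_eq_divide)
    also have "1 + (s / L)\<^sup>2 = (s\<^sup>2 + L\<^sup>2) / L\<^sup>2"
      using L by (simp add: power_divide add_divide_distrib)
    finally have "(F has_real_derivative L\<^sup>2 / (s\<^sup>2 + L\<^sup>2)) (at s)"
      by (simp add: F_def)
    then show "(F has_real_derivative L\<^sup>2 / (s\<^sup>2 + L\<^sup>2)) (at s)" .
  qed (use t pos in \<open>auto\<close>)
  finally have 1: "(\<integral>\<^sup>+s\<in>{0..t}. ennreal (min s t * (L\<^sup>2 / (s * (s\<^sup>2 + L\<^sup>2)))) \<partial>lborel) = ennreal (F t)"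
    by (simp add: F_def)
  have "(\<integral>\<^sup>+s\<in>{t..}. ennreal (min s t * (L\<^sup>2 / (s * (s\<^sup>2 + L\<^sup>2)))) \<partial>lborel) =
      (\<integral>\<^sup>+s\<in>{t..}. ennreal (t * (L\<^sup>2 / (s * (s\<^sup>2 + L\<^sup>2)))) \<partial>lborel)"
    by (intro nn_integral_cong) (auto split: split_indicator)
  also have "\<dots> = ennreal (0 - H t)"
  proof (rule nn_integral_FTC_atLeast)
    show "(H \<longlongrightarrow> 0) at_top" unfolding H_def using t L by real_asymp
    fix s assume s: "t \<le> s"
    then have "s > 0" "1 + (L / s)\<^sup>2 > 0" using t by (auto simp: add_pos_nonneg)
    have "((\<lambda>s. 1 + (L / s)\<^sup>2) has_real_derivative - (2 * L\<^sup>2 / (s * s\<^sup>2))) (at s)"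
      using \<open>s > 0\<close> by (auto intro!: derivative_eq_intros simp: power2_eq_square)
    from DERIV_chain2[OF DERIV_ln_divide this] \<open>1 + (L / s)\<^sup>2 > 0\<close>
    have "((\<lambda>s. - (t / 2 * ln (1 + (L / s)\<^sup>2))) has_real_derivative
        - (t / 2 * (1 / (1 + (L / s)\<^sup>2) * - (2 * L\<^sup>2 / (s * s\<^sup>2))))) (at s)"
      by (intro DERIV_minus DERIV_cmult)
    also have "- (t / 2 * (1 / (1 + (L / s)\<^sup>2) * - (2 * L\<^sup>2 / (s * s\<^sup>2)))) = t * (L\<^sup>2 / (s * (s\<^sup>2 + L\<^sup>2)))"
    proof -
      have eq: "1 + (L / s)\<^sup>2 = (s\<^sup>2 + L\<^sup>2) / s\<^sup>2"
        using \<open>s > 0\<close> by (simp add: power_divide add_divide_distrib)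
      show ?thesis
        unfolding eq using \<open>s > 0\<close> pos(1)[of s] by (simp add: divide_simps)
    qed
    finally show "(H has_real_derivative t * (L\<^sup>2 / (s * (s\<^sup>2 + L\<^sup>2)))) (at s)"
      unfolding H_def .
  qed (use t L in \<open>auto simp: H_def\<close>)
  finally have 2: "(\<integral>\<^sup>+s\<in>{t..}. ennreal (min s t * (L\<^sup>2 / (s * (s\<^sup>2 + L\<^sup>2)))) \<partial>lborel) = ennreal (- H t)"
    by simp
  have "0 \<le> F t" "0 \<le> - H t" using t L by (auto simp: F_def H_def)
  then have "ennreal (F t) + ennreal (- H t) = ennreal (L * arctan (t / L) + t / 2 * ln (1 + (L / t)\<^sup>2))"
    by (subst ennreal_plus[symmetric]) (auto simp: H_def F_def)
  then show ?thesis
    by (subst set_nn_integral_Ioi_split[OF t]) (simp_all only: 1 2, measurable)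
qed

text \<open>The kernel is \<open>(1 - cos (L * x)) * min s t * exp (- (s * x))\<close>: integrating
  out \<open>s\<close> gives the wanted integrand, integrating out \<open>x\<close> the rational
  function of the preceding evaluation.\<close>

lemma nn_integral_cauchy_trunc:
  assumes t: "t > 0" and L: "(L::real) > 0"
  shows "(\<integral>\<^sup>+x\<in>{0<..}. ennreal ((1 - exp (- (t * x))) * (1 - cos (L * x)) / x\<^sup>2) \<partial>lborel) =
    ennreal (L * arctan (t / L) + t / 2 * ln (1 + (L / t)\<^sup>2))"
proof -
  have "(\<integral>\<^sup>+x\<in>{0<..}. ennreal ((1 - cos (L * x)) * ((1 - exp (- (t * x))) / x\<^sup>2)) \<partial>lborel) =
     (\<integral>\<^sup>+s\<in>{0<..}. ennreal (min s t * (L\<^sup>2 / (s * (s\<^sup>2 + L\<^sup>2)))) \<partial>lborel)"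
  proof (rule set_nn_integral_swap)
    fix x :: real assume "x \<in> {0<..}"
    then show "(\<integral>\<^sup>+s\<in>{0<..}. ennreal ((1 - cos (L * x)) * (min s t * exp (- (s * x)))) \<partial>lborel) =
        ennreal ((1 - cos (L * x)) * ((1 - exp (- (t * x))) / x\<^sup>2))"
      using nn_integral_min_exp[OF t, of x]
      by (subst set_nn_integral_cmult) (simp_all add: ennreal_mult'[symmetric])
  next
    fix s :: real assume s: "s \<in> {0<..}"
    have "(\<integral>\<^sup>+x\<in>{0<..}. ennreal ((1 - cos (L * x)) * (min s t * exp (- (s * x)))) \<partial>lborel) =
        (\<integral>\<^sup>+x\<in>{0<..}. ennreal (min s t * (exp (- (s * x)) * (1 - cos (L * x)))) \<partial>lborel)"
      by (simp add: algebra_simps)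
    also have "\<dots> = ennreal (min s t * (L\<^sup>2 / (s * (s\<^sup>2 + L\<^sup>2))))"
      using s t nn_integral_laplace_one_minus_cos[of s L]
      by (subst set_nn_integral_cmult) (simp_all add: ennreal_mult'[symmetric])
    finally show "(\<integral>\<^sup>+x\<in>{0<..}. ennreal ((1 - cos (L * x)) * (min s t * exp (- (s * x)))) \<partial>lborel) = \<dots>" .
  qed auto
  then show ?thesis
    unfolding nn_integral_min_rational[OF assms] by (simp add: mult.commute)
qed

text \<open>The arctangent term is of order \<open>t\<close>, whereas
  \<open>ln (1 + (L / t)^2)\<close> grows like \<open>2 ln (1 / t)\<close>, so the factor
  \<open>t / 2\<close> leaves \<open>t ln (1 / t)\<close> with constant 1.\<close>

lemma cauchy_trunc_asymp:
  assumes "(L::real) > 0"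
  shows "((\<lambda>t. (L * arctan (t / L) + t / 2 * ln (1 + (L / t)\<^sup>2)) / (t * ln (1 / t))) \<longlongrightarrow> 1) (at_right 0)"
  using assms by real_asymp

section \<open>Real Gamma identities and the constant of the Levy density\<close>

lemma Gamma_reflection_real:
  "Gamma x * Gamma (1 - x) = pi / sin (pi * x)" for x :: real
proof -
  have "1 - complex_of_real x = complex_of_real (1 - x)"
    "sin (complex_of_real pi * complex_of_real x) = complex_of_real (sin (pi * x))"
    by (simp_all flip: sin_of_real)
  then have "complex_of_real (Gamma x * Gamma (1 - x)) = complex_of_real (pi / sin (pi * x))"
    using Gamma_reflection_complex[of "of_real x"]
    by (simp only: Gamma_complex_of_real of_real_mult of_real_divide)
  then show ?thesis by (simp only: of_real_eq_iff)
qed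

lemma Gamma_legendre_duplication_real:
  fixes x :: real
  assumes "x > 0"
  shows "Gamma x * Gamma (x + 1 / 2) = 2 powr (1 - 2 * x) * sqrt pi * Gamma (2 * x)"
proof -
  have "complex_of_real x \<notin> \<int>\<^sub>\<le>\<^sub>0" "complex_of_real (x + 1 / 2) \<notin> \<int>\<^sub>\<le>\<^sub>0"
    unfolding of_real_in_nonpos_Ints_iff using assms by (auto elim!: nonpos_Ints_cases')
  moreover have "complex_of_real x + 1 / 2 = complex_of_real (x + 1 / 2)"
    "2 * complex_of_real x = complex_of_real (2 * x)"
    "exp ((1 - complex_of_real (2 * x)) * of_real (ln 2)) = complex_of_real (exp ((1 - 2 * x) * ln 2))"
    by (simp_all only: of_real_mult of_real_numeral of_real_add of_real_divide of_real_1 of_real_diff exp_of_real[symmetric])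
  ultimately have "complex_of_real (Gamma x * Gamma (x + 1 / 2)) =
      complex_of_real (exp ((1 - 2 * x) * ln 2) * sqrt pi * Gamma (2 * x))"
    using Gamma_legendre_duplication[of "of_real x"]
    by (simp only: Gamma_complex_of_real simp_thms) (simp only: of_real_mult)
  then show ?thesis by (simp only: of_real_eq_iff) (simp add: powr_def)
qed

text \<open>Matches the constant of the cosine integral for \<open>b = 1 - a\<close> with the Levy
  density. Reflection gives the numerator \<open>pi / cos (pi * a / 2)\<close>; reflection at
  \<open>a\<close> and the double angle formula trade it for
  \<open>2 * sin (pi * a / 2) * Gamma a * Gamma (1 - a)\<close>; Legendre duplication reduces
  \<open>stable_const a\<close> to \<open>a * sin (pi * a / 2) * Gamma a / pi\<close>.\<close>

lemma stable_const_altdef: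
  assumes "0 < a" "a < 1"
  shows "Gamma ((1 - a) / 2) * Gamma (1 - (1 - a) / 2) / (2 * Gamma (1 + (1 - a))) =
    pi * stable_const a / (a * (1 - a))"
proof -
  have na: "1 - a \<notin> \<int>\<^sub>\<le>\<^sub>0"
    using assms by (auto elim!: nonpos_Ints_cases')
  have sn: "sin (pi * a / 2) > 0" "cos (pi * a / 2) > 0"
    using assms by (auto intro!: sin_gt_zero cos_gt_zero simp: field_simps)
  have G: "Gamma a > 0" "Gamma (1 - a) > 0" using assms by (auto intro!: Gamma_real_pos)
  have "Gamma ((1 - a) / 2) * Gamma (1 - (1 - a) / 2) = pi / sin (pi * ((1 - a) / 2))"
    by (rule Gamma_reflection_real)
  also have "sin (pi * ((1 - a) / 2)) = cos (pi * a / 2)"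
    by (simp add: cos_sin_eq field_simps)
  finally have 1: "Gamma ((1 - a) / 2) * Gamma (1 - (1 - a) / 2) = pi / cos (pi * a / 2)" .
  have 2: "Gamma (1 + (1 - a)) = (1 - a) * Gamma (1 - a)"
    using Gamma_plus1[OF na] by (simp add: add.commute)
  have "Gamma a * Gamma (1 - a) = pi / sin (pi * a)" by (rule Gamma_reflection_real)
  also have "sin (pi * a) = 2 * sin (pi * a / 2) * cos (pi * a / 2)"
    using sin_double[of "pi * a / 2"] by simp
  finally have 3: "Gamma a * Gamma (1 - a) * (2 * sin (pi * a / 2) * cos (pi * a / 2)) = pi"
    using sn by (simp add: field_simps)
  have "Gamma (a / 2) * Gamma ((1 + a) / 2) = 2 powr (1 - a) * sqrt pi * Gamma a"
    using Gamma_legendre_duplication_real[of "a / 2"] assms by (simp add: add_divide_distrib mult_ac add_ac)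
  then have "stable_const a = a * 2 powr (a - 1) * pi powr (- (3 / 2)) * sin (pi * a / 2) *
      (2 powr (1 - a) * sqrt pi * Gamma a)"
    by (simp add: stable_const_def mult_ac)
  also have "\<dots> = a * sin (pi * a / 2) * Gamma a * (2 powr (a - 1) * 2 powr (1 - a)) * (pi powr (- (3 / 2)) * pi powr (1 / 2))"
    by (simp add: powr_half_sqrt mult_ac)
  also have "\<dots> = a * sin (pi * a / 2) * Gamma a / pi"
    by (subst (1 2) powr_add[symmetric]) (simp add: powr_minus_divide)
  finally have 4: "stable_const a = a * sin (pi * a / 2) * Gamma a / pi" .
  show ?thesis
  proof -
    have "pi / cos (pi * a / 2) = Gamma a * Gamma (1 - a) * (2 * sin (pi * a / 2) * cos (pi * a / 2)) / cos (pi * a / 2)"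
      by (simp only: 3)
    also have "\<dots> = Gamma a * Gamma (1 - a) * (2 * sin (pi * a / 2))"
      using sn by simp
    finally have "pi / cos (pi * a / 2) = Gamma a * Gamma (1 - a) * (2 * sin (pi * a / 2))" .
    then show ?thesis
      unfolding 1 2 4 using G assms less_imp_neq[OF G(2)] by (simp only:) (simp add: field_simps)
  qed
qed

subsection \<open>The fractional perimeter of an interval\<close>

lemma nn_integral_reflect:
  fixes c :: real
  assumes "f \<in> borel_measurable borel"
  shows "(\<integral>\<^sup>+x. f x \<partial>lborel) = (\<integral>\<^sup>+x. f (c - x) \<partial>lborel)"
  using nn_integral_real_affine[OF assms, of "-1" c] by simp

lemma nn_integral_tail_powr:
  assumes "0 < (d::real)" "0 < p"
  shows "(\<integral>\<^sup>+y\<in>{d..}. ennreal (1 / y powr (1 + p)) \<partial>lborel) = ennreal (d powr (- p) / p)"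
proof -
  have "(\<integral>\<^sup>+y\<in>{d..}. ennreal (y powr (- 1 - p)) \<partial>lborel) = ennreal (0 - (- (d powr (- p) / p)))"
  proof (rule nn_integral_FTC_atLeast)
    show "((\<lambda>y. - (y powr (- p) / p)) \<longlongrightarrow> 0) at_top"
      using assms by real_asymp
    show "((\<lambda>y. - (y powr (- p) / p)) has_real_derivative y powr (- 1 - p)) (at y)" if "d \<le> y" for y
    proof -
      have "((\<lambda>y. (- 1 / p) * y powr (- p)) has_real_derivative (- 1 / p) * (- p * y powr (- p - 1))) (at y)"
        using assms that by (intro DERIV_cmult has_real_derivative_powr) auto
      moreover have "- p - 1 = - 1 - p" by simp
      ultimately show ?thesis using assms by simp
    qed
  qed auto
  also have "(\<integral>\<^sup>+y\<in>{d..}. ennreal (y powr (- 1 - p)) \<partial>lborel) = (\<integral>\<^sup>+y\<in>{d..}. ennreal (1 / y powr (1 + p)) \<partial>lborel)"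
    using powr_minus_divide[of _ "1 + p"] by (simp add: algebra_simps)
  finally show ?thesis by simp
qed

lemma nn_integral_powr_Ioo:
  assumes "0 < p" "p < 1" "0 < (L::real)"
  shows "(\<integral>\<^sup>+u\<in>{0<..<L}. ennreal (u powr (- p)) \<partial>lborel) = ennreal (L powr (1 - p) / (1 - p))"
proof -
  have "((\<lambda>u. u powr (- p)) has_integral (L powr (- p + 1) / (- p + 1))) {0..L}"
    using assms by (intro has_integral_powr_from_0) auto
  then have "(\<integral>\<^sup>+u\<in>{0..L}. ennreal (u powr (- p)) \<partial>lborel) = ennreal (L powr (- p + 1) / (- p + 1))"
    using assms by (subst (asm) has_integral_iff_set_nn_integral) auto
  moreover have "(\<integral>\<^sup>+u\<in>{0<..<L}. ennreal (u powr (- p)) \<partial>lborel) = (\<integral>\<^sup>+u\<in>{0..L}. ennreal (u powr (- p)) \<partial>lborel)"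
  proof (rule nn_integral_cong_AE, use AE_lborel_singleton[of "0::real"] AE_lborel_singleton[of L] in eventually_elim)
    case (elim x)
    then show ?case by (auto split: split_indicator)
  qed
  ultimately show ?thesis by simp
qed

text \<open>The complement consists of two rays at distances \<open>b - x\<close> and
  \<open>x - a\<close> from \<open>x\<close>, so the inner integral is a sum of two power tails.
  After a reflection and a shift, both outer integrals are that of \<open>u powr (- p) / p\<close>
  over \<open>(0, b - a)\<close>, finite because \<open>p < 1\<close>.\<close>

lemma fractional_perimeter_interval:
  assumes "0 < p" "p < 1" "a < b"
  shows "fractional_perimeter p {a<..<b} = ennreal (2 * (b - a) powr (1 - p) / (p * (1 - p)))"
proof -
  define k where "k = (\<lambda>z::real. ennreal (1 / \<bar>z\<bar> powr (1 + p)))"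
  have km: "k \<in> borel_measurable borel" unfolding k_def by measurable
  note [measurable] = km
  have tail: "(\<integral>\<^sup>+z\<in>{d..}. k z \<partial>lborel) = ennreal (d powr (- p) / p)" if "d > 0" for d
  proof -
    have "(\<integral>\<^sup>+z\<in>{d..}. k z \<partial>lborel) = (\<integral>\<^sup>+y\<in>{d..}. ennreal (1 / y powr (1 + p)) \<partial>lborel)"
      using that unfolding k_def by (intro nn_integral_cong) (auto split: split_indicator)
    then show ?thesis using nn_integral_tail_powr[OF that assms(1)] by simp
  qed
  have inner: "(\<integral>\<^sup>+y\<in>- {a<..<b}. ennreal (1 / \<bar>x - y\<bar> powr (1 + p)) \<partial>lborel) =
      ennreal ((b - x) powr (- p) / p) + ennreal ((x - a) powr (- p) / p)" if x: "x \<in> {a<..<b}" for x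
  proof -
    have "(\<integral>\<^sup>+y\<in>- {a<..<b}. ennreal (1 / \<bar>x - y\<bar> powr (1 + p)) \<partial>lborel) =
        (\<integral>\<^sup>+y. k (x - y) * indicator {b - x..} (y - x) + k (x - y) * indicator {x - a..} (x - y) \<partial>lborel)"
      using assms by (intro nn_integral_cong) (auto simp: k_def split: split_indicator)
    also have "\<dots> = (\<integral>\<^sup>+y. k (x - y) * indicator {b - x..} (y - x) \<partial>lborel) +
        (\<integral>\<^sup>+y. k (x - y) * indicator {x - a..} (x - y) \<partial>lborel)"
      by (rule nn_integral_add) auto
    also have "(\<integral>\<^sup>+y. k (x - y) * indicator {x - a..} (x - y) \<partial>lborel) = (\<integral>\<^sup>+z\<in>{x - a..}. k z \<partial>lborel)"
      by (rule nn_integral_reflect[symmetric]) auto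
    also have "(\<integral>\<^sup>+y. k (x - y) * indicator {b - x..} (y - x) \<partial>lborel) = (\<integral>\<^sup>+z\<in>{b - x..}. k z \<partial>lborel)"
      by (subst nn_integral_real_affine[of _ 1 x]) (auto simp: k_def)
    finally show ?thesis using x by (simp add: tail)
  qed
  have "fractional_perimeter p {a<..<b} =
      (\<integral>\<^sup>+x. ennreal ((b - x) powr (- p) / p) * indicator {a<..<b} x +
        ennreal ((x - a) powr (- p) / p) * indicator {a<..<b} x \<partial>lborel)"
    unfolding fractional_perimeter_def
    by (intro nn_integral_cong) (auto simp: inner split: split_indicator)
  also have "\<dots> = (\<integral>\<^sup>+x\<in>{a<..<b}. ennreal ((b - x) powr (- p) / p) \<partial>lborel) +
      (\<integral>\<^sup>+x\<in>{a<..<b}. ennreal ((x - a) powr (- p) / p) \<partial>lborel)"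
    by (rule nn_integral_add) auto
  also have "(\<integral>\<^sup>+x\<in>{a<..<b}. ennreal ((b - x) powr (- p) / p) \<partial>lborel) =
      (\<integral>\<^sup>+u\<in>{0<..<b - a}. ennreal ((1 / p) * u powr (- p)) \<partial>lborel)"
    by (subst nn_integral_reflect[of _ b]) (auto intro!: nn_integral_cong split: split_indicator)
  also have "(\<integral>\<^sup>+x\<in>{a<..<b}. ennreal ((x - a) powr (- p) / p) \<partial>lborel) =
      (\<integral>\<^sup>+u\<in>{0<..<b - a}. ennreal ((1 / p) * u powr (- p)) \<partial>lborel)"
    by (subst nn_integral_real_affine[of _ 1 a]) (auto intro!: nn_integral_cong split: split_indicator)
  also have "(\<integral>\<^sup>+u\<in>{0<..<b - a}. ennreal ((1 / p) * u powr (- p)) \<partial>lborel) =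
      ennreal ((1 / p) * ((b - a) powr (1 - p) / (1 - p)))"
    using assms nn_integral_powr_Ioo[of p "b - a"]
    by (subst set_nn_integral_cmult) (simp_all add: ennreal_mult'[symmetric])
  finally have "fractional_perimeter p {a<..<b} =
      ennreal ((1 / p) * ((b - a) powr (1 - p) / (1 - p)) + (1 / p) * ((b - a) powr (1 - p) / (1 - p)))"
    using assms by (subst ennreal_plus) auto
  then show ?thesis by (simp add: field_simps)
qed

subsection \<open>Cadlag paths\<close>

text \<open>One-sided limits bound the path near each point, on both sides separately; compactness
  of \<open>[0, t]\<close> makes the bound uniform.\<close>

lemma cadlag_bounded:
  assumes w: "cadlag w" and t: "0 \<le> t"
  shows "\<exists>B. \<forall>s\<in>{0..t}. \<bar>w s\<bar> \<le> B"
proof -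
  have loc: "\<exists>U B. open U \<and> s \<in> U \<and> (\<forall>r\<in>U \<inter> {0..t}. \<bar>w r\<bar> \<le> B)" if s: "s \<in> {0..t}" for s
  proof -
    have "(w \<longlongrightarrow> w s) (at_right s)"
      using w s by (simp add: cadlag_def continuous_within)
    then have "\<forall>\<^sub>F r in at_right s. dist (w r) (w s) < 1"
      by (rule tendstoD) simp
    then obtain b where b: "b > s" "\<And>r. s < r \<Longrightarrow> r < b \<Longrightarrow> \<bar>w r - w s\<bar> < 1"
      by (auto simp: eventually_at_right_field dist_real_def)
    \<comment> \<open>At \<open>s = 0\<close> no left limit is available, but no \<open>r\<close>
      satisfies \<open>0 <= r < s\<close> either, so any \<open>a\<close> and \<open>l\<close>
      serve.\<close>
    have "\<exists>a l. a < s \<and> (\<forall>r. a < r \<and> r < s \<and> 0 \<le> r \<longrightarrow> \<bar>w r - l\<bar> < 1)"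
    proof (cases "s = 0")
      case False
      then have "s > 0" using s by simp
      then obtain l where "(w \<longlongrightarrow> l) (at_left s)"
        using w by (auto simp: cadlag_def)
      then have "\<forall>\<^sub>F r in at_left s. dist (w r) l < 1"
        by (rule tendstoD) simp
      then show ?thesis
        by (auto simp: eventually_at_left_field dist_real_def)
    qed (auto intro!: exI[of _ "-1"])
    then obtain a l where a: "a < s" "\<And>r. a < r \<Longrightarrow> r < s \<Longrightarrow> 0 \<le> r \<Longrightarrow> \<bar>w r - l\<bar> < 1"
      by blast
    have "\<bar>w r\<bar> \<le> \<bar>w s\<bar> + \<bar>l\<bar> + 1" if "r \<in> {a<..<b} \<inter> {0..t}" for r
      using a(2)[of r] b(2)[of r] that by (cases r s rule: linorder_cases) auto
    then show ?thesis
      using a(1) b(1) by (intro exI[of _ "{a<..<b}"] exI[of _ "\<bar>w s\<bar> + \<bar>l\<bar> + 1"]) auto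
  qed
  then obtain U B where UB: "\<And>s. s \<in> {0..t} \<Longrightarrow> open (U s) \<and> s \<in> U s \<and> (\<forall>r\<in>U s \<inter> {0..t}. \<bar>w r\<bar> \<le> B s)"
    by metis
  have "compact {0..t}" by simp
  then obtain C where C: "C \<subseteq> {0..t}" "finite C" "{0..t} \<subseteq> (\<Union>s\<in>C. U s)"
    by (rule compactE_image[of _ "{0..t}" U]) (use UB in auto)
  have "\<bar>w r\<bar> \<le> Max (B ` C)" if r: "r \<in> {0..t}" for r
  proof -
    obtain s where s: "s \<in> C" "r \<in> U s" using C r by auto
    then have "\<bar>w r\<bar> \<le> B s" using UB[of s] C r by auto
    also have "\<dots> \<le> Max (B ` C)" using s C by auto
    finally show ?thesis .
  qed
  then show ?thesis by blast
qed

lemma dyadic_between: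
  assumes "0 \<le> s" "s < (r::real)" "0 < t" "r \<le> t"
  shows "\<exists>N. \<forall>m\<ge>N. \<exists>k\<le>2 ^ m. s < t * real k / 2 ^ m \<and> t * real k / 2 ^ m < r"
proof -
  obtain N where N: "t / (r - s) < 2 ^ N"
    using real_arch_pow[of 2 "t / (r - s)"] by auto
  have "\<exists>k\<le>2 ^ m. s < t * real k / 2 ^ m \<and> t * real k / 2 ^ m < r" if m: "m \<ge> N" for m
  proof -
    have "(2::real) ^ N \<le> 2 ^ m" using m by (rule power_increasing) simp
    then have "t / (r - s) < 2 ^ m" using N by (rule less_le_trans[rotated])
    then have gap: "t / 2 ^ m < r - s"
      using assms by (simp add: field_simps)
    \<comment> \<open>The first grid index strictly to the right of \<open>s\<close>; its grid point
      overshoots \<open>s\<close> by at most the mesh \<open>t / 2 ^ m\<close>, which is below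
      \<open>r - s\<close>.\<close>
    define k where "k = nat \<lfloor>s * 2 ^ m / t\<rfloor> + 1"
    have k: "real k = of_int \<lfloor>s * 2 ^ m / t\<rfloor> + 1"
      using assms by (simp add: k_def)
    have "s * 2 ^ m / t < real k" "real k \<le> s * 2 ^ m / t + 1"
      unfolding k by linarith+
    then have lo: "s < t * real k / 2 ^ m" and "t * real k / 2 ^ m \<le> s + t / 2 ^ m"
      using assms by (auto simp: field_simps)
    then have hi: "t * real k / 2 ^ m < r" using gap by linarith
    then have "t * real k / 2 ^ m < t" using assms by simp
    then have "t * real k < t * 2 ^ m" by (simp add: divide_less_eq)
    then have "real k < 2 ^ m" using assms by simp
    then have "k \<le> 2 ^ m"
      by (metis less_imp_le of_nat_le_iff of_nat_numeral of_nat_power)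
    then show ?thesis using lo hi by blast
  qed
  then show ?thesis by blast
qed

text \<open>Right-continuity carries a value close to the supremum from \<open>s\<close> to all
  times slightly later, and every fine enough grid has a point among them.\<close>

lemma cadlag_dyadic_max_tendsto:
  assumes w: "cadlag w" and t: "0 < t"
  shows "(\<lambda>m. MAX k\<in>{..2 ^ m::nat}. w (t * real k / 2 ^ m)) \<longlonglongrightarrow> (SUP s\<in>{0..t}. w s)"
proof -
  let ?S = "SUP s\<in>{0..t}. w s"
  obtain B where B: "\<And>s. s \<in> {0..t} \<Longrightarrow> \<bar>w s\<bar> \<le> B"
    using cadlag_bounded[OF w, of t] t by fastforce
  have bdd: "bdd_above (w ` {0..t})"
    using B by (intro bdd_aboveI[of _ B]) (auto simp: abs_le_iff)
  have le: "(MAX k\<in>{..2 ^ m::nat}. w (t * real k / 2 ^ m)) \<le> ?S" for m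
  proof (rule Max.boundedI)
    fix x assume "x \<in> (\<lambda>k. w (t * real k / 2 ^ m)) ` {..2 ^ m::nat}"
    then obtain k :: nat where k: "k \<le> 2 ^ m" "x = w (t * real k / 2 ^ m)" by auto
    have "real k \<le> 2 ^ m" using k(1) by (metis of_nat_le_iff of_nat_numeral of_nat_power)
    then have "t * real k / 2 ^ m \<in> {0..t}" using t by (auto simp: field_simps)
    then show "x \<le> ?S" unfolding k using bdd by (rule cSUP_upper)
  qed auto
  show ?thesis
  proof (rule LIMSEQ_I)
    fix e :: real assume e: "e > 0"
    obtain s where s: "s \<in> {0..t}" "?S - e < w s"
      using less_cSUP_iff[OF _ bdd, of "?S - e"] t e by auto
    have "\<exists>N. \<forall>m\<ge>N. \<exists>k\<le>2 ^ m. ?S - e < w (t * real k / 2 ^ m)"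
    \<comment> \<open>The right endpoint leaves no room to its right inside \<open>[0, t]\<close>,
      but it belongs to every grid, as the point \<open>k = 2 ^ m\<close>.\<close>
    proof (cases "s = t")
      case True
      have "\<exists>k\<le>2 ^ m. ?S - e < w (t * real k / 2 ^ m)" for m :: nat
        using s True by (intro exI[of _ "2 ^ m"]) simp
      then show ?thesis by blast
    next
      case False
      have "(w \<longlongrightarrow> w s) (at_right s)"
        using w s by (simp add: cadlag_def continuous_within)
      then have "\<forall>\<^sub>F r in at_right s. ?S - e < w r"
        using s(2) by (rule order_tendstoD)
      then obtain b where b: "b > s" "\<And>r. s < r \<Longrightarrow> r < b \<Longrightarrow> ?S - e < w r"
        by (auto simp: eventually_at_right_field)
      obtain N where "\<forall>m\<ge>N. \<exists>k\<le>2 ^ m. s < t * real k / 2 ^ m \<and> t * real k / 2 ^ m < min b t"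
        using dyadic_between[of s "min b t" t] s t b False by auto
      then show ?thesis using b(2) by (metis min_less_iff_conj)
    qed
    then obtain N where N: "\<And>m. m \<ge> N \<Longrightarrow> \<exists>k\<le>2 ^ m. ?S - e < w (t * real k / 2 ^ m)" by blast
    have "norm ((MAX k\<in>{..2 ^ m::nat}. w (t * real k / 2 ^ m)) - ?S) < e" if "m \<ge> N" for m
    proof -
      obtain k where "k \<le> 2 ^ m" "?S - e < w (t * real k / 2 ^ m)" using N[OF \<open>m \<ge> N\<close>] by blast
      then have "?S - e < (MAX k\<in>{..2 ^ m::nat}. w (t * real k / 2 ^ m))"
        by (subst Max_gr_iff) auto
      then show ?thesis using le[of m] by simp
    qed
    then show "\<exists>N. \<forall>m\<ge>N. norm ((MAX k\<in>{..2 ^ m::nat}. w (t * real k / 2 ^ m)) - ?S) < e" by blast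
  qed
qed

text \<open>Staying inside up to time \<open>t\<close> alone gives only that the infimum is at least
  \<open>t\<close>. Strictness comes from right-continuity: the interval is open, so the path
  remains inside for some time beyond \<open>t\<close>.\<close>

lemma less_exit_time_iff:
  assumes w: "cadlag w" and t: "0 \<le> t"
  shows "ereal t < exit_time {a<..<b} (\<lambda>s. x + w s) \<longleftrightarrow> (\<forall>s\<in>{0..t}. a < x + w s \<and> x + w s < b)"
proof
  assume *: "ereal t < exit_time {a<..<b} (\<lambda>s. x + w s)"
  show "\<forall>s\<in>{0..t}. a < x + w s \<and> x + w s < b"
  proof (rule ccontr)
    assume "\<not> ?thesis"
    then obtain s where s: "s \<in> {0..t}" "x + w s \<in> - {a<..<b}" by auto
    then have "exit_time {a<..<b} (\<lambda>s. x + w s) \<le> ereal s"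
      unfolding exit_time_def by (intro Inf_lower) auto
    then show False using * s by (metis atLeastAtMost_iff ereal_less_eq(3) leD order_trans)
  qed
next
  assume *: "\<forall>s\<in>{0..t}. a < x + w s \<and> x + w s < b"
  have "(w \<longlongrightarrow> w t) (at_right t)"
    using w t by (simp add: cadlag_def continuous_within)
  then have "\<forall>\<^sub>F r in at_right t. w r \<in> {a - x<..<b - x}"
    using * t by (intro topological_tendstoD) (auto simp: algebra_simps)
  then obtain u where u: "u > t" "\<And>r. t < r \<Longrightarrow> r < u \<Longrightarrow> w r \<in> {a - x<..<b - x}"
    by (auto simp: eventually_at_right_field)
  have "ereal u \<le> exit_time {a<..<b} (\<lambda>s. x + w s)"
    unfolding exit_time_def
  proof (rule Inf_greatest)
    fix y assume "y \<in> ereal ` {s. 0 \<le> s \<and> x + w s \<in> - {a<..<b}}"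
    then obtain s where s: "y = ereal s" "0 \<le> s" "x + w s \<notin> {a<..<b}" by auto
    have "\<not> s \<le> t" using s * by auto
    moreover have "\<not> (t < s \<and> s < u)" using s u(2)[of s] by (auto simp: algebra_simps)
    ultimately show "ereal u \<le> y" using s by auto
  qed
  then show "ereal t < exit_time {a<..<b} (\<lambda>s. x + w s)"
    using u(1) by (meson ereal_less(3) less_ereal.simps(1) less_le_trans)
qed

subsection \<open>Maxima of partial sums and truncated expectations\<close>

text \<open>The empty sum \<open>k = 0\<close> is included, which makes the value nonnegative; for
  the increments of a skeleton it is the maximum measured from the starting value.\<close>

definition partial_max :: "nat \<Rightarrow> (nat \<Rightarrow> real) \<Rightarrow> real" where
  "partial_max n d = (MAX k\<in>{..n}. \<Sum>i<k. d i)"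

lemma partial_max_nonneg: "0 \<le> partial_max n d"
proof -
  have "(\<Sum>i<0. d i) \<le> partial_max n d"
    unfolding partial_max_def by (rule Max_ge) (auto intro!: image_eqI[of _ _ 0])
  then show ?thesis by simp
qed

lemma partial_max_gr_iff: "l < partial_max n d \<longleftrightarrow> (\<exists>k\<le>n. l < (\<Sum>i<k. d i))"
  unfolding partial_max_def by (subst Max_gr_iff) auto

lemma partial_max_cong: "(\<And>i. i < n \<Longrightarrow> d i = e i) \<Longrightarrow> partial_max n d = partial_max n e"
  unfolding partial_max_def by (intro arg_cong[where f = Max] image_cong refl sum.cong) auto

lemma partial_max_cmult:
  assumes "c \<ge> 0"
  shows "partial_max n (\<lambda>i. c * d i) = c * partial_max n d"
  unfolding partial_max_def sum_distrib_left[symmetric]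
  using assms mono_Max_commute[of "\<lambda>x. c * x" "(\<lambda>k. \<Sum>i<k. d i) ` {..n}"]
  by (auto simp: mono_def mult_left_mono image_image)

text \<open>The left side is the range of the walk, that is the difference of two partial sums,
  hence up to sign the sum over the block of steps between them.\<close>

lemma partial_max_le_sum_abs: "partial_max n d + partial_max n (\<lambda>i. - d i) \<le> (\<Sum>i<n. \<bar>d i\<bar>)"
proof -
  have le: "(\<Sum>i<j. d i) - (\<Sum>i<k. d i) \<le> (\<Sum>i<n. \<bar>d i\<bar>)" if "j \<le> n" "k \<le> n" for j k
  proof -
    have *: "\<bar>\<Sum>i\<in>{p..<q}. d i\<bar> \<le> (\<Sum>i<n. \<bar>d i\<bar>)" if "q \<le> n" for p q
    proof -
      have "\<bar>\<Sum>i\<in>{p..<q}. d i\<bar> \<le> (\<Sum>i\<in>{p..<q}. \<bar>d i\<bar>)" by (rule sum_abs)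
      also have "\<dots> \<le> (\<Sum>i<n. \<bar>d i\<bar>)" using that by (intro sum_mono2) auto
      finally show ?thesis .
    qed
    have **: "(\<Sum>i<q. d i) - (\<Sum>i<p. d i) = (\<Sum>i\<in>{p..<q}. d i)" if "p \<le> q" for p q
      using sum_diff_nat_ivl[of 0 p q d] that by (simp add: lessThan_atLeast0)
    show ?thesis
    proof (cases "k \<le> j")
      case True
      then show ?thesis using *[of j k] **[of k j] \<open>j \<le> n\<close> by linarith
    next
      case False
      then show ?thesis using *[of k j] **[of j k] \<open>k \<le> n\<close> by linarith
    qed
  qed
  have max_in: "\<exists>k\<le>n. partial_max n e = (\<Sum>i<k. e i)" for e
  proof -
    have "partial_max n e \<in> (\<lambda>k. \<Sum>i<k. e i) ` {..n}"
      unfolding partial_max_def by (rule Max_in) auto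
    then show ?thesis by auto
  qed
  obtain j where j: "j \<le> n" "partial_max n d = (\<Sum>i<j. d i)" using max_in[of d] by auto
  obtain k where k: "k \<le> n" "partial_max n (\<lambda>i. - d i) = (\<Sum>i<k. - d i)"
    using max_in[of "\<lambda>i. - d i"] by auto
  show ?thesis using le[OF j(1) k(1)] j(2) k(2) by (simp add: sum_negf)
qed

lemma measurable_partial_max:
  assumes "\<And>i. i < n \<Longrightarrow> (\<lambda>x. f x i) \<in> borel_measurable N"
  shows "(\<lambda>x. partial_max n (f x)) \<in> borel_measurable N"
  unfolding partial_max_def using assms by (intro borel_measurable_Max borel_measurable_sum) auto

context prob_space
begin

text \<open>Split according to the first index at which the partial sum exceeds \<open>l\<close>.
  This event depends on earlier summands only and is independent of the remaining sum, which stays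
  above \<open>- u\<close> with probability at least \<open>1 - \<delta>\<close>; if both happen,
  the full sum exceeds \<open>l - u\<close>.\<close>

lemma ottaviani_inequality:
  fixes D :: "nat \<Rightarrow> 'a \<Rightarrow> real"
  assumes ind: "indep_vars (\<lambda>_. borel) D {..<n}"
    and tail: "\<And>k. k \<le> n \<Longrightarrow> prob {\<omega> \<in> space M. (\<Sum>i\<in>{k..<n}. D i \<omega>) \<le> - u} \<le> \<delta>"
  shows "(1 - \<delta>) * prob {\<omega> \<in> space M. l < partial_max n (\<lambda>i. D i \<omega>)} \<le>
    prob {\<omega> \<in> space M. l - u < (\<Sum>i<n. D i \<omega>)}"
proof -
  have [measurable]: "D i \<in> borel_measurable M" if "i < n" for i
    using ind that by (auto simp: indep_vars_def)
  define A where "A = (\<lambda>k. {\<omega> \<in> space M. l < (\<Sum>i<k. D i \<omega>) \<and> (\<forall>j\<in>{..<k}. (\<Sum>i<j. D i \<omega>) \<le> l)})"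
  define B where "B = (\<lambda>k. {\<omega> \<in> space M. - u < (\<Sum>i\<in>{k..<n}. D i \<omega>)})"
  have meas_sum: "(\<lambda>\<omega>. \<Sum>i\<in>J. D i \<omega>) \<in> borel_measurable M" if "J \<subseteq> {..<n}" for J
    using that by (intro borel_measurable_sum) auto
  have A: "A k \<in> events" if "k \<le> n" for k
    unfolding A_def using that
    by (intro sets.sets_Collect_conj sets.sets_Collect_finite_All borel_measurable_less borel_measurable_le meas_sum) auto
  have B: "B k \<in> events" for k
    unfolding B_def by (intro borel_measurable_less meas_sum) auto
  have un: "{\<omega> \<in> space M. l < partial_max n (\<lambda>i. D i \<omega>)} = (\<Union>k\<in>{..n}. A k)"
  proof (intro equalityI subsetI)
    fix \<omega> assume "\<omega> \<in> {\<omega> \<in> space M. l < partial_max n (\<lambda>i. D i \<omega>)}"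
    then have \<omega>: "\<omega> \<in> space M" "\<exists>k. k \<le> n \<and> l < (\<Sum>i<k. D i \<omega>)"
      by (auto simp: partial_max_gr_iff)
    define k where "k = (LEAST k. k \<le> n \<and> l < (\<Sum>i<k. D i \<omega>))"
    have "k \<le> n \<and> l < (\<Sum>i<k. D i \<omega>)" unfolding k_def by (rule LeastI_ex[OF \<omega>(2)])
    moreover have "\<not> (j \<le> n \<and> l < (\<Sum>i<j. D i \<omega>))" if "j < k" for j
      using that unfolding k_def by (rule not_less_Least)
    ultimately show "\<omega> \<in> (\<Union>k\<in>{..n}. A k)" using \<omega>(1) by (force simp: A_def)
  qed (auto simp: A_def partial_max_gr_iff)
  have disj: "disjoint_family_on A {..n}"
    unfolding disjoint_family_on_def A_def by (force simp: neq_iff not_le)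
  have AB: "(1 - \<delta>) * prob (A k) \<le> prob (A k \<inter> B k)" if k: "k \<le> n" for k
  proof -
    \<comment> \<open>Independence is used between the two blocks of summands as random vectors, so
      both events are rewritten as measurable conditions \<open>EA\<close> and \<open>EB\<close> on
      these vectors.\<close>
    let ?P = "\<lambda>J. PiM J (\<lambda>_. borel :: real measure)"
    let ?R = "\<lambda>J \<omega>. restrict (\<lambda>i. D i \<omega>) J"
    define EA where "EA = {d \<in> space (?P {..<k}). l < (\<Sum>i<k. d i) \<and> (\<forall>j\<in>{..<k}. (\<Sum>i<j. d i) \<le> l)}"
    define EB where "EB = {d \<in> space (?P {k..<n}). - u < (\<Sum>i\<in>{k..<n}. d i)}"
    have "EA \<in> sets (?P {..<k})"
      unfolding EA_def
      by (intro sets.sets_Collect_conj sets.sets_Collect_finite_All borel_measurable_less borel_measurable_le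
          borel_measurable_sum measurable_component_singleton) auto
    moreover have "EB \<in> sets (?P {k..<n})"
      unfolding EB_def
      by (intro borel_measurable_less borel_measurable_sum measurable_component_singleton) auto
    moreover have "indep_var (?P {..<k}) (?R {..<k}) (?P {k..<n}) (?R {k..<n})"
      using k by (intro indep_var_restrict[OF ind]) auto
    ultimately have "prob ((\<lambda>x. (?R {..<k} x, ?R {k..<n} x)) -` (EA \<times> EB) \<inter> space M) =
        prob (?R {..<k} -` EA \<inter> space M) * prob (?R {k..<n} -` EB \<inter> space M)"
      by (intro indep_varD)
    moreover have "?R {..<k} -` EA \<inter> space M = A k"
      by (auto simp: EA_def A_def space_PiM)
    moreover have "?R {k..<n} -` EB \<inter> space M = B k"
      by (auto simp: EB_def B_def space_PiM)
    moreover have "(\<lambda>x. (?R {..<k} x, ?R {k..<n} x)) -` (EA \<times> EB) \<inter> space M =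
        (?R {..<k} -` EA \<inter> space M) \<inter> (?R {k..<n} -` EB \<inter> space M)" by auto
    ultimately have "prob (A k \<inter> B k) = prob (A k) * prob (B k)" by simp
    moreover have "1 - \<delta> \<le> prob (B k)"
    proof -
      have "space M - B k = {\<omega> \<in> space M. (\<Sum>i\<in>{k..<n}. D i \<omega>) \<le> - u}"
        by (auto simp: B_def)
      then have "1 - prob (B k) \<le> \<delta>"
        using tail[OF k] prob_compl[OF B[of k]] by simp
      then show ?thesis by simp
    qed
    ultimately show ?thesis
      using mult_left_mono[of "1 - \<delta>" "prob (B k)" "prob (A k)"] by (simp add: mult.commute)
  qed
  have "(1 - \<delta>) * prob {\<omega> \<in> space M. l < partial_max n (\<lambda>i. D i \<omega>)} = (\<Sum>k\<le>n. (1 - \<delta>) * prob (A k))"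
    unfolding un using A disj
    by (subst finite_measure_finite_Union) (auto simp: sum_distrib_left)
  also have "\<dots> \<le> (\<Sum>k\<le>n. prob (A k \<inter> B k))"
    using AB by (intro sum_mono) auto
  also have "\<dots> = prob (\<Union>k\<in>{..n}. A k \<inter> B k)"
    using A B disj
    by (intro finite_measure_finite_Union[symmetric]) (fastforce simp: disjoint_family_on_def)+
  also have "\<dots> \<le> prob {\<omega> \<in> space M. l - u < (\<Sum>i<n. D i \<omega>)}"
  proof (rule finite_measure_mono)
    show "(\<Union>k\<in>{..n}. A k \<inter> B k) \<subseteq> {\<omega> \<in> space M. l - u < (\<Sum>i<n. D i \<omega>)}"
    proof
      fix \<omega> assume "\<omega> \<in> (\<Union>k\<in>{..n}. A k \<inter> B k)"
      then obtain k where k: "k \<le> n" "\<omega> \<in> A k" "\<omega> \<in> B k" by auto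
      have "(\<Sum>i<k. D i \<omega>) + (\<Sum>i\<in>{k..<n}. D i \<omega>) = (\<Sum>i<n. D i \<omega>)"
        using sum.atLeastLessThan_concat[of 0 k n "\<lambda>i. D i \<omega>"] k(1) by (simp add: lessThan_atLeast0)
      then show "\<omega> \<in> {\<omega> \<in> space M. l - u < (\<Sum>i<n. D i \<omega>)}"
        using k by (auto simp: A_def B_def)
    qed
    show "{\<omega> \<in> space M. l - u < (\<Sum>i<n. D i \<omega>)} \<in> events"
      by (intro borel_measurable_less meas_sum) auto
  qed
  finally show ?thesis .
qed

text \<open>Independence makes both joint laws the product of the marginals. This transfers
  functionals of a whole skeleton between processes known to agree only increment by
  increment.\<close>

lemma expectation_indep_vars_cong:
  fixes F :: "('i \<Rightarrow> 'b) \<Rightarrow> real"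
  assumes ne: "I \<noteq> {}"
    and Y: "indep_vars N Y I" and Z: "indep_vars N Z I"
    and eq: "\<And>i. i \<in> I \<Longrightarrow> distr M (N i) (Y i) = distr M (N i) (Z i)"
    and F: "F \<in> borel_measurable (PiM I N)"
  shows "expectation (\<lambda>\<omega>. F (\<lambda>i\<in>I. Y i \<omega>)) = expectation (\<lambda>\<omega>. F (\<lambda>i\<in>I. Z i \<omega>))"
proof -
  have *: "expectation (\<lambda>\<omega>. F (\<lambda>i\<in>I. V i \<omega>)) = integral\<^sup>L (PiM I (\<lambda>i. distr M (N i) (V i))) F"
    if V: "indep_vars N V I" for V
  proof -
    have rv: "V i \<in> measurable M (N i)" if "i \<in> I" for i
      using V that by (auto simp: indep_vars_def)
    have "distr M (PiM I N) (\<lambda>\<omega>. \<lambda>i\<in>I. V i \<omega>) = PiM I (\<lambda>i. distr M (N i) (V i))"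
      using indep_vars_iff_distr_eq_PiM'[where M' = N and X = V and I = I, OF ne rv] V by simp
    moreover have "expectation (\<lambda>\<omega>. F (\<lambda>i\<in>I. V i \<omega>)) = integral\<^sup>L (distr M (PiM I N) (\<lambda>\<omega>. \<lambda>i\<in>I. V i \<omega>)) F"
      using rv F by (intro integral_distr[symmetric] measurable_restrict) auto
    ultimately show ?thesis by simp
  qed
  have "PiM I (\<lambda>i. distr M (N i) (Y i)) = PiM I (\<lambda>i. distr M (N i) (Z i))"
    using eq by (intro PiM_cong) auto
  then show ?thesis using *[OF Y] *[OF Z] by simp
qed

text \<open>For \<open>y >= 0\<close>, \<open>min T y\<close> is the length of the set of levels
  \<open>l\<close> in \<open>[0, T]\<close> below \<open>y\<close>; Tonelli does the rest. For
  negative \<open>T\<close> both sides are 0, since \<open>ennreal\<close> truncates and the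
  interval is empty.\<close>

lemma nn_integral_min_layer_cake:
  assumes [measurable]: "Y \<in> borel_measurable M" and Y: "\<And>\<omega>. 0 \<le> Y \<omega>"
  shows "(\<integral>\<^sup>+\<omega>. ennreal (min T (Y \<omega>)) \<partial>M) =
    (\<integral>\<^sup>+l\<in>{0..T}. emeasure M {\<omega> \<in> space M. l < Y \<omega>} \<partial>lborel)"
proof -
  interpret pair_sigma_finite M lborel ..
  have "(\<integral>\<^sup>+\<omega>. ennreal (min T (Y \<omega>)) \<partial>M) =
      (\<integral>\<^sup>+\<omega>. (\<integral>\<^sup>+l. indicator {0..T} l * indicator {p. fst p < Y (snd p)} (l, \<omega>) \<partial>lborel) \<partial>M)"
  proof (rule nn_integral_cong)
    fix \<omega>
    have "(\<integral>\<^sup>+l. indicator {0..T} l * indicator {p. fst p < Y (snd p)} (l, \<omega>) \<partial>lborel) =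
        (\<integral>\<^sup>+l. indicator {0..min T (Y \<omega>)} l \<partial>lborel)"
    proof (rule nn_integral_cong_AE, use AE_lborel_singleton[of "Y \<omega>"] in eventually_elim)
      case (elim l)
      then show ?case by (auto split: split_indicator)
    qed
    also have "\<dots> = ennreal (min T (Y \<omega>))"
      using Y[of \<omega>] by (cases "T \<ge> 0") (auto simp: ennreal_neg min_def)
    finally show "ennreal (min T (Y \<omega>)) =
        (\<integral>\<^sup>+l. indicator {0..T} l * indicator {p. fst p < Y (snd p)} (l, \<omega>) \<partial>lborel)" ..
  qed
  also have "\<dots> = (\<integral>\<^sup>+l. (\<integral>\<^sup>+\<omega>. indicator {0..T} l * indicator {p. fst p < Y (snd p)} (l, \<omega>) \<partial>M) \<partial>lborel)"
    by (rule Fubini'[symmetric]) measurable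
  also have "\<dots> = (\<integral>\<^sup>+l\<in>{0..T}. emeasure M {\<omega> \<in> space M. l < Y \<omega>} \<partial>lborel)"
  proof (rule nn_integral_cong)
    fix l :: real
    have "(\<integral>\<^sup>+\<omega>. indicator {0..T} l * indicator {p. fst p < Y (snd p)} (l, \<omega>) \<partial>M) =
        indicator {0..T} l * (\<integral>\<^sup>+\<omega>. indicator {\<omega> \<in> space M. l < Y \<omega>} \<omega> \<partial>M)"
      by (subst nn_integral_cmult[symmetric]) (auto intro!: nn_integral_cong simp: indicator_def)
    then show "(\<integral>\<^sup>+\<omega>. indicator {0..T} l * indicator {p. fst p < Y (snd p)} (l, \<omega>) \<partial>M) =
        emeasure M {\<omega> \<in> space M. l < Y \<omega>} * indicator {0..T} l"
      by (simp add: mult.commute del: nn_integral_indicator) (subst nn_integral_indicator, auto)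
  qed
  finally show ?thesis .
qed

lemma integrable_min:
  assumes "Y \<in> borel_measurable M" "AE \<omega> in M. 0 \<le> Y \<omega>" "0 \<le> T"
  shows "integrable M (\<lambda>\<omega>. min T (Y \<omega>) :: real)"
  using assms by (intro integrable_const_bound[where B = T]) auto

text \<open>Levels below \<open>K\<close> are charged with probability 1, which costs at most
  \<open>K\<close>; above \<open>K\<close> the tail comparison is integrated. The dilation
  \<open>q\<close> leaves the truncation because \<open>min T (q * z) <= q * min T z\<close> for
  \<open>q >= 1\<close>.\<close>

lemma expectation_min_le_of_tail_le:
  assumes [measurable]: "Y \<in> borel_measurable M" "Z \<in> borel_measurable M"
    and Y: "\<And>\<omega>. 0 \<le> Y \<omega>" and Z: "\<And>\<omega>. 0 \<le> Z \<omega>"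
    and K: "0 \<le> K" and p: "0 \<le> p" and q: "1 \<le> q" and T: "0 \<le> T"
    and tail: "\<And>l. K \<le> l \<Longrightarrow> prob {\<omega> \<in> space M. l < Y \<omega>} \<le> p * prob {\<omega> \<in> space M. l < q * Z \<omega>}"
  shows "expectation (\<lambda>\<omega>. min T (Y \<omega>)) \<le> K + p * q * expectation (\<lambda>\<omega>. min T (Z \<omega>))"
proof -
  have qZ: "0 \<le> q * Z \<omega>" for \<omega> using q Z[of \<omega>] by simp
  have "ennreal (expectation (\<lambda>\<omega>. min T (Y \<omega>))) = (\<integral>\<^sup>+\<omega>. ennreal (min T (Y \<omega>)) \<partial>M)"
    using Y T by (intro nn_integral_eq_integral[symmetric] integrable_min) auto
  also have "\<dots> = (\<integral>\<^sup>+l\<in>{0..T}. emeasure M {\<omega> \<in> space M. l < Y \<omega>} \<partial>lborel)"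
    using Y by (intro nn_integral_min_layer_cake) auto
  also have "\<dots> \<le> (\<integral>\<^sup>+l. indicator {0..K} l +
      ennreal p * (emeasure M {\<omega> \<in> space M. l < q * Z \<omega>} * indicator {0..T} l) \<partial>lborel)"
  proof (rule nn_integral_mono)
    fix l :: real
    show "emeasure M {\<omega> \<in> space M. l < Y \<omega>} * indicator {0..T} l \<le> indicator {0..K} l +
      ennreal p * (emeasure M {\<omega> \<in> space M. l < q * Z \<omega>} * indicator {0..T} l)"
    proof (cases "l \<in> {0..T} \<and> K \<le> l")
      case True
      then have "emeasure M {\<omega> \<in> space M. l < Y \<omega>} \<le> ennreal p * emeasure M {\<omega> \<in> space M. l < q * Z \<omega>}"
        using tail[of l] p by (simp add: emeasure_eq_measure ennreal_mult[symmetric] ennreal_leI)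
      then show ?thesis using True by (auto split: split_indicator intro: add_increasing)
    next
      case False
      have "emeasure M {\<omega> \<in> space M. l < Y \<omega>} \<le> 1"
        by (simp add: emeasure_eq_measure ennreal_le_1)
      then show ?thesis using False by (auto split: split_indicator intro: add_increasing2)
    qed
  qed
  also have "\<dots> = ennreal K + ennreal p * (\<integral>\<^sup>+l\<in>{0..T}. emeasure M {\<omega> \<in> space M. l < q * Z \<omega>} \<partial>lborel)"
    using K by (subst nn_integral_add) (auto simp: nn_integral_cmult)
  also have "(\<integral>\<^sup>+l\<in>{0..T}. emeasure M {\<omega> \<in> space M. l < q * Z \<omega>} \<partial>lborel) = (\<integral>\<^sup>+\<omega>. ennreal (min T (q * Z \<omega>)) \<partial>M)"
    using qZ by (intro nn_integral_min_layer_cake[symmetric]) auto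
  also have "\<dots> = ennreal (expectation (\<lambda>\<omega>. min T (q * Z \<omega>)))"
    using qZ T by (intro nn_integral_eq_integral integrable_min) auto
  also have "ennreal K + ennreal p * \<dots> = ennreal (K + p * expectation (\<lambda>\<omega>. min T (q * Z \<omega>)))"
    using K p T qZ by (simp add: ennreal_mult' ennreal_plus Bochner_Integration.integral_nonneg)
  finally have "expectation (\<lambda>\<omega>. min T (Y \<omega>)) \<le> K + p * expectation (\<lambda>\<omega>. min T (q * Z \<omega>))"
    using K p T qZ by (subst (asm) ennreal_le_iff) (auto intro!: add_nonneg_nonneg mult_nonneg_nonneg Bochner_Integration.integral_nonneg)
  also have "expectation (\<lambda>\<omega>. min T (q * Z \<omega>)) \<le> expectation (\<lambda>\<omega>. q * min T (Z \<omega>))"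
  proof (rule integral_mono)
    show "min T (q * Z \<omega>) \<le> q * min T (Z \<omega>)" for \<omega>
    proof -
      have "T \<le> q * T" using T q mult_right_mono[of 1 q T] by simp
      then show ?thesis
        using q by (cases "T \<le> Z \<omega>") (auto simp: min.absorb1 min.absorb2 min.coboundedI1)
    qed
  qed (use T q Z qZ in \<open>auto intro!: integrable_min\<close>)
  finally show ?thesis using p by (simp add: mult.assoc mult_left_mono)
qed

end

subsection \<open>Running maxima and dyadic skeletons of Levy processes\<close>

context levy_process
begin

text \<open>\<open>run_max (-1)\<close> is the negative of the running infimum.\<close>

definition run_max :: "real \<Rightarrow> real \<Rightarrow> 'a \<Rightarrow> real" where
  "run_max c t \<omega> = (SUP s\<in>{0..t}. c * X s \<omega>)"

definition path_range :: "real \<Rightarrow> 'a \<Rightarrow> real" where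
  "path_range t \<omega> = run_max 1 t \<omega> + run_max (-1) t \<omega>"

definition incr :: "real \<Rightarrow> nat \<Rightarrow> nat \<Rightarrow> 'a \<Rightarrow> real" where
  "incr t m i \<omega> = X (t * real (Suc i) / 2 ^ m) \<omega> - X (t * real i / 2 ^ m) \<omega>"

lemma cadlag_cmult: "\<omega> \<in> space M \<Longrightarrow> cadlag (\<lambda>s. c * X s \<omega>)"
  using cadlag_paths[of \<omega>] tendsto_mult_left[where c = c]
  unfolding cadlag_def by (fastforce intro!: continuous_intros)

lemma run_max_upper:
  assumes "\<omega> \<in> space M" "0 \<le> s" "s \<le> t"
  shows "c * X s \<omega> \<le> run_max c t \<omega>"
proof -
  obtain B where "\<forall>s\<in>{0..t}. \<bar>c * X s \<omega>\<bar> \<le> B"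
    using cadlag_bounded[OF cadlag_cmult[of \<omega> c], of t] assms by fastforce
  then have "bdd_above ((\<lambda>s. c * X s \<omega>) ` {0..t})"
    by (intro bdd_aboveI[of _ B]) (auto simp: abs_le_iff)
  then show ?thesis
    unfolding run_max_def using assms by (intro cSUP_upper) auto
qed

lemma run_max_le_iff:
  assumes "\<omega> \<in> space M" "0 \<le> t"
  shows "run_max c t \<omega> \<le> y \<longleftrightarrow> (\<forall>s\<in>{0..t}. c * X s \<omega> \<le> y)"
proof
  show "run_max c t \<omega> \<le> y" if "\<forall>s\<in>{0..t}. c * X s \<omega> \<le> y"
    unfolding run_max_def using assms that by (intro cSUP_least) auto
qed (use run_max_upper[OF assms(1)] in \<open>fastforce intro: order_trans\<close>)

lemma sum_incr: "(\<Sum>i\<in>{k..<n}. incr t m i \<omega>) = X (t * real n / 2 ^ m) \<omega> - X (t * real k / 2 ^ m) \<omega>" if "k \<le> n"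
  using sum_Suc_diff'[OF that, of "\<lambda>i. X (t * real i / 2 ^ m) \<omega>"] by (simp add: incr_def)

text \<open>The starting value stays in the formula because it vanishes only almost surely, whereas
  the identity is pathwise.\<close>

lemma partial_max_incr:
  "partial_max n (\<lambda>i. c * incr t m i \<omega>) = (MAX k\<in>{..n}. c * X (t * real k / 2 ^ m) \<omega>) - c * X 0 \<omega>"
proof -
  have "(\<Sum>i<k. c * incr t m i \<omega>) = c * X (t * real k / 2 ^ m) \<omega> + - (c * X 0 \<omega>)" for k
    using sum_incr[of 0 k t m \<omega>] by (simp add: lessThan_atLeast0 right_diff_distrib flip: sum_distrib_left)
  then have "partial_max n (\<lambda>i. c * incr t m i \<omega>) = (MAX k\<in>{..n}. c * X (t * real k / 2 ^ m) \<omega> + - (c * X 0 \<omega>))"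
    unfolding partial_max_def by (simp only:)
  also have "\<dots> = (MAX k\<in>{..n}. c * X (t * real k / 2 ^ m) \<omega>) + - (c * X 0 \<omega>)"
    by (rule Max_add_commute) auto
  finally show ?thesis by simp
qed

lemma partial_max_incr_tendsto:
  assumes "\<omega> \<in> space M" "0 < t"
  shows "(\<lambda>m. partial_max (2 ^ m) (\<lambda>i. c * incr t m i \<omega>)) \<longlonglongrightarrow> run_max c t \<omega> - c * X 0 \<omega>"
  unfolding partial_max_incr run_max_def
  using cadlag_dyadic_max_tendsto[OF cadlag_cmult[OF assms(1)] assms(2)]
  by (intro tendsto_diff) auto

lemma incr_measurable [measurable]: "0 \<le> t \<Longrightarrow> incr t m i \<in> borel_measurable M"
  unfolding incr_def by (intro borel_measurable_diff rv) auto

lemma partial_max_incr_measurable [measurable]: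
  "0 \<le> t \<Longrightarrow> (\<lambda>\<omega>. partial_max n (\<lambda>i. c * incr t m i \<omega>)) \<in> borel_measurable M"
  by (intro measurable_partial_max borel_measurable_times) auto

text \<open>The supremum runs over uncountably many times; measurability comes from writing it as a
  pointwise limit of finite maxima over dyadic grids.\<close>

lemma run_max_measurable [measurable]:
  assumes "0 < t"
  shows "run_max c t \<in> borel_measurable M"
proof -
  have "(\<lambda>\<omega>. run_max c t \<omega> - c * X 0 \<omega>) \<in> borel_measurable M"
    using assms by (intro borel_measurable_LIMSEQ_real[OF partial_max_incr_tendsto]) auto
  moreover have "(\<lambda>\<omega>. c * X 0 \<omega>) \<in> borel_measurable M"
    using rv[of 0] by auto
  ultimately have "(\<lambda>\<omega>. run_max c t \<omega> - c * X 0 \<omega> + c * X 0 \<omega>) \<in> borel_measurable M"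
    by (rule borel_measurable_add)
  then show ?thesis by simp
qed

lemma path_range_measurable [measurable]: "0 < t \<Longrightarrow> path_range t \<in> borel_measurable M"
  unfolding path_range_def by measurable

lemma run_max_nonneg: "0 < t \<Longrightarrow> AE \<omega> in M. 0 \<le> run_max c t \<omega>"
  using start AE_space
proof eventually_elim
  case (elim \<omega>)
  then show ?case using run_max_upper[of \<omega> 0 t c] by simp
qed

lemma path_range_nonneg:
  assumes "0 < t"
  shows "AE \<omega> in M. 0 \<le> path_range t \<omega>"
  using run_max_nonneg[OF assms, of 1] run_max_nonneg[OF assms, of "-1"]
  by eventually_elim (simp add: path_range_def)

lemma abs_le_path_range:
  assumes "0 < t"
  shows "AE \<omega> in M. \<bar>X t \<omega>\<bar> \<le> path_range t \<omega>"
  using run_max_nonneg[OF assms, of 1] run_max_nonneg[OF assms, of "-1"] AE_space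
proof eventually_elim
  case (elim \<omega>)
  then show ?case using run_max_upper[of \<omega> t t 1] run_max_upper[of \<omega> t t "-1"] assms
    by (auto simp: path_range_def)
qed

lemma incr_indep:
  assumes "0 < t"
  shows "indep_vars (\<lambda>_. borel) (incr t m) {..<2 ^ m}"
proof -
  have "indep_vars (\<lambda>_. borel) (\<lambda>i \<omega>. X (t * real (Suc i) / 2 ^ m) \<omega> - X (t * real i / 2 ^ m) \<omega>) {..<2 ^ m}"
    using assms by (intro indep_increments) (auto simp: strict_mono_on_def field_simps)
  moreover have "incr t m = (\<lambda>i \<omega>. X (t * real (Suc i) / 2 ^ m) \<omega> - X (t * real i / 2 ^ m) \<omega>)"
    by (simp add: incr_def fun_eq_iff)
  ultimately show ?thesis by simp
qed

lemma distr_diff: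
  assumes "0 \<le> s" "s \<le> t"
  shows "distr M borel (\<lambda>\<omega>. X t \<omega> - X s \<omega>) = distr M borel (X (t - s))"
proof -
  have "distr M borel (\<lambda>\<omega>. X t \<omega> - X s \<omega>) = distr M borel (\<lambda>\<omega>. X (t - s) \<omega> - X 0 \<omega>)"
    using stationary_increments[of s "t - s"] assms by simp
  also have "\<dots> = distr M borel (X (t - s))"
    using start rv[of 0] rv[of "t - s"] assms by (intro distr_cong_AE) auto
  finally show ?thesis .
qed

lemma distr_incr:
  assumes "0 \<le> t"
  shows "distr M borel (incr t m i) = distr M borel (X (t / 2 ^ m))"
proof -
  have "incr t m i = (\<lambda>\<omega>. X (t * real (Suc i) / 2 ^ m) \<omega> - X (t * real i / 2 ^ m) \<omega>)"
    by (simp add: incr_def fun_eq_iff)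
  moreover have "t * real (Suc i) / 2 ^ m - t * real i / 2 ^ m = t / 2 ^ m"
    by (simp add: field_simps)
  ultimately show ?thesis
    using distr_diff[of "t * real i / 2 ^ m" "t * real (Suc i) / 2 ^ m"] assms
    by (simp add: divide_right_mono mult_left_mono)
qed

text \<open>A bound linear in time is stable under subdivision: \<open>2 ^ m\<close> increments of
  duration \<open>t / 2 ^ m\<close> contribute \<open>C * t\<close> in total for every
  \<open>m\<close>, so it survives the passage to the limit.\<close>

lemma expectation_min_path_range_le:
  assumes t: "0 < t" and L: "0 \<le> L"
    and C: "\<And>s. 0 < s \<Longrightarrow> expectation (\<lambda>\<omega>. min L \<bar>X s \<omega>\<bar>) \<le> C * s"
  shows "expectation (\<lambda>\<omega>. min L (path_range t \<omega>)) \<le> C * t"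
proof (rule LIMSEQ_le_const2)
  let ?p = "\<lambda>m \<omega>. partial_max (2 ^ m) (\<lambda>i. 1 * incr t m i \<omega>) + partial_max (2 ^ m) (\<lambda>i. (-1) * incr t m i \<omega>)"
  show "(\<lambda>m. expectation (\<lambda>\<omega>. min L (?p m \<omega>))) \<longlonglongrightarrow> expectation (\<lambda>\<omega>. min L (path_range t \<omega>))"
  proof (rule integral_dominated_convergence[where w = "\<lambda>_. L"])
    show "AE \<omega> in M. (\<lambda>m. min L (?p m \<omega>)) \<longlonglongrightarrow> min L (path_range t \<omega>)"
    proof (rule AE_I2, rule tendsto_min[OF tendsto_const])
      fix \<omega> assume \<omega>: "\<omega> \<in> space M"
      show "(\<lambda>m. ?p m \<omega>) \<longlonglongrightarrow> path_range t \<omega>"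
        using tendsto_add[OF partial_max_incr_tendsto[OF \<omega> t, of 1] partial_max_incr_tendsto[OF \<omega> t, of "-1"]]
        by (simp add: path_range_def)
    qed
    show "AE \<omega> in M. norm (min L (?p m \<omega>)) \<le> L" for m
    proof (rule AE_I2)
      fix \<omega>
      have "0 \<le> ?p m \<omega>" by (intro add_nonneg_nonneg partial_max_nonneg)
      then show "norm (min L (?p m \<omega>)) \<le> L" using L by (auto simp: min_def)
    qed
    show "(\<lambda>\<omega>. min L (?p m \<omega>)) \<in> borel_measurable M" for m
      using t by (intro borel_measurable_min borel_measurable_add partial_max_incr_measurable borel_measurable_const) auto
  qed (use t in auto)
  show "\<exists>N. \<forall>m\<ge>N. expectation (\<lambda>\<omega>. min L (?p m \<omega>)) \<le> C * t"
  proof (intro exI[of _ 0] allI impI)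
    fix m :: nat
    have int: "integrable M (\<lambda>\<omega>. min L \<bar>incr t m i \<omega>\<bar>)" for i
      using t L by (intro integrable_min) auto
    have "expectation (\<lambda>\<omega>. min L (?p m \<omega>)) \<le> expectation (\<lambda>\<omega>. \<Sum>i<2 ^ m. min L \<bar>incr t m i \<omega>\<bar>)"
    proof (rule integral_mono)
      fix \<omega>
      have "min L (\<Sum>i\<in>J. \<bar>incr t m i \<omega>\<bar>) \<le> (\<Sum>i\<in>J. min L \<bar>incr t m i \<omega>\<bar>)" if "finite J" for J
        using that
      proof induction
        case (insert i J)
        have sub: "min L (x + y) \<le> min L x + min L y" if "0 \<le> x" "0 \<le> y" for x y :: real
          using that L by (auto simp: min_def)
        show ?case
          using insert sub[of "\<bar>incr t m i \<omega>\<bar>" "\<Sum>i\<in>J. \<bar>incr t m i \<omega>\<bar>"] by (simp add: sum_nonneg)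
      qed simp
      from this[of "{..<2 ^ m}"] show "min L (?p m \<omega>) \<le> (\<Sum>i<2 ^ m. min L \<bar>incr t m i \<omega>\<bar>)"
        using partial_max_le_sum_abs[of "2 ^ m" "\<lambda>i. incr t m i \<omega>"] by simp
      show "integrable M (\<lambda>\<omega>. min L (?p m \<omega>))"
        using t L by (intro integrable_min borel_measurable_add partial_max_incr_measurable)
          (auto intro: add_nonneg_nonneg partial_max_nonneg)
    qed (use int in auto)
    also have "\<dots> = (\<Sum>i<2 ^ m. expectation (\<lambda>\<omega>. min L \<bar>incr t m i \<omega>\<bar>))"
      using int by (intro Bochner_Integration.integral_sum) auto
    also have "\<dots> = (\<Sum>i<(2::nat) ^ m. expectation (\<lambda>\<omega>. min L \<bar>X (t / 2 ^ m) \<omega>\<bar>))"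
    proof (rule sum.cong)
      fix i
      have "expectation (\<lambda>\<omega>. min L \<bar>incr t m i \<omega>\<bar>) = integral\<^sup>L (distr M borel (incr t m i)) (\<lambda>x. min L \<bar>x\<bar>)"
        using t by (subst integral_distr) auto
      also have "\<dots> = expectation (\<lambda>\<omega>. min L \<bar>X (t / 2 ^ m) \<omega>\<bar>)"
        unfolding distr_incr[OF less_imp_le[OF t]] using t rv by (subst integral_distr) auto
      finally show "expectation (\<lambda>\<omega>. min L \<bar>incr t m i \<omega>\<bar>) = expectation (\<lambda>\<omega>. min L \<bar>X (t / 2 ^ m) \<omega>\<bar>)" .
    qed simp
    also have "\<dots> \<le> (\<Sum>i<(2::nat) ^ m. C * (t / 2 ^ m))"
      using C[of "t / 2 ^ m"] t by (intro sum_mono) auto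
    also have "\<dots> = C * t" by simp
    finally show "expectation (\<lambda>\<omega>. min L (?p m \<omega>)) \<le> C * t" .
  qed
qed

end

subsection \<open>Symmetric stable processes\<close>

context symmetric_stable_process
begin

text \<open>Self-similarity and symmetry in one formula: the characteristic function sees only
  \<open>\<bar>r\<bar>\<close>, so \<open>r = - 1\<close> leaves the time unchanged. The case
  \<open>r = 0\<close> is covered by \<open>0 powr \<alpha> = 0\<close>.\<close>

lemma distr_cmult:
  assumes "0 \<le> t"
  shows "distr M borel (\<lambda>\<omega>. r * X t \<omega>) = distr M borel (X (\<bar>r\<bar> powr \<alpha> * t))"
proof (rule Levy_uniqueness)
  have X: "X t \<in> borel_measurable M" "X (\<bar>r\<bar> powr \<alpha> * t) \<in> borel_measurable M"
    using assms by (auto intro: rv)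
  then show "real_distribution (distr M borel (\<lambda>\<omega>. r * X t \<omega>))"
    "real_distribution (distr M borel (X (\<bar>r\<bar> powr \<alpha> * t)))"
    by (auto intro!: real_distribution_distr)
  show "char (distr M borel (\<lambda>\<omega>. r * X t \<omega>)) = char (distr M borel (X (\<bar>r\<bar> powr \<alpha> * t)))"
  proof
    fix \<xi>
    have "char (distr M borel (\<lambda>\<omega>. r * X t \<omega>)) \<xi> = char (distr M borel (X t)) (r * \<xi>)"
      using X unfolding char_def by (simp add: integral_distr mult_ac)
    also have "\<dots> = char (distr M borel (X (\<bar>r\<bar> powr \<alpha> * t))) \<xi>"
      using assms by (simp add: char_stable abs_mult powr_mult mult_ac)
    finally show "char (distr M borel (\<lambda>\<omega>. r * X t \<omega>)) \<xi> = char (distr M borel (X (\<bar>r\<bar> powr \<alpha> * t))) \<xi>" .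
  qed
qed

text \<open>Carries statements about skeletons to the path. The test function takes both maxima
  jointly because the range depends on the pair, and its boundedness provides the dominating
  constant.\<close>

lemma expectation_skeleton_tendsto:
  fixes h :: "real \<Rightarrow> real \<Rightarrow> real"
  assumes h: "continuous_on UNIV (\<lambda>p. h (fst p) (snd p))" and B: "\<And>u v. \<bar>h u v\<bar> \<le> B" and t: "0 < t"
  shows "(\<lambda>m. expectation (\<lambda>\<omega>. h (partial_max (2 ^ m) (\<lambda>i. c * incr t m i \<omega>))
        (partial_max (2 ^ m) (\<lambda>i. - c * incr t m i \<omega>)))) \<longlonglongrightarrow>
    expectation (\<lambda>\<omega>. h (run_max c t \<omega>) (run_max (- c) t \<omega>))"
proof (rule integral_dominated_convergence[where w = "\<lambda>_. B"])
  have [measurable]: "(\<lambda>p. h (fst p) (snd p)) \<in> borel_measurable (borel \<Otimes>\<^sub>M borel)"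
    using borel_measurable_continuous_onI[OF h] by (simp add: borel_prod)
  have hm: "(\<lambda>\<omega>. h (f \<omega>) (g \<omega>)) \<in> borel_measurable M"
    if "f \<in> borel_measurable M" "g \<in> borel_measurable M" for f g
  proof -
    have "(\<lambda>\<omega>. (f \<omega>, g \<omega>)) \<in> M \<rightarrow>\<^sub>M borel \<Otimes>\<^sub>M borel"
      using that by measurable
    from measurable_compose[OF this \<open>(\<lambda>p. h (fst p) (snd p)) \<in> borel_measurable (borel \<Otimes>\<^sub>M borel)\<close>]
    show ?thesis by simp
  qed
  show "(\<lambda>\<omega>. h (run_max c t \<omega>) (run_max (- c) t \<omega>)) \<in> borel_measurable M"
    using t by (intro hm) auto
  show "(\<lambda>\<omega>. h (partial_max (2 ^ m) (\<lambda>i. c * incr t m i \<omega>))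
      (partial_max (2 ^ m) (\<lambda>i. - c * incr t m i \<omega>))) \<in> borel_measurable M" for m
    using t by (intro hm partial_max_incr_measurable) auto
  show "AE \<omega> in M. (\<lambda>m. h (partial_max (2 ^ m) (\<lambda>i. c * incr t m i \<omega>))
        (partial_max (2 ^ m) (\<lambda>i. - c * incr t m i \<omega>))) \<longlonglongrightarrow> h (run_max c t \<omega>) (run_max (- c) t \<omega>)"
    using start AE_space
  proof eventually_elim
    case (elim \<omega>)
    have "(\<lambda>m. (partial_max (2 ^ m) (\<lambda>i. c * incr t m i \<omega>), partial_max (2 ^ m) (\<lambda>i. - c * incr t m i \<omega>)))
        \<longlonglongrightarrow> (run_max c t \<omega>, run_max (- c) t \<omega>)"
      using partial_max_incr_tendsto[OF elim(2) t, of c] partial_max_incr_tendsto[OF elim(2) t, of "- c"] elim(1)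
      by (intro tendsto_Pair) auto
    from continuous_on_tendsto_compose[OF h this] show ?case by simp
  qed
qed (use B in auto)

text \<open>On each grid the increments of \<open>c * X\<close> over \<open>[0, t]\<close> and of
  \<open>X\<close> over \<open>[0, t']\<close> are independent with equal marginals, so the two
  skeletons have the same law; equality of the expectations passes to the limit.\<close>

lemma run_max_scaling:
  fixes h :: "real \<Rightarrow> real \<Rightarrow> real"
  assumes h: "continuous_on UNIV (\<lambda>p. h (fst p) (snd p))" and B: "\<And>u v. \<bar>h u v\<bar> \<le> B"
    and t: "0 < t" and c: "c \<noteq> 0"
  defines "t' \<equiv> \<bar>c\<bar> powr \<alpha> * t"
  shows "expectation (\<lambda>\<omega>. h (run_max c t \<omega>) (run_max (- c) t \<omega>)) =
    expectation (\<lambda>\<omega>. h (run_max 1 t' \<omega>) (run_max (- 1) t' \<omega>))"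
proof (rule LIMSEQ_unique)
  have t': "0 < t'" using c t by (simp add: t'_def)
  show "(\<lambda>m. expectation (\<lambda>\<omega>. h (partial_max (2 ^ m) (\<lambda>i. 1 * incr t' m i \<omega>))
        (partial_max (2 ^ m) (\<lambda>i. - 1 * incr t' m i \<omega>)))) \<longlonglongrightarrow>
    expectation (\<lambda>\<omega>. h (run_max 1 t' \<omega>) (run_max (- 1) t' \<omega>))"
    by (rule expectation_skeleton_tendsto[OF h B t'])
  have hm: "(\<lambda>p. h (fst p) (snd p)) \<in> borel_measurable (borel \<Otimes>\<^sub>M borel)"
    using borel_measurable_continuous_onI[OF h] by (simp add: borel_prod)
  have "expectation (\<lambda>\<omega>. h (partial_max (2 ^ m) (\<lambda>i. c * incr t m i \<omega>))
        (partial_max (2 ^ m) (\<lambda>i. - c * incr t m i \<omega>))) =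
     expectation (\<lambda>\<omega>. h (partial_max (2 ^ m) (\<lambda>i. 1 * incr t' m i \<omega>))
        (partial_max (2 ^ m) (\<lambda>i. - 1 * incr t' m i \<omega>)))" for m
  proof -
    define F where "F = (\<lambda>d. h (partial_max (2 ^ m) d) (partial_max (2 ^ m) (\<lambda>i. - d i)))"
    have "(\<lambda>d. (partial_max (2 ^ m) d, partial_max (2 ^ m) (\<lambda>i. - d i)))
        \<in> PiM {..<2 ^ m} (\<lambda>_. borel) \<rightarrow>\<^sub>M borel \<Otimes>\<^sub>M borel"
      by (intro measurable_Pair measurable_partial_max borel_measurable_uminus measurable_component_singleton) auto
    from measurable_compose[OF this hm]
    have F: "F \<in> borel_measurable (PiM {..<2 ^ m} (\<lambda>_. borel))"
      by (simp add: F_def)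
    have "expectation (\<lambda>\<omega>. F (\<lambda>i\<in>{..<2 ^ m}. c * incr t m i \<omega>)) =
        expectation (\<lambda>\<omega>. F (\<lambda>i\<in>{..<2 ^ m}. incr t' m i \<omega>))"
    proof (rule expectation_indep_vars_cong[OF _ _ incr_indep[OF t'] _ F])
      show "indep_vars (\<lambda>_. borel) (\<lambda>i \<omega>. c * incr t m i \<omega>) {..<2 ^ m}"
        using indep_vars_compose2[OF incr_indep[OF t], where Y = "\<lambda>_ x. c * x"] by simp
      fix i
      have "distr M borel (\<lambda>\<omega>. c * incr t m i \<omega>) = distr (distr M borel (incr t m i)) borel (\<lambda>x. c * x)"
        using t by (subst distr_distr) (auto simp: o_def)
      also have "\<dots> = distr M borel (\<lambda>\<omega>. c * X (t / 2 ^ m) \<omega>)"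
        unfolding distr_incr[OF less_imp_le[OF t]] using t rv[of "t / 2 ^ m"]
        by (subst distr_distr) (auto simp: o_def)
      also have "\<dots> = distr M borel (X (t' / 2 ^ m))"
        using t by (subst distr_cmult) (auto simp: t'_def)
      also have "\<dots> = distr M borel (incr t' m i)"
        using t' by (subst distr_incr) auto
      finally show "distr M borel (\<lambda>\<omega>. c * incr t m i \<omega>) = distr M borel (incr t' m i)" .
    qed (auto simp: lessThan_empty_iff)
    \<comment> \<open>\<open>F\<close> looks only at increments with index below
      \<open>2 ^ m\<close>, so passing to the restricted family does not change its value.\<close>
    moreover have "F (restrict d {..<2 ^ m}) = F d" for d
      unfolding F_def by (intro arg_cong2[where f = h] partial_max_cong) auto
    ultimately show ?thesis by (simp add: F_def)
  qed
  then show "(\<lambda>m. expectation (\<lambda>\<omega>. h (partial_max (2 ^ m) (\<lambda>i. 1 * incr t' m i \<omega>))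
        (partial_max (2 ^ m) (\<lambda>i. - 1 * incr t' m i \<omega>)))) \<longlonglongrightarrow>
    expectation (\<lambda>\<omega>. h (run_max c t \<omega>) (run_max (- c) t \<omega>))"
    using expectation_skeleton_tendsto[OF h B t, of c] by simp
qed

lemma run_max_cmult:
  assumes "0 < c" "\<omega> \<in> space M" "0 < t"
  shows "run_max (c * d) t \<omega> = c * run_max d t \<omega>"
proof -
  have "(\<lambda>m. partial_max (2 ^ m) (\<lambda>i. (c * d) * incr t m i \<omega>)) \<longlonglongrightarrow> c * (run_max d t \<omega> - d * X 0 \<omega>)"
    using tendsto_mult_left[OF partial_max_incr_tendsto[OF assms(2,3), of d], of c] assms(1)
    by (simp add: partial_max_cmult[symmetric] mult.assoc)
  then have "c * (run_max d t \<omega> - d * X 0 \<omega>) = run_max (c * d) t \<omega> - (c * d) * X 0 \<omega>"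
    by (rule LIMSEQ_unique) (rule partial_max_incr_tendsto[OF assms(2,3)])
  then show ?thesis by (simp add: algebra_simps)
qed

lemma expectation_min_path_range_scaling:
  assumes "0 < t" "0 \<le> L"
  shows "expectation (\<lambda>\<omega>. min L (path_range t \<omega>)) = t powr (1 / \<alpha>) * expectation (\<lambda>\<omega>. min (L / t powr (1 / \<alpha>)) (path_range 1 \<omega>))"
proof -
  define c where "c = t powr (1 / \<alpha>)"
  have c: "0 < c" "\<bar>c\<bar> powr \<alpha> * 1 = t" using assms index by (auto simp: c_def powr_powr)
  \<comment> \<open>The inner \<open>max 0\<close> makes \<open>h\<close> bounded for all real
    arguments; almost surely it changes nothing, since the range is nonnegative.\<close>
  define h where "h = (\<lambda>u v :: real. min L (max 0 (u + v)))"
  have "expectation (\<lambda>\<omega>. min L (path_range t \<omega>)) = expectation (\<lambda>\<omega>. h (run_max 1 t \<omega>) (run_max (- 1) t \<omega>))"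
  proof (rule integral_cong_AE)
    show "AE \<omega> in M. min L (path_range t \<omega>) = h (run_max 1 t \<omega>) (run_max (- 1) t \<omega>)"
      using path_range_nonneg[OF assms(1)] by eventually_elim (simp add: h_def path_range_def max_absorb2)
  qed (use assms in \<open>auto simp: h_def\<close>)
  also have "\<dots> = expectation (\<lambda>\<omega>. h (run_max c 1 \<omega>) (run_max (- c) 1 \<omega>))"
    using c(1) assms(2) unfolding c(2)[symmetric]
    by (intro run_max_scaling[symmetric, where B = L]) (auto simp: h_def intro!: continuous_intros)
  also have "\<dots> = expectation (\<lambda>\<omega>. c * min (L / c) (path_range 1 \<omega>))"
  proof (rule integral_cong_AE)
    show "AE \<omega> in M. h (run_max c 1 \<omega>) (run_max (- c) 1 \<omega>) = c * min (L / c) (path_range 1 \<omega>)"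
      using path_range_nonneg[of 1, OF zero_less_one] AE_space
    proof eventually_elim
      case (elim \<omega>)
      then have "run_max c 1 \<omega> + run_max (- c) 1 \<omega> = c * path_range 1 \<omega>"
        using run_max_cmult[OF c(1), of \<omega> 1 1] run_max_cmult[OF c(1), of \<omega> 1 "-1"]
        by (simp add: path_range_def algebra_simps)
      moreover have "0 \<le> c * path_range 1 \<omega>" using elim c by simp
      moreover have "min L (c * r) = c * min (L / c) r" for r
        using c(1) by (auto simp: min_def field_simps)
      ultimately show ?case by (simp add: h_def max_absorb2)
    qed
  qed (use assms in \<open>auto simp: h_def\<close>)
  finally show ?thesis by (simp add: c_def)
qed

text \<open>The scaling law with \<open>c = - 1\<close>, which leaves the time horizon unchanged.
  Truncated expectations are compared here; removing the truncation needs integrability.\<close>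

lemma expectation_min_run_max_sym:
  assumes "0 \<le> T" "0 < t"
  shows "expectation (\<lambda>\<omega>. min T (run_max (- 1) t \<omega>)) = expectation (\<lambda>\<omega>. min T (run_max 1 t \<omega>))"
proof -
  have pos: "expectation (\<lambda>\<omega>. min T (run_max c t \<omega>)) = expectation (\<lambda>\<omega>. min T (max 0 (run_max c t \<omega>)))" for c
  proof (rule integral_cong_AE)
    show "AE \<omega> in M. min T (run_max c t \<omega>) = min T (max 0 (run_max c t \<omega>))"
      using run_max_nonneg[OF assms(2), of c] by eventually_elim (simp add: max_absorb2)
  qed (use assms in auto)
  have "expectation (\<lambda>\<omega>. min T (max 0 (run_max (- 1) t \<omega>))) = expectation (\<lambda>\<omega>. min T (max 0 (run_max 1 t \<omega>)))"
    using run_max_scaling[where h = "\<lambda>u v. min T (max 0 u)" and c = "-1" and B = T and t = t] assms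
    by (simp add: continuous_intros)
  then show ?thesis by (simp add: pos)
qed

section \<open>Comparison of the running maximum with the endpoint\<close>

lemma prob_abs_diff_le:
  assumes s: "0 \<le> s" "s \<le> 1"
  shows "prob {\<omega> \<in> space M. u \<le> \<bar>X 1 \<omega> - X s \<omega>\<bar>} \<le> prob {\<omega> \<in> space M. u \<le> \<bar>X 1 \<omega>\<bar>}"
proof -
  \<comment> \<open>By stationarity and scaling, \<open>X 1 - X s\<close> has the law of
    \<open>r * X 1\<close> with \<open>0 <= r <= 1\<close>, so its tails are no heavier. This yields
    the tail hypothesis of Ottaviani's inequality with a single bound for all grid times.\<close>
  define r where "r = (1 - s) powr (1 / \<alpha>)"
  have r: "0 \<le> r" "r \<le> 1" "\<bar>r\<bar> powr \<alpha> * 1 = 1 - s"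
    using s index by (auto simp: r_def powr_powr intro!: powr_le1)
  have X: "X 1 \<in> borel_measurable M" "X s \<in> borel_measurable M"
    using s by (auto intro: rv)
  have *: "prob {\<omega> \<in> space M. u \<le> \<bar>f \<omega>\<bar>} = measure (distr M borel f) {x. u \<le> \<bar>x\<bar>}"
    if "f \<in> borel_measurable M" for f
    using that by (subst measure_distr) (auto intro!: arg_cong[where f = prob])
  have "distr M borel (\<lambda>\<omega>. X 1 \<omega> - X s \<omega>) = distr M borel (\<lambda>\<omega>. r * X 1 \<omega>)"
    using distr_diff[OF s] distr_cmult[of 1 r] r(3) by simp
  then have "prob {\<omega> \<in> space M. u \<le> \<bar>X 1 \<omega> - X s \<omega>\<bar>} = prob {\<omega> \<in> space M. u \<le> \<bar>r * X 1 \<omega>\<bar>}"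
    using X by (subst (1 2) *) auto
  also have "\<dots> \<le> prob {\<omega> \<in> space M. u \<le> \<bar>X 1 \<omega>\<bar>}"
  proof (rule finite_measure_mono)
    show "{\<omega> \<in> space M. u \<le> \<bar>r * X 1 \<omega>\<bar>} \<subseteq> {\<omega> \<in> space M. u \<le> \<bar>X 1 \<omega>\<bar>}"
    proof safe
      fix \<omega> assume "u \<le> \<bar>r * X 1 \<omega>\<bar>"
      also have "\<dots> \<le> \<bar>X 1 \<omega>\<bar>"
        using r mult_right_mono[of r 1 "\<bar>X 1 \<omega>\<bar>"] by (simp add: abs_mult)
      finally show "u \<le> \<bar>X 1 \<omega>\<bar>" .
    qed
  qed (use X in measurable)
  finally show ?thesis .
qed

lemma ex_prob_abs_le:
  assumes "0 < \<delta>"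
  shows "\<exists>K>0. prob {\<omega> \<in> space M. K \<le> \<bar>X 1 \<omega>\<bar>} \<le> \<delta>"
proof -
  have X: "X 1 \<in> borel_measurable M" by (auto intro: rv)
  then interpret D: real_distribution "distr M borel (\<lambda>\<omega>. \<bar>X 1 \<omega>\<bar>)"
    by (auto intro!: real_distribution_distr)
  have "\<forall>\<^sub>F K in at_top. cdf (distr M borel (\<lambda>\<omega>. \<bar>X 1 \<omega>\<bar>)) K > 1 - \<delta>"
    using assms by (intro order_tendstoD(1)[OF D.cdf_lim_at_top_prob]) simp
  then obtain K where K: "0 \<le> K" "cdf (distr M borel (\<lambda>\<omega>. \<bar>X 1 \<omega>\<bar>)) K > 1 - \<delta>"
    using eventually_conj[OF eventually_ge_at_top[of 0]] by (metis (mono_tags, lifting) eventually_happens' trivial_limit_at_top_linorder)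
  have "cdf (distr M borel (\<lambda>\<omega>. \<bar>X 1 \<omega>\<bar>)) K = prob {\<omega> \<in> space M. \<bar>X 1 \<omega>\<bar> \<le> K}"
    unfolding cdf_def using X by (subst measure_distr) (auto intro!: arg_cong[where f = prob])
  also have "{\<omega> \<in> space M. \<bar>X 1 \<omega>\<bar> \<le> K} = space M - {\<omega> \<in> space M. K < \<bar>X 1 \<omega>\<bar>}" by auto
  also have "prob \<dots> = 1 - prob {\<omega> \<in> space M. K < \<bar>X 1 \<omega>\<bar>}"
    using X by (intro prob_compl) measurable
  finally have "prob {\<omega> \<in> space M. K < \<bar>X 1 \<omega>\<bar>} \<le> \<delta>" using K(2) by simp
  \<comment> \<open>The distribution function controls strict exceedance of \<open>K\<close>;
    passing to \<open>K + 1\<close> gives the weak inequality and a positive level.\<close>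
  moreover have "prob {\<omega> \<in> space M. K + 1 \<le> \<bar>X 1 \<omega>\<bar>} \<le> prob {\<omega> \<in> space M. K < \<bar>X 1 \<omega>\<bar>}"
    using X by (intro finite_measure_mono) (auto, measurable)
  ultimately show ?thesis using K(1) by (intro exI[of _ "K + 1"]) auto
qed

lemma expectation_min_max_zero:
  fixes Y :: "'a \<Rightarrow> real"
  assumes "0 \<le> T" "Y \<in> borel_measurable M" "AE \<omega> in M. 0 \<le> Y \<omega>"
  shows "expectation (\<lambda>\<omega>. min T (max 0 (Y \<omega>))) = expectation (\<lambda>\<omega>. min T (Y \<omega>))"
proof (rule integral_cong_AE)
  note [measurable] = assms(2)
  show "(\<lambda>\<omega>. min T (max 0 (Y \<omega>))) \<in> borel_measurable M" "(\<lambda>\<omega>. min T (Y \<omega>)) \<in> borel_measurable M"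
    by measurable
qed (use assms in \<open>auto simp: max_absorb2\<close>)

text \<open>Ottaviani's inequality with \<open>u = \<delta> * l\<close>: for
  \<open>l >= K / \<delta>\<close> the shift is at least \<open>K\<close>, where the tail is at most
  \<delta>. One factor \<open>1 / (1 - \<delta>)\<close> is the loss of the inequality, the other
  comes from lowering the level to \<open>(1 - \<delta>) * l\<close>.\<close>

lemma expectation_min_run_max_le:
  assumes c: "\<bar>c\<bar> = 1" and \<delta>: "0 < \<delta>" "\<delta> < 1" and T: "0 \<le> T"
    and K: "0 < K" "prob {\<omega> \<in> space M. K \<le> \<bar>X 1 \<omega>\<bar>} \<le> \<delta>"
  shows "expectation (\<lambda>\<omega>. min T (run_max c 1 \<omega>)) \<le>
    K / \<delta> + 1 / (1 - \<delta>) * (1 / (1 - \<delta>)) * expectation (\<lambda>\<omega>. min T (max 0 (c * X 1 \<omega>)))"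
proof -
  have X: "X 1 \<in> borel_measurable M" "X 0 \<in> borel_measurable M" by (auto intro: rv)
  \<comment> \<open>The full sum of the increments is \<open>X 1 - X 0\<close> on every path;
    \<open>X 0\<close> is dropped almost surely only at the end.\<close>
  define Z where "Z = (\<lambda>\<omega>. max 0 (c * (X 1 \<omega> - X 0 \<omega>)))"
  have Z: "Z \<in> borel_measurable M" "\<And>\<omega>. 0 \<le> Z \<omega>" using X by (auto simp: Z_def)
  have bound: "expectation (\<lambda>\<omega>. min T (partial_max (2 ^ m) (\<lambda>i. c * incr 1 m i \<omega>))) \<le>
      K / \<delta> + 1 / (1 - \<delta>) * (1 / (1 - \<delta>)) * expectation (\<lambda>\<omega>. min T (Z \<omega>))" for m
  proof (rule expectation_min_le_of_tail_le)
    fix l assume l: "K / \<delta> \<le> l"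
    then have l': "K \<le> \<delta> * l" using \<delta> by (simp add: field_simps)
    have "0 < l" using l K \<delta> by (smt (verit) divide_pos_pos)
    have sum: "(\<Sum>i\<in>{k..<2 ^ m}. c * incr 1 m i \<omega>) = c * (X 1 \<omega> - X (real k / 2 ^ m) \<omega>)" if "k \<le> 2 ^ m" for k \<omega>
      using sum_incr[of k "2 ^ m" 1 m \<omega>] that by (simp flip: sum_distrib_left)
    have "(1 - \<delta>) * prob {\<omega> \<in> space M. l < partial_max (2 ^ m) (\<lambda>i. c * incr 1 m i \<omega>)} \<le>
        prob {\<omega> \<in> space M. l - \<delta> * l < (\<Sum>i<2 ^ m. c * incr 1 m i \<omega>)}"
    proof (rule ottaviani_inequality)
      show "indep_vars (\<lambda>_. borel) (\<lambda>i \<omega>. c * incr 1 m i \<omega>) {..<2 ^ m}"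
        using indep_vars_compose2[OF incr_indep[of 1 m], where Y = "\<lambda>_ x. c * x"] by simp
      fix k :: nat assume k: "k \<le> 2 ^ m"
      have k': "real k / 2 ^ m \<le> 1"
        using k by (metis divide_le_eq_1_pos of_nat_le_iff of_nat_numeral of_nat_power zero_less_numeral zero_less_power)
      then have "X (real k / 2 ^ m) \<in> borel_measurable M" by (auto intro: rv)
      then have "prob {\<omega> \<in> space M. (\<Sum>i\<in>{k..<2 ^ m}. c * incr 1 m i \<omega>) \<le> - (\<delta> * l)} \<le>
          prob {\<omega> \<in> space M. \<delta> * l \<le> \<bar>X 1 \<omega> - X (real k / 2 ^ m) \<omega>\<bar>}"
      proof (intro finite_measure_mono)
        show "{\<omega> \<in> space M. (\<Sum>i\<in>{k..<2 ^ m}. c * incr 1 m i \<omega>) \<le> - (\<delta> * l)} \<subseteq>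
          {\<omega> \<in> space M. \<delta> * l \<le> \<bar>X 1 \<omega> - X (real k / 2 ^ m) \<omega>\<bar>}"
          using c k by (auto simp: sum abs_if split: if_splits)
      qed (use X in measurable)
      also have "\<dots> \<le> prob {\<omega> \<in> space M. \<delta> * l \<le> \<bar>X 1 \<omega>\<bar>}"
        using k' by (intro prob_abs_diff_le) auto
      also have "\<dots> \<le> prob {\<omega> \<in> space M. K \<le> \<bar>X 1 \<omega>\<bar>}"
        using X l' by (intro finite_measure_mono) (auto, measurable)
      also have "\<dots> \<le> \<delta>" by (rule K)
      finally show "prob {\<omega> \<in> space M. (\<Sum>i\<in>{k..<2 ^ m}. c * incr 1 m i \<omega>) \<le> - (\<delta> * l)} \<le> \<delta>" .
    qed
    \<comment> \<open>The level \<open>l - \<delta> * l\<close> is positive, so replacing the sum by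
      its positive part does not affect the event.\<close>
    also have "{\<omega> \<in> space M. l - \<delta> * l < (\<Sum>i<2 ^ m. c * incr 1 m i \<omega>)} = {\<omega> \<in> space M. l < 1 / (1 - \<delta>) * Z \<omega>}"
    proof -
      have "l - \<delta> * l < y \<longleftrightarrow> l < 1 / (1 - \<delta>) * max 0 y" for y
      proof -
        have "0 < l - \<delta> * l" using \<open>0 < l\<close> \<delta> by (simp add: algebra_simps)
        then have "l - \<delta> * l < y \<longleftrightarrow> (1 - \<delta>) * l < max 0 y" by (auto simp: max_def algebra_simps)
        then show ?thesis using \<delta> by (simp add: field_simps)
      qed
      then show ?thesis
        using sum[of 0] by (auto simp: Z_def lessThan_atLeast0)
    qed
    finally show "prob {\<omega> \<in> space M. l < partial_max (2 ^ m) (\<lambda>i. c * incr 1 m i \<omega>)} \<le>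
        1 / (1 - \<delta>) * prob {\<omega> \<in> space M. l < 1 / (1 - \<delta>) * Z \<omega>}"
      using \<delta> by (simp add: field_simps)
  qed (use \<delta> K T Z in \<open>auto intro: partial_max_nonneg\<close>)
  have "(\<lambda>m. expectation (\<lambda>\<omega>. min T (max 0 (partial_max (2 ^ m) (\<lambda>i. c * incr 1 m i \<omega>))))) \<longlonglongrightarrow>
      expectation (\<lambda>\<omega>. min T (max 0 (run_max c 1 \<omega>)))"
    using T by (intro expectation_skeleton_tendsto[where h = "\<lambda>u v. min T (max 0 u)" and B = T]) (auto intro!: continuous_intros)
  then have "(\<lambda>m. expectation (\<lambda>\<omega>. min T (partial_max (2 ^ m) (\<lambda>i. c * incr 1 m i \<omega>)))) \<longlonglongrightarrow>
      expectation (\<lambda>\<omega>. min T (run_max c 1 \<omega>))"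
    using expectation_min_max_zero[OF T run_max_measurable[of 1 c] run_max_nonneg[of 1 c]]
    by (simp add: max_absorb2 partial_max_nonneg)
  then have "expectation (\<lambda>\<omega>. min T (run_max c 1 \<omega>)) \<le>
      K / \<delta> + 1 / (1 - \<delta>) * (1 / (1 - \<delta>)) * expectation (\<lambda>\<omega>. min T (Z \<omega>))"
    using bound by (intro LIMSEQ_le_const2) auto
  also have "expectation (\<lambda>\<omega>. min T (Z \<omega>)) = expectation (\<lambda>\<omega>. min T (max 0 (c * X 1 \<omega>)))"
    using X Z start by (intro integral_cong_AE) (auto simp: Z_def)
  finally show ?thesis .
qed

text \<open>Truncation is subadditive over the two maxima, and the truncated positive and negative
  parts of \<open>X 1\<close> add up to the truncation of \<open>\<bar>X 1\<bar>\<close>. Treating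
  the two directions separately therefore does not double the main term.\<close>

lemma expectation_min_path_range_le_abs:
  assumes "0 < \<eta>"
  shows "\<exists>K. \<forall>T\<ge>0. expectation (\<lambda>\<omega>. min T (path_range 1 \<omega>)) \<le> K + (1 + \<eta>) * expectation (\<lambda>\<omega>. min T \<bar>X 1 \<omega>\<bar>)"
proof -
  have X: "X 1 \<in> borel_measurable M" by (auto intro: rv)
  \<comment> \<open>Chosen so that the product of the two factors \<open>1 / (1 - \<delta>)\<close>
    is exactly \<open>1 + \<eta>\<close>.\<close>
  define \<delta> where "\<delta> = 1 - 1 / sqrt (1 + \<eta>)"
  have \<delta>: "0 < \<delta>" "\<delta> < 1" using assms by (auto simp: \<delta>_def)
  have d: "1 / (1 - \<delta>) * (1 / (1 - \<delta>)) = 1 + \<eta>"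
    using assms by (simp add: \<delta>_def)
  obtain K where K: "0 < K" "prob {\<omega> \<in> space M. K \<le> \<bar>X 1 \<omega>\<bar>} \<le> \<delta>"
    using ex_prob_abs_le[OF \<delta>(1)] by auto
  have "expectation (\<lambda>\<omega>. min T (path_range 1 \<omega>)) \<le> 2 * (K / \<delta>) + (1 + \<eta>) * expectation (\<lambda>\<omega>. min T \<bar>X 1 \<omega>\<bar>)"
    if T: "0 \<le> T" for T
  proof -
    have int: "integrable M (\<lambda>\<omega>. min T (run_max c 1 \<omega>))" for c
      using T by (intro integrable_min run_max_nonneg) auto
    have int': "integrable M (\<lambda>\<omega>. min T (max 0 (c * X 1 \<omega>)))" for c
      using T X by (intro integrable_min) auto
    have "expectation (\<lambda>\<omega>. min T (path_range 1 \<omega>)) \<le>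
        expectation (\<lambda>\<omega>. min T (run_max 1 1 \<omega>) + min T (run_max (- 1) 1 \<omega>))"
    proof (rule integral_mono_AE)
      show "AE \<omega> in M. min T (path_range 1 \<omega>) \<le> min T (run_max 1 1 \<omega>) + min T (run_max (- 1) 1 \<omega>)"
        using run_max_nonneg[of 1 1, OF zero_less_one] run_max_nonneg[of 1 "-1", OF zero_less_one]
        by eventually_elim (use T in \<open>auto simp: path_range_def min_def\<close>)
      show "integrable M (\<lambda>\<omega>. min T (path_range 1 \<omega>))"
        using T by (intro integrable_min path_range_nonneg) auto
    qed (use int in auto)
    also have "\<dots> = expectation (\<lambda>\<omega>. min T (run_max 1 1 \<omega>)) + expectation (\<lambda>\<omega>. min T (run_max (- 1) 1 \<omega>))"
      using int by simp
    also have "\<dots> \<le> (K / \<delta> + (1 + \<eta>) * expectation (\<lambda>\<omega>. min T (max 0 (1 * X 1 \<omega>)))) +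
        (K / \<delta> + (1 + \<eta>) * expectation (\<lambda>\<omega>. min T (max 0 (- 1 * X 1 \<omega>))))"
      using expectation_min_run_max_le[of 1, OF _ \<delta> T K] expectation_min_run_max_le[of "- 1", OF _ \<delta> T K]
      unfolding d by (intro add_mono) auto
    also have "\<dots> = 2 * (K / \<delta>) + (1 + \<eta>) * (expectation (\<lambda>\<omega>. min T (max 0 (1 * X 1 \<omega>))) + expectation (\<lambda>\<omega>. min T (max 0 (- 1 * X 1 \<omega>))))"
      by (simp add: algebra_simps)
    also have "expectation (\<lambda>\<omega>. min T (max 0 (1 * X 1 \<omega>))) + expectation (\<lambda>\<omega>. min T (max 0 (- 1 * X 1 \<omega>))) =
        expectation (\<lambda>\<omega>. min T (max 0 (1 * X 1 \<omega>)) + min T (max 0 (- 1 * X 1 \<omega>)))"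
      using int'[of 1] int'[of "-1"] by (intro Bochner_Integration.integral_add[symmetric])
    also have "\<dots> = expectation (\<lambda>\<omega>. min T \<bar>X 1 \<omega>\<bar>)"
      using T by (intro Bochner_Integration.integral_cong refl) (auto simp: min_def max_def)
    finally show ?thesis .
  qed
  then show ?thesis by blast
qed

section \<open>Truncated moments through the characteristic function\<close>

lemma expectation_cos:
  assumes "0 \<le> t"
  shows "expectation (\<lambda>\<omega>. cos (x * X t \<omega>)) = exp (- (t * \<bar>x\<bar> powr \<alpha>))"
proof -
  have X: "X t \<in> borel_measurable M" using assms by (rule rv)
  interpret D: real_distribution "distr M borel (X t)"
    using X by (rule real_distribution_distr)
  have "exp (- (t * \<bar>x\<bar> powr \<alpha>)) = Re (char (distr M borel (X t)) x)"
    using char_stable[OF assms, of x] by simp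
  also have "\<dots> = (\<integral>y. Re (iexp (x * y)) \<partial>distr M borel (X t))"
    unfolding char_def by (rule integral_Re[symmetric], rule D.integrable_iexp) auto
  also have "\<dots> = (\<integral>y. cos (x * y) \<partial>distr M borel (X t))"
    by (simp add: Re_exp)
  also have "\<dots> = expectation (\<lambda>\<omega>. cos (x * X t \<omega>))"
    using X by (subst integral_distr) auto
  finally show ?thesis ..
qed

text \<open>Stated in \<open>ennreal\<close>, where Tonelli applies because the integrand is
  nonnegative; finiteness of the right side then comes from the bounded expectation on the
  left.\<close>

lemma expectation_min_abs:
  assumes t: "0 \<le> t" and L: "0 \<le> L"
  shows "ennreal (pi / 2 * expectation (\<lambda>\<omega>. min L \<bar>X t \<omega>\<bar>)) =
    (\<integral>\<^sup>+x\<in>{0<..}. ennreal ((1 - exp (- (t * x powr \<alpha>))) * (1 - cos (L * x)) / x\<^sup>2) \<partial>lborel)"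
proof -
  interpret pair_sigma_finite M lborel ..
  have X[measurable]: "X t \<in> borel_measurable M" using t by (rule rv)
  have int: "integrable M (\<lambda>\<omega>. min L \<bar>X t \<omega>\<bar>)"
    using L by (intro integrable_min) auto
  have "ennreal (pi / 2 * expectation (\<lambda>\<omega>. min L \<bar>X t \<omega>\<bar>)) = (\<integral>\<^sup>+\<omega>. ennreal (pi / 2 * min L \<bar>X t \<omega>\<bar>) \<partial>M)"
    using int L by (subst nn_integral_eq_integral) auto
  also have "\<dots> = (\<integral>\<^sup>+\<omega>. (\<integral>\<^sup>+x. ennreal ((1 - cos (X t \<omega> * x)) * (1 - cos (L * x)) / x\<^sup>2) * indicator {0<..} x \<partial>lborel) \<partial>M)"
    using has_integral_min_abs[OF L] L
    by (intro nn_integral_cong has_integral_iff_set_nn_integral[THEN iffD1, symmetric]) auto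
  also have "\<dots> = (\<integral>\<^sup>+x. (\<integral>\<^sup>+\<omega>. ennreal ((1 - cos (X t \<omega> * x)) * (1 - cos (L * x)) / x\<^sup>2) * indicator {0<..} x \<partial>M) \<partial>lborel)"
    by (rule Fubini'[symmetric]) measurable
  also have "\<dots> = (\<integral>\<^sup>+x\<in>{0<..}. ennreal ((1 - exp (- (t * x powr \<alpha>))) * (1 - cos (L * x)) / x\<^sup>2) \<partial>lborel)"
  proof (rule nn_integral_cong)
    fix x :: real
    show "(\<integral>\<^sup>+\<omega>. ennreal ((1 - cos (X t \<omega> * x)) * (1 - cos (L * x)) / x\<^sup>2) * indicator {0<..} x \<partial>M) =
        ennreal ((1 - exp (- (t * x powr \<alpha>))) * (1 - cos (L * x)) / x\<^sup>2) * indicator {0<..} x"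
    proof (cases "x > 0")
      case True
      have int: "integrable M (\<lambda>\<omega>. cos (x * X t \<omega>))"
        by (intro integrable_const_bound[where B = 1]) auto
      have "(\<integral>\<^sup>+\<omega>. ennreal ((1 - cos (X t \<omega> * x)) * (1 - cos (L * x)) / x\<^sup>2) \<partial>M) =
          (\<integral>\<^sup>+\<omega>. ennreal ((1 - cos (L * x)) / x\<^sup>2 * (1 - cos (x * X t \<omega>))) \<partial>M)"
        by (simp add: mult_ac)
      also have "\<dots> = ennreal (expectation (\<lambda>\<omega>. (1 - cos (L * x)) / x\<^sup>2 * (1 - cos (x * X t \<omega>))))"
        using int by (intro nn_integral_eq_integral) auto
      also have "expectation (\<lambda>\<omega>. (1 - cos (L * x)) / x\<^sup>2 * (1 - cos (x * X t \<omega>))) =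
          (1 - cos (L * x)) / x\<^sup>2 * (1 - exp (- (t * x powr \<alpha>)))"
        using int True expectation_cos[OF t, of x] by (simp add: prob_space)
      finally show ?thesis using True by (simp add: mult_ac)
    qed simp
  qed
  finally show ?thesis .
qed

lemma expectation_min_abs_cauchy:
  assumes "\<alpha> = 1" "0 < t" "0 < L"
  shows "expectation (\<lambda>\<omega>. min L \<bar>X t \<omega>\<bar>) = 2 / pi * (L * arctan (t / L) + t / 2 * ln (1 + (L / t)\<^sup>2))"
proof -
  have nn: "0 \<le> expectation (\<lambda>\<omega>. min L \<bar>X t \<omega>\<bar>)" using assms by (intro Bochner_Integration.integral_nonneg) auto
  have "ennreal (pi / 2 * expectation (\<lambda>\<omega>. min L \<bar>X t \<omega>\<bar>)) =
     (\<integral>\<^sup>+x\<in>{0<..}. ennreal ((1 - exp (- (t * x powr \<alpha>))) * (1 - cos (L * x)) / x\<^sup>2) \<partial>lborel)"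
    using assms by (intro expectation_min_abs) auto
  also have "\<dots> = (\<integral>\<^sup>+x\<in>{0<..}. ennreal ((1 - exp (- (t * x))) * (1 - cos (L * x)) / x\<^sup>2) \<partial>lborel)"
    using assms(1) by (intro nn_integral_cong) (auto split: split_indicator)
  also have "\<dots> = ennreal (L * arctan (t / L) + t / 2 * ln (1 + (L / t)\<^sup>2))"
    using assms by (intro nn_integral_cauchy_trunc)
  finally have "pi / 2 * expectation (\<lambda>\<omega>. min L \<bar>X t \<omega>\<bar>) = L * arctan (t / L) + t / 2 * ln (1 + (L / t)\<^sup>2)"
    using assms nn by (subst (asm) ennreal_inj) auto
  then show ?thesis by (simp add: field_simps)
qed

text \<open>Since \<open>1 - exp (- y) <= y\<close>, the Fourier integrand divided by
  \<open>t\<close> is dominated by its own limit \<open>w\<close> as \<open>t\<close> tends to 0.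
  Domination gives the linear bound and dominated convergence the limit, with the same constant: the
  integral of \<open>w\<close> is \<open>pi / 2 * C\<close>, by the cosine integral for
  \<open>b = 1 - \<alpha>\<close>, which is positive as \<alpha> < 1.\<close>

lemma
  assumes a: "\<alpha> < 1" and L: "0 < L"
  defines "C \<equiv> 2 * L powr (1 - \<alpha>) * stable_const \<alpha> / (\<alpha> * (1 - \<alpha>))"
  shows expectation_min_abs_le: "\<And>t. 0 < t \<Longrightarrow> expectation (\<lambda>\<omega>. min L \<bar>X t \<omega>\<bar>) \<le> C * t"
    and expectation_min_abs_tendsto: "((\<lambda>t. expectation (\<lambda>\<omega>. min L \<bar>X t \<omega>\<bar>) / t) \<longlongrightarrow> C) (at_right 0)"
proof -
  define w where "w = (\<lambda>x. (1 - cos (L * x)) / x powr (1 + (1 - \<alpha>)) * indicator {0<..} x)"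
  define f where "f = (\<lambda>t x. (1 - exp (- (t * x powr \<alpha>))) / t * ((1 - cos (L * x)) / x\<^sup>2) * indicator {0<..} x)"
  have "stable_const \<alpha> > 0"
    unfolding stable_const_def using index(1) a
    by (intro mult_pos_pos Gamma_real_pos sin_gt_zero) (auto simp: field_simps)
  then have C: "0 \<le> C" using index(1) a by (simp add: C_def)
  have w_nonneg: "0 \<le> w x" for x by (auto simp: w_def)
  have [measurable]: "w \<in> borel_measurable lborel" "f t \<in> borel_measurable lborel" for t
    by (auto simp: w_def f_def)
  have "(\<integral>\<^sup>+x. ennreal (w x) \<partial>lborel) = (\<integral>\<^sup>+x\<in>{0<..}. ennreal ((1 - cos (L * x)) / x powr (1 + (1 - \<alpha>))) \<partial>lborel)"
    by (intro nn_integral_cong) (auto simp: w_def split: split_indicator)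
  also have "\<dots> = ennreal (L powr (1 - \<alpha>) * (Gamma ((1 - \<alpha>) / 2) * Gamma (1 - (1 - \<alpha>) / 2)) / (2 * Gamma (1 + (1 - \<alpha>))))"
    using L a index(1) by (intro nn_integral_one_minus_cos_powr) auto
  also have "L powr (1 - \<alpha>) * (Gamma ((1 - \<alpha>) / 2) * Gamma (1 - (1 - \<alpha>) / 2)) / (2 * Gamma (1 + (1 - \<alpha>))) = pi / 2 * C"
    by (subst times_divide_eq_right[symmetric], subst stable_const_altdef[OF index(1) a]) (simp add: C_def)
  finally have nn_w: "(\<integral>\<^sup>+x. ennreal (w x) \<partial>lborel) = ennreal (pi / 2 * C)" .
  have w: "integrable lborel w" "integral\<^sup>L lborel w = pi / 2 * C"
    using nn_integral_eq_integrable[of w lborel "pi / 2 * C"] nn_w w_nonneg C by auto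
  have f_nonneg: "0 \<le> f t x" if "0 < t" for t x
    using that by (auto simp: f_def)
  have f_le: "f t x \<le> w x" if "0 < t" for t x
  proof (cases "x > 0")
    case True
    have "1 - exp (- (t * x powr \<alpha>)) \<le> t * x powr \<alpha>"
      using exp_ge_add_one_self[of "- (t * x powr \<alpha>)"] by simp
    then have "(1 - exp (- (t * x powr \<alpha>))) / t \<le> x powr \<alpha>"
      using that by (simp add: field_simps)
    then have "(1 - exp (- (t * x powr \<alpha>))) / t * ((1 - cos (L * x)) / x\<^sup>2) \<le> x powr \<alpha> * ((1 - cos (L * x)) / x\<^sup>2)"
      by (rule mult_right_mono) simp
    then have "f t x \<le> x powr \<alpha> * ((1 - cos (L * x)) / x\<^sup>2)"
      using True unfolding f_def by simp
    also have "\<dots> = w x"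
      using True by (simp add: w_def powr_add powr_diff power2_eq_square)
    finally show ?thesis .
  qed (simp add: f_def w_def)
  have f_int: "integrable lborel (f t)" if "0 < t" for t
    using f_nonneg[OF that] f_le[OF that] w_nonneg
    by (intro Bochner_Integration.integrable_bound[OF w(1)]) auto
  have E: "expectation (\<lambda>\<omega>. min L \<bar>X t \<omega>\<bar>) / t = 2 / pi * integral\<^sup>L lborel (f t)" if t: "0 < t" for t
  proof -
    have nn: "0 \<le> expectation (\<lambda>\<omega>. min L \<bar>X t \<omega>\<bar>)" "0 \<le> integral\<^sup>L lborel (f t)"
      using L f_nonneg[OF t] by (auto intro!: Bochner_Integration.integral_nonneg)
    have "ennreal (pi / 2 * expectation (\<lambda>\<omega>. min L \<bar>X t \<omega>\<bar>)) = (\<integral>\<^sup>+x. ennreal (t * f t x) \<partial>lborel)"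
      unfolding expectation_min_abs[OF less_imp_le[OF t] less_imp_le[OF L]]
      using t by (intro nn_integral_cong) (auto simp: f_def split: split_indicator)
    also have "\<dots> = ennreal (t * integral\<^sup>L lborel (f t))"
      using t f_int[OF t] f_nonneg[OF t] by (subst nn_integral_eq_integral) auto
    finally have "pi / 2 * expectation (\<lambda>\<omega>. min L \<bar>X t \<omega>\<bar>) = t * integral\<^sup>L lborel (f t)"
      using nn t by (subst (asm) ennreal_inj) auto
    then show ?thesis using t by (simp add: field_simps)
  qed
  show "expectation (\<lambda>\<omega>. min L \<bar>X t \<omega>\<bar>) \<le> C * t" if t: "0 < t" for t
  proof -
    have "integral\<^sup>L lborel (f t) \<le> pi / 2 * C"
      unfolding w(2)[symmetric] by (intro integral_mono f_int[OF t] w(1) f_le[OF t])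
    then have "2 / pi * integral\<^sup>L lborel (f t) \<le> C" by (simp add: field_simps)
    then have "expectation (\<lambda>\<omega>. min L \<bar>X t \<omega>\<bar>) / t \<le> C" by (simp only: E[OF t])
    then show ?thesis using t by (simp add: divide_le_eq)
  qed
  show "((\<lambda>t. expectation (\<lambda>\<omega>. min L \<bar>X t \<omega>\<bar>) / t) \<longlongrightarrow> C) (at_right 0)"
    unfolding tendsto_at_iff_sequentially
  proof (intro allI impI)
    fix T :: "nat \<Rightarrow> real" assume T: "\<forall>i. T i \<in> {0<..} - {0}" "T \<longlonglongrightarrow> 0"
    have "(\<lambda>n. integral\<^sup>L lborel (f (T n))) \<longlonglongrightarrow> integral\<^sup>L lborel w"
    proof (rule integral_dominated_convergence[where w = w])
      show "AE x in lborel. (\<lambda>n. f (T n) x) \<longlonglongrightarrow> w x"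
      proof (rule AE_I2)
        fix x :: real
        show "(\<lambda>n. f (T n) x) \<longlonglongrightarrow> w x"
        proof (cases "x > 0")
          case True
          have "((\<lambda>t. (1 - exp (- (t * x powr \<alpha>))) / t) \<longlongrightarrow> x powr \<alpha>) (at_right 0)"
            using True by real_asymp
          then have "(\<lambda>n. (1 - exp (- (T n * x powr \<alpha>))) / T n) \<longlonglongrightarrow> x powr \<alpha>"
            using T unfolding tendsto_at_iff_sequentially by (auto simp: o_def)
          then have "(\<lambda>n. f (T n) x) \<longlonglongrightarrow> x powr \<alpha> * ((1 - cos (L * x)) / x\<^sup>2)"
            using tendsto_mult_right[of _ _ _ "(1 - cos (L * x)) / x\<^sup>2"] True by (force simp: f_def)
          also have "x powr \<alpha> * ((1 - cos (L * x)) / x\<^sup>2) = w x"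
            using True by (simp add: w_def powr_add powr_diff power2_eq_square)
          finally show ?thesis .
        qed (simp add: f_def w_def)
      qed
      show "AE x in lborel. norm (f (T n) x) \<le> w x" for n
        using T f_nonneg[of "T n"] f_le[of "T n"] by (intro AE_I2) auto
    qed (use w in auto)
    then have "(\<lambda>n. 2 / pi * integral\<^sup>L lborel (f (T n))) \<longlonglongrightarrow> 2 / pi * (pi / 2 * C)"
      unfolding w(2) by (intro tendsto_mult_left)
    then show "((\<lambda>t. expectation (\<lambda>\<omega>. min L \<bar>X t \<omega>\<bar>) / t) \<circ> T) \<longlonglongrightarrow> C"
      using T by (simp add: o_def E)
  qed
qed

text \<open>The point is uniformity in \<open>L\<close>. On \<open>[0, 1]\<close> the integrand is
  at most \<open>2 * x powr (\<alpha> - 2)\<close>, integrable because \<alpha> > 1; beyond 1 it is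
  at most \<open>2 / x^2\<close>.\<close>

lemma expectation_min_abs_bounded:
  assumes a: "1 < \<alpha>" and L: "0 \<le> L"
  shows "pi / 2 * expectation (\<lambda>\<omega>. min L \<bar>X 1 \<omega>\<bar>) \<le> 2 / (\<alpha> - 1) + 2"
proof -
  have cos: "1 - cos (L * x) \<le> 2" for x
    using cos_ge_minus_one[of "L * x"] by linarith
  have low: "(1 - exp (- (1 * x powr \<alpha>))) * (1 - cos (L * x)) / x\<^sup>2 \<le> 2 * x powr (\<alpha> - 2)" if "0 < x" for x
  proof -
    have "(1 - exp (- (1 * x powr \<alpha>))) * (1 - cos (L * x)) \<le> x powr \<alpha> * 2"
      using exp_ge_add_one_self[of "- (x powr \<alpha>)"] by (intro mult_mono cos) auto
    then show ?thesis using that by (simp add: powr_diff divide_right_mono)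
  qed
  have high: "(1 - exp (- (1 * x powr \<alpha>))) * (1 - cos (L * x)) / x\<^sup>2 \<le> 2 * (1 / x powr (1 + 1))" if "1 \<le> x" for x
  proof -
    have "(1 - exp (- (1 * x powr \<alpha>))) * (1 - cos (L * x)) \<le> 1 * 2"
      by (intro mult_mono cos) auto
    then show ?thesis using that by (simp add: divide_right_mono)
  qed
  have "ennreal (pi / 2 * expectation (\<lambda>\<omega>. min L \<bar>X 1 \<omega>\<bar>)) =
      (\<integral>\<^sup>+x\<in>{0..1}. ennreal ((1 - exp (- (1 * x powr \<alpha>))) * (1 - cos (L * x)) / x\<^sup>2) \<partial>lborel) +
      (\<integral>\<^sup>+x\<in>{1..}. ennreal ((1 - exp (- (1 * x powr \<alpha>))) * (1 - cos (L * x)) / x\<^sup>2) \<partial>lborel)"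
    by (subst expectation_min_abs[OF zero_le_one L], subst set_nn_integral_Ioi_split[of 1]) auto
  also have "\<dots> \<le> (\<integral>\<^sup>+x\<in>{0..1}. ennreal (2 * x powr (\<alpha> - 2)) \<partial>lborel) +
      (\<integral>\<^sup>+x\<in>{1..}. ennreal (2 * (1 / x powr (1 + 1))) \<partial>lborel)"
  proof (intro add_mono nn_integral_mono)
    fix x :: real
    show "ennreal ((1 - exp (- (1 * x powr \<alpha>))) * (1 - cos (L * x)) / x\<^sup>2) * indicator {0..1} x \<le>
        ennreal (2 * x powr (\<alpha> - 2)) * indicator {0..1} x"
      using low[of x] by (cases "x = 0") (auto intro!: ennreal_leI split: split_indicator)
    show "ennreal ((1 - exp (- (1 * x powr \<alpha>))) * (1 - cos (L * x)) / x\<^sup>2) * indicator {1..} x \<le>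
        ennreal (2 * (1 / x powr (1 + 1))) * indicator {1..} x"
      using high[of x] by (cases "1 \<le> x") (auto intro!: ennreal_leI)
  qed
  also have "(\<integral>\<^sup>+x\<in>{1..}. ennreal (2 * (1 / x powr (1 + 1))) \<partial>lborel) = ennreal 2"
    using nn_integral_tail_powr[of 1 1] by (subst set_nn_integral_cmult) simp_all
  also have "(\<integral>\<^sup>+x\<in>{0..1}. ennreal (2 * x powr (\<alpha> - 2)) \<partial>lborel) = ennreal (2 * (1 / (\<alpha> - 1)))"
  proof -
    have "((\<lambda>x. x powr (\<alpha> - 2)) has_integral (1 powr (\<alpha> - 2 + 1) / (\<alpha> - 2 + 1))) {0..1}"
      using a by (intro has_integral_powr_from_0) auto
    then have "(\<integral>\<^sup>+x\<in>{0..1}. ennreal (x powr (\<alpha> - 2)) \<partial>lborel) = ennreal (1 / (\<alpha> - 1))"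
      using a by (subst (asm) has_integral_iff_set_nn_integral) auto
    moreover have "(\<integral>\<^sup>+x\<in>{0..1}. ennreal (2 * x powr (\<alpha> - 2)) \<partial>lborel) =
        ennreal 2 * (\<integral>\<^sup>+x\<in>{0..1}. ennreal (x powr (\<alpha> - 2)) \<partial>lborel)"
      by (rule set_nn_integral_cmult) auto
    moreover have "ennreal 2 * ennreal (1 / (\<alpha> - 1)) = ennreal (2 * (1 / (\<alpha> - 1)))"
      using a by (intro ennreal_mult[symmetric]) auto
    ultimately show ?thesis by simp
  qed
  also have "ennreal (2 * (1 / (\<alpha> - 1))) + ennreal 2 = ennreal (2 / (\<alpha> - 1) + 2)"
    using a by (subst ennreal_plus) auto
  finally show ?thesis
    using a by (subst (asm) ennreal_le_iff) auto
qed

subsection \<open>Heat loss as truncated expected range\<close>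

text \<open>A path may stay inside while its supremum equals the boundary, approached only through a
  left limit. So the event contains the one with strict inequalities for the maxima and is contained
  in the one with weak inequalities; these differ by a null set when neither maximum has an atom at
  the boundary value.\<close>

lemma prob_exit_time_eq:
  assumes t: "0 < t"
    and null: "prob {\<omega> \<in> space M. run_max 1 t \<omega> = b - x} = 0" "prob {\<omega> \<in> space M. run_max (- 1) t \<omega> = x - a} = 0"
  shows "measure (completion M) {\<omega> \<in> space M. ereal t < exit_time {a<..<b} (\<lambda>s. x + X s \<omega>)} =
    prob {\<omega> \<in> space M. run_max 1 t \<omega> < b - x \<and> run_max (- 1) t \<omega> < x - a}"
proof -
  have [measurable]: "run_max c t \<in> borel_measurable M" for c using t by measurable
  define A where "A = {\<omega> \<in> space M. ereal t < exit_time {a<..<b} (\<lambda>s. x + X s \<omega>)}"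
  define U where "U = {\<omega> \<in> space M. run_max 1 t \<omega> < b - x \<and> run_max (- 1) t \<omega> < x - a}"
  define N where "N = {\<omega> \<in> space M. run_max 1 t \<omega> = b - x} \<union> {\<omega> \<in> space M. run_max (- 1) t \<omega> = x - a}"
  have U: "U \<in> sets M" unfolding U_def by measurable
  have "{\<omega> \<in> space M. run_max 1 t \<omega> = b - x} \<in> null_sets M" "{\<omega> \<in> space M. run_max (- 1) t \<omega> = x - a} \<in> null_sets M"
    using null by (auto simp: null_sets_def emeasure_eq_measure)
  then have N: "N \<in> null_sets M" unfolding N_def by auto
  have A_iff: "\<omega> \<in> A \<longleftrightarrow> (\<forall>s\<in>{0..t}. 1 * X s \<omega> < b - x \<and> - 1 * X s \<omega> < x - a)" if "\<omega> \<in> space M" for \<omega>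
    using less_exit_time_iff[OF cadlag_paths[OF that], of t a b x] that t by (auto simp: A_def algebra_simps)
  have "U \<subseteq> A"
  proof
    fix \<omega> assume "\<omega> \<in> U"
    then show "\<omega> \<in> A"
      using run_max_upper[of \<omega> _ t 1] run_max_upper[of \<omega> _ t "-1"] by (force simp: U_def A_iff)
  qed
  moreover have "A - U \<subseteq> N"
  proof
    fix \<omega> assume *: "\<omega> \<in> A - U"
    then have \<omega>: "\<omega> \<in> space M" by (auto simp: A_def)
    have "run_max 1 t \<omega> \<le> b - x" "run_max (- 1) t \<omega> \<le> x - a"
      using * t unfolding run_max_le_iff[OF \<omega> less_imp_le[OF t]] A_iff[OF \<omega>, symmetric] by (auto simp: A_iff[OF \<omega>] intro: less_imp_le)
    then show "\<omega> \<in> N" using * \<omega> by (auto simp: U_def N_def)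
  qed
  ultimately have A: "A = U \<union> (A - U)" "A - U \<subseteq> N" by auto
  \<comment> \<open>\<open>A - U\<close> need not be measurable for \<open>M\<close>; as a subset of
    a null set it is measurable, and null, in the completion.\<close>
  have "A - U \<in> null_sets (completion M)"
    using A(2) N by (rule null_sets_completion_subset[OF _ null_sets_completionI])
  then have "emeasure (completion M) (U \<union> (A - U)) = emeasure (completion M) U"
    using U by (intro emeasure_Un_null_set) auto
  then have "emeasure (completion M) A = emeasure M U"
    using U A(1) by simp
  then show ?thesis by (simp add: measure_def A_def U_def)
qed

text \<open>For a fixed path of range \<open>R\<close>, the surviving starting points form, up to
  endpoints, an interval of length \<open>max 0 (b - a - R)\<close>, which is
  \<open>(b - a) - min (b - a) R\<close>. Tonelli over starting point and path gives the
  expectation.\<close>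

lemma spectral_heat_content_interval:
  assumes t: "0 < t" and ab: "a < b"
  shows "spectral_heat_content M X {a<..<b} t = (b - a) - expectation (\<lambda>\<omega>. min (b - a) (path_range t \<omega>))"
proof -
  interpret pair_sigma_finite M lborel ..
  have [measurable]: "run_max c t \<in> borel_measurable M" "path_range t \<in> borel_measurable M" for c using t by auto
  let ?U = "\<lambda>x. {\<omega> \<in> space M. run_max 1 t \<omega> < b - x \<and> run_max (- 1) t \<omega> < x - a}"
  \<comment> \<open>Off the countable set \<open>N\<close> of atoms, strict and weak inequalities for the running maxima differ by
    a null set, so the exit event is measurable in the completion.\<close>
  define N where "N = (\<lambda>y. b - y) ` {y. measure (distr M borel (run_max 1 t)) {y} \<noteq> 0} \<union>
      (\<lambda>y. y + a) ` {y. measure (distr M borel (run_max (- 1) t)) {y} \<noteq> 0}"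
  have fin: "finite_measure (distr M borel (run_max c t))" for c
    by (rule finite_measure_distr) measurable
  have N: "countable N"
    unfolding N_def by (intro countable_Un countable_image finite_measure.countable_support fin)
  have eq: "measure (completion M) {\<omega> \<in> space M. ereal t < exit_time {a<..<b} (\<lambda>s. x + X s \<omega>)} = prob (?U x)"
    if "x \<notin> N" for x
  proof (rule prob_exit_time_eq[OF t])
    have *: "prob {\<omega> \<in> space M. run_max c t \<omega> = y} = measure (distr M borel (run_max c t)) {y}" for c y
      by (subst measure_distr) (auto intro!: arg_cong[where f = prob])
    show "prob {\<omega> \<in> space M. run_max 1 t \<omega> = b - x} = 0"
      using that unfolding * N_def by (force simp: image_iff)
    show "prob {\<omega> \<in> space M. run_max (- 1) t \<omega> = x - a} = 0"
      using that unfolding * N_def by (force simp: image_iff)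
  qed
  have U_meas: "(\<lambda>x. ennreal (indicator {a<..<b} x * prob (?U x))) \<in> borel_measurable lborel"
    and U_int: "(\<integral>\<^sup>+x. ennreal (indicator {a<..<b} x * prob (?U x)) \<partial>lborel) =
      ennreal ((b - a) - expectation (\<lambda>\<omega>. min (b - a) (path_range t \<omega>)))"
  proof -
    define G where "G = (\<lambda>x \<omega>. indicator {p. a < fst p \<and> fst p < b \<and> run_max 1 t (snd p) < b - fst p \<and> run_max (- 1) t (snd p) < fst p - a} (x, \<omega>) :: ennreal)"
    have [measurable]: "(\<lambda>p. G (snd p) (fst p)) \<in> borel_measurable (M \<Otimes>\<^sub>M lborel)"
      "(\<lambda>p. G (fst p) (snd p)) \<in> borel_measurable (lborel \<Otimes>\<^sub>M M)"
      unfolding G_def indicator_def by auto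
    have G: "ennreal (indicator {a<..<b} x * prob (?U x)) = (\<integral>\<^sup>+\<omega>. G x \<omega> \<partial>M)" for x
    proof -
      have "(\<integral>\<^sup>+\<omega>. G x \<omega> \<partial>M) = (\<integral>\<^sup>+\<omega>. indicator {a<..<b} x * indicator (?U x) \<omega> \<partial>M)"
        by (intro nn_integral_cong) (auto simp: G_def split: split_indicator)
      also have "\<dots> = indicator {a<..<b} x * emeasure M (?U x)"
        by (subst nn_integral_cmult) auto
      finally show ?thesis
        by (auto simp: emeasure_eq_measure split: split_indicator)
    qed
    show "(\<lambda>x. ennreal (indicator {a<..<b} x * prob (?U x))) \<in> borel_measurable lborel"
      unfolding G by measurable
    have "(\<integral>\<^sup>+x. ennreal (indicator {a<..<b} x * prob (?U x)) \<partial>lborel) = (\<integral>\<^sup>+x. \<integral>\<^sup>+\<omega>. G x \<omega> \<partial>M \<partial>lborel)"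
      unfolding G ..
    also have "\<dots> = (\<integral>\<^sup>+\<omega>. \<integral>\<^sup>+x. G x \<omega> \<partial>lborel \<partial>M)"
      by (rule Fubini') measurable
    also have "\<dots> = (\<integral>\<^sup>+\<omega>. ennreal ((b - a) - min (b - a) (path_range t \<omega>)) \<partial>M)"
    proof (rule nn_integral_cong_AE)
      show "AE \<omega> in M. (\<integral>\<^sup>+x. G x \<omega> \<partial>lborel) = ennreal ((b - a) - min (b - a) (path_range t \<omega>))"
        using run_max_nonneg[OF t, of 1] run_max_nonneg[OF t, of "-1"]
      proof eventually_elim
        case (elim \<omega>)
        have "(\<integral>\<^sup>+x. G x \<omega> \<partial>lborel) = (\<integral>\<^sup>+x. indicator {a + run_max (- 1) t \<omega><..<b - run_max 1 t \<omega>} x \<partial>lborel)"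
          using elim by (intro nn_integral_cong) (auto simp: G_def split: split_indicator)
        also have "\<dots> = ennreal ((b - a) - min (b - a) (path_range t \<omega>))"
          by (cases "a + run_max (- 1) t \<omega> \<le> b - run_max 1 t \<omega>") (auto simp: path_range_def min_def)
        finally show ?case .
      qed
    qed
    also have "\<dots> = ennreal (expectation (\<lambda>\<omega>. (b - a) - min (b - a) (path_range t \<omega>)))"
      using ab t by (intro nn_integral_eq_integral) (auto intro!: integrable_min path_range_nonneg)
    also have "expectation (\<lambda>\<omega>. (b - a) - min (b - a) (path_range t \<omega>)) =
        (b - a) - expectation (\<lambda>\<omega>. min (b - a) (path_range t \<omega>))"
      using ab t by (subst Bochner_Integration.integral_diff) (auto intro!: integrable_min path_range_nonneg simp: prob_space)
    finally show "(\<integral>\<^sup>+x. ennreal (indicator {a<..<b} x * prob (?U x)) \<partial>lborel) =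
      ennreal ((b - a) - expectation (\<lambda>\<omega>. min (b - a) (path_range t \<omega>)))" .
  qed
  have "(\<lambda>x. enn2real (ennreal (indicator {a<..<b} x * prob (?U x)))) \<in> borel_measurable lborel"
    using U_meas by measurable
  then have U_meas': "(\<lambda>x. indicator {a<..<b} x * prob (?U x)) \<in> borel_measurable lborel" by simp
  have le: "expectation (\<lambda>\<omega>. min (b - a) (path_range t \<omega>)) \<le> b - a"
  proof -
    have "expectation (\<lambda>\<omega>. min (b - a) (path_range t \<omega>)) \<le> expectation (\<lambda>\<omega>. b - a)"
      using ab t by (intro integral_mono) (auto intro!: integrable_min path_range_nonneg)
    then show ?thesis by (simp add: prob_space)
  qed
  \<comment> \<open>The exceptional starting points are countable, so changing the integrand there
    does not change the integral.\<close>
  have "spectral_heat_content M X {a<..<b} t = (\<integral>x. indicator {a<..<b} x * prob (?U x) \<partial>lebesgue)"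
    unfolding spectral_heat_content_def set_lebesgue_integral_def
    using N by (intro integral_discrete_difference[of N]) (auto simp: eq)
  also have "\<dots> = (\<integral>x. indicator {a<..<b} x * prob (?U x) \<partial>lborel)"
    by (rule integral_completion[OF U_meas'])
  also have "\<dots> = (b - a) - expectation (\<lambda>\<omega>. min (b - a) (path_range t \<omega>))"
    using U_meas' U_int le by (subst integral_eq_nn_integral) (auto simp: split: split_indicator)
  finally show ?thesis .
qed

section \<open>Small-time asymptotics in the three regimes\<close>

lemma expectation_min_tendsto_at_top:
  assumes Y: "integrable M Y" and nn: "AE \<omega> in M. 0 \<le> Y \<omega>"
  shows "((\<lambda>T. expectation (\<lambda>\<omega>. min T (Y \<omega>) :: real)) \<longlongrightarrow> expectation Y) at_top"
proof (rule integral_dominated_convergence_at_top[where w = Y])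
  note [measurable] = borel_measurable_integrable[OF Y]
  show "(\<lambda>\<omega>. min T (Y \<omega>)) \<in> borel_measurable M" for T :: real by measurable
  show "\<forall>\<^sub>F T in at_top. AE \<omega> in M. norm (min T (Y \<omega>)) \<le> Y \<omega>"
    using eventually_ge_at_top[of 0]
  proof eventually_elim
    case (elim T)
    show ?case using nn by eventually_elim (use elim in auto)
  qed
  show "AE \<omega> in M. ((\<lambda>T. min T (Y \<omega>)) \<longlongrightarrow> Y \<omega>) at_top"
  proof (rule AE_I2, rule tendsto_eventually)
    show "\<forall>\<^sub>F T in at_top. min T (Y \<omega>) = Y \<omega>" for \<omega>
      using eventually_ge_at_top[of "Y \<omega>"] by eventually_elim simp
  qed
qed (use Y in auto)

text \<open>Monotone convergence of the truncations, whose expectations stay bounded by comparison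
  with the endpoint. Only finiteness matters here, so the loss factor is taken to be 2.\<close>

lemma integrable_path_range:
  assumes a: "1 < \<alpha>"
  shows "integrable M (path_range 1)"
proof -
  obtain K where K: "\<And>T. 0 \<le> T \<Longrightarrow>
      expectation (\<lambda>\<omega>. min T (path_range 1 \<omega>)) \<le> K + (1 + 1) * expectation (\<lambda>\<omega>. min T \<bar>X 1 \<omega>\<bar>)"
    using expectation_min_path_range_le_abs[of 1] by auto
  define b where "b = 2 / pi * (2 / (\<alpha> - 1) + 2)"
  define B where "B = K + 2 * b"
  have int: "integrable M (\<lambda>\<omega>. min (real n) (path_range 1 \<omega>))" for n :: nat
    by (intro integrable_min path_range_nonneg) auto
  have B: "expectation (\<lambda>\<omega>. min (real n) (path_range 1 \<omega>)) \<le> B" for n :: nat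
  proof -
    have "expectation (\<lambda>\<omega>. min (real n) \<bar>X 1 \<omega>\<bar>) \<le> b"
      using expectation_min_abs_bounded[OF a, of "real n"] by (simp add: b_def field_simps)
    then show ?thesis using K[of "real n"] by (simp add: B_def)
  qed
  have inc: "incseq (\<lambda>n. expectation (\<lambda>\<omega>. min (real n) (path_range 1 \<omega>)))"
    by (intro incseq_SucI integral_mono int) auto
  obtain l where l: "(\<lambda>n. expectation (\<lambda>\<omega>. min (real n) (path_range 1 \<omega>))) \<longlonglongrightarrow> l"
    using incseq_convergent[OF inc, of B] B by blast
  show ?thesis
  proof (rule integrable_monotone_convergence[OF int _ _ l])
    show "AE \<omega> in M. mono (\<lambda>n. min (real n) (path_range 1 \<omega>))"
      by (intro AE_I2 monoI) auto
    show "AE \<omega> in M. (\<lambda>n. min (real n) (path_range 1 \<omega>)) \<longlonglongrightarrow> path_range 1 \<omega>"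
    proof (rule AE_I2, rule tendsto_eventually)
      show "\<forall>\<^sub>F n in sequentially. min (real n) (path_range 1 \<omega>) = path_range 1 \<omega>" for \<omega>
        using eventually_ge_at_top[of "nat \<lceil>path_range 1 \<omega>\<rceil>"]
        by eventually_elim (simp add: min_absorb2 nat_ceiling_le_eq)
    qed
  qed auto
qed

text \<open>Symmetry is available for truncated maxima; both truncated expectations converge because
  each maximum is dominated by the integrable range.\<close>

lemma expectation_path_range:
  assumes a: "1 < \<alpha>"
  shows "expectation (path_range 1) = 2 * expectation (run_max 1 1)"
proof -
  have int: "integrable M (run_max c 1)" if "c \<in> {1, -1}" for c
  proof (rule Bochner_Integration.integrable_bound[OF integrable_path_range[OF a]])
    show "AE \<omega> in M. norm (run_max c 1 \<omega>) \<le> norm (path_range 1 \<omega>)"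
      using run_max_nonneg[of 1 1, OF zero_less_one] run_max_nonneg[of 1 "-1", OF zero_less_one]
      by eventually_elim (use that in \<open>auto simp: path_range_def\<close>)
  qed auto
  have "((\<lambda>T. expectation (\<lambda>\<omega>. min T (run_max (- 1) 1 \<omega>))) \<longlongrightarrow> expectation (run_max (- 1) 1)) at_top"
    by (intro expectation_min_tendsto_at_top int run_max_nonneg) auto
  moreover have "\<forall>\<^sub>F T in at_top. expectation (\<lambda>\<omega>. min T (run_max (- 1) 1 \<omega>)) = expectation (\<lambda>\<omega>. min T (run_max 1 1 \<omega>))"
    using eventually_ge_at_top[of 0] by eventually_elim (intro expectation_min_run_max_sym, auto)
  ultimately have "((\<lambda>T. expectation (\<lambda>\<omega>. min T (run_max 1 1 \<omega>))) \<longlongrightarrow> expectation (run_max (- 1) 1)) at_top"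
    by (rule Lim_transform_eventually)
  then have "expectation (run_max (- 1) 1) = expectation (run_max 1 1)"
    by (rule tendsto_unique[OF trivial_limit_at_top_linorder])
      (intro expectation_min_tendsto_at_top int run_max_nonneg, auto)
  then show ?thesis
    using int[of 1] int[of "-1"] unfolding path_range_def by simp
qed

text \<open>By scaling, the quotient equals the expectation of \<open>path_range 1\<close> truncated
  at \<open>L / t powr (1 / \<alpha>)\<close>, a level that tends to infinity.\<close>

lemma heat_loss_supercritical:
  assumes a: "1 < \<alpha>" and L: "0 < L"
  shows "((\<lambda>t. expectation (\<lambda>\<omega>. min L (path_range t \<omega>)) / t powr (1 / \<alpha>))
    \<longlongrightarrow> 2 * expectation (run_max 1 1)) (at_right 0)"
proof (rule Lim_transform_eventually)
  have "filterlim (\<lambda>t. L / t powr (1 / \<alpha>)) at_top (at_right 0)"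
    using L index by real_asymp
  from filterlim_compose[OF expectation_min_tendsto_at_top[OF integrable_path_range[OF a] path_range_nonneg] this]
  show "((\<lambda>t. expectation (\<lambda>\<omega>. min (L / t powr (1 / \<alpha>)) (path_range 1 \<omega>)))
      \<longlongrightarrow> 2 * expectation (run_max 1 1)) (at_right 0)"
    by (simp add: expectation_path_range[OF a])
  show "\<forall>\<^sub>F t in at_right 0. expectation (\<lambda>\<omega>. min (L / t powr (1 / \<alpha>)) (path_range 1 \<omega>)) =
      expectation (\<lambda>\<omega>. min L (path_range t \<omega>)) / t powr (1 / \<alpha>)"
    using eventually_at_right_less[of 0]
  proof eventually_elim
    case (elim t)
    then show ?case
      using L by (subst (2) expectation_min_path_range_scaling) auto
  qed
qed

lemma expectation_min_abs_le_path_range: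
  assumes "0 < t" "0 \<le> L"
  shows "expectation (\<lambda>\<omega>. min L \<bar>X t \<omega>\<bar>) \<le> expectation (\<lambda>\<omega>. min L (path_range t \<omega>))"
proof (rule integral_mono_AE)
  have X: "X t \<in> borel_measurable M" using assms by (auto intro: rv)
  show "integrable M (\<lambda>\<omega>. min L \<bar>X t \<omega>\<bar>)" using assms X by (intro integrable_min) auto
  show "integrable M (\<lambda>\<omega>. min L (path_range t \<omega>))"
    using assms by (intro integrable_min path_range_nonneg) auto
  show "AE \<omega> in M. min L \<bar>X t \<omega>\<bar> \<le> min L (path_range t \<omega>)"
    using abs_le_path_range[OF assms(1)] by eventually_elim auto
qed

text \<open>From below, the endpoint and its closed formula already give the full constant. From
  above, scaling leads to \<open>path_range 1\<close> truncated at \<open>L / t\<close>; comparison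
  with \<open>\<bar>X 1\<bar>\<close> costs the factor \<open>1 + \<eta>\<close> and an additive
  \<open>K\<close>, and the latter vanishes after division by \<open>ln (1 / t)\<close>.\<close>

lemma heat_loss_critical:
  assumes a: "\<alpha> = 1" and L: "0 < L"
  shows "((\<lambda>t. expectation (\<lambda>\<omega>. min L (path_range t \<omega>)) / (t * ln (1 / t))) \<longlongrightarrow> 2 / pi) (at_right 0)"
proof (rule order_tendstoI)
  let ?f = "\<lambda>t. expectation (\<lambda>\<omega>. min L (path_range t \<omega>))"
  define G where "G = (\<lambda>t. (L * arctan (t / L) + t / 2 * ln (1 + (L / t)\<^sup>2)) / (t * ln (1 / t)))"
  have G: "(G \<longlongrightarrow> 1) (at_right 0)" unfolding G_def by (rule cauchy_trunc_asymp[OF L])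
  have small: "\<forall>\<^sub>F t in at_right 0. 0 < t \<and> t < (1::real)"
    by (auto simp: eventually_at_right_field intro!: exI[of _ 1])
  {
    fix y :: real assume "y < 2 / pi"
    moreover have "((\<lambda>t. 2 / pi * G t) \<longlongrightarrow> 2 / pi) (at_right 0)"
      using tendsto_mult_left[OF G, of "2 / pi"] by simp
    ultimately have "\<forall>\<^sub>F t in at_right 0. y < 2 / pi * G t" by (intro order_tendstoD(1))
    then show "\<forall>\<^sub>F t in at_right 0. y < ?f t / (t * ln (1 / t))"
      using small
    proof eventually_elim
      case (elim t)
      then have D: "0 < t * ln (1 / t)" by simp
      have "2 / pi * G t = expectation (\<lambda>\<omega>. min L \<bar>X t \<omega>\<bar>) / (t * ln (1 / t))"
        using elim L a by (simp add: expectation_min_abs_cauchy G_def)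
      also have "\<dots> \<le> ?f t / (t * ln (1 / t))"
        using D elim L by (intro divide_right_mono expectation_min_abs_le_path_range) auto
      finally show ?case using elim by simp
    qed
  }
  {
    fix y assume y: "2 / pi < y"
    \<comment> \<open>Half of the available excess suffices: since \<open>2 / pi < 1\<close>, the
      limit \<open>(1 + \<eta>) * (2 / pi)\<close> is below \<open>2 / pi + \<eta>\<close>, hence
      below \<open>y\<close>.\<close>
    define \<eta> where "\<eta> = (y - 2 / pi) / 2"
    have \<eta>: "0 < \<eta>" using y by (simp add: \<eta>_def)
    obtain K where K: "\<And>T. 0 \<le> T \<Longrightarrow>
        expectation (\<lambda>\<omega>. min T (path_range 1 \<omega>)) \<le> K + (1 + \<eta>) * expectation (\<lambda>\<omega>. min T \<bar>X 1 \<omega>\<bar>)"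
      using expectation_min_path_range_le_abs[OF \<eta>] by auto
    have "((\<lambda>t::real. K / ln (1 / t)) \<longlongrightarrow> 0) (at_right 0)" by real_asymp
    then have "((\<lambda>t. K / ln (1 / t) + (1 + \<eta>) * (2 / pi) * G t) \<longlongrightarrow> 0 + (1 + \<eta>) * (2 / pi) * 1) (at_right 0)"
      by (intro tendsto_intros G)
    moreover have "0 + (1 + \<eta>) * (2 / pi) * 1 < y"
    proof -
      have "2 / pi < 1" using pi_gt3 by simp
      then have "\<eta> * (2 / pi) < \<eta> * 1" using \<eta> by (intro mult_strict_left_mono)
      moreover have "0 + (1 + \<eta>) * (2 / pi) * 1 = 2 / pi + \<eta> * (2 / pi)" by (simp only: distrib_right mult_1 mult_1_right add_0)
      moreover have "2 / pi + \<eta> * 1 < y" unfolding \<eta>_def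
      proof -
        have "p + (y - p) / 2 * 1 < y" if "p < y" for p :: real using that by (simp add: field_simps)
        then show "2 / pi + (y - 2 / pi) / 2 * 1 < y" using y .
      qed
      ultimately show ?thesis by (simp only: mult_1_right)
    qed
    ultimately have "\<forall>\<^sub>F t in at_right 0. K / ln (1 / t) + (1 + \<eta>) * (2 / pi) * G t < y"
      by (rule order_tendstoD(2))
    then show "\<forall>\<^sub>F t in at_right 0. ?f t / (t * ln (1 / t)) < y"
      using small
    proof eventually_elim
      case (elim t)
      then have D: "0 < t * ln (1 / t)" by simp
      have "?f t = t * expectation (\<lambda>\<omega>. min (L / t) (path_range 1 \<omega>))"
        using elim L a by (subst expectation_min_path_range_scaling) auto
      also have "\<dots> \<le> t * (K + (1 + \<eta>) * expectation (\<lambda>\<omega>. min (L / t) \<bar>X 1 \<omega>\<bar>))"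
        using elim L by (intro mult_left_mono K) auto
      also have "expectation (\<lambda>\<omega>. min (L / t) \<bar>X 1 \<omega>\<bar>) = 2 / pi * (L / t * arctan (t / L) + 1 / 2 * ln (1 + (L / t)\<^sup>2))"
        using elim L a by (subst expectation_min_abs_cauchy) auto
      \<comment> \<open>The same \<open>G t\<close> as in the lower bound reappears, reflecting that
        \<open>t * min (L / t) \<bar>X 1\<bar>\<close> and \<open>min L \<bar>X t\<bar>\<close> have
        the same law for \<alpha> = 1.\<close>
      also have "t * (K + (1 + \<eta>) * (2 / pi * (L / t * arctan (t / L) + 1 / 2 * ln (1 + (L / t)\<^sup>2)))) =
          K * t + (1 + \<eta>) * (2 / pi) * (G t * (t * ln (1 / t)))"
      proof -
        have "n / d * d = n" if "0 < d" for n d :: real using that by simp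
        then have "G t * (t * ln (1 / t)) = L * arctan (t / L) + t / 2 * ln (1 + (L / t)\<^sup>2)"
          unfolding G_def using D .
        also have "\<dots> = t * (L / t * arctan (t / L) + 1 / 2 * ln (1 + (L / t)\<^sup>2))"
          using elim by (simp add: distrib_left)
        finally have "G t * (t * ln (1 / t)) = t * (L / t * arctan (t / L) + 1 / 2 * ln (1 + (L / t)\<^sup>2))" .
        moreover have "t * (K + c * (p * A)) = K * t + c * p * (t * A)" for c p A :: real
          by (simp add: algebra_simps)
        ultimately show ?thesis by (simp only:)
      qed
      finally have "?f t / (t * ln (1 / t)) \<le> (K * t + (1 + \<eta>) * (2 / pi) * (G t * (t * ln (1 / t)))) / (t * ln (1 / t))"
        using D by (intro divide_right_mono) auto
      also have "\<dots> = K / ln (1 / t) + (1 + \<eta>) * (2 / pi) * G t"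
        unfolding add_divide_distrib using D elim by simp
      finally show ?case using elim by simp
    qed
  }
qed

text \<open>The upper bound by subdivision and the lower bound by the endpoint share the constant
  \<open>C\<close>, which is \<open>stable_const \<alpha>\<close> times the closed form of the
  perimeter.\<close>

lemma heat_loss_subcritical:
  assumes a: "\<alpha> < 1" and ab: "a < b"
  shows "((\<lambda>t. expectation (\<lambda>\<omega>. min (b - a) (path_range t \<omega>)) / t)
    \<longlongrightarrow> stable_const \<alpha> * enn2real (fractional_perimeter \<alpha> {a<..<b})) (at_right 0)"
proof -
  let ?L = "b - a"
  define C where "C = 2 * ?L powr (1 - \<alpha>) * stable_const \<alpha> / (\<alpha> * (1 - \<alpha>))"
  have L: "0 < ?L" using ab by simp
  have le: "expectation (\<lambda>\<omega>. min ?L (path_range t \<omega>)) \<le> C * t" if "0 < t" for t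
    using expectation_min_abs_le[OF a L] that L
    by (intro expectation_min_path_range_le) (auto simp: C_def)
  have "((\<lambda>t. expectation (\<lambda>\<omega>. min ?L (path_range t \<omega>)) / t) \<longlongrightarrow> C) (at_right 0)"
  proof (rule tendsto_sandwich)
    show "((\<lambda>t. expectation (\<lambda>\<omega>. min ?L \<bar>X t \<omega>\<bar>) / t) \<longlongrightarrow> C) (at_right 0)"
      unfolding C_def by (rule expectation_min_abs_tendsto[OF a L])
    show "((\<lambda>t. C) \<longlongrightarrow> C) (at_right 0)" by simp
    show "\<forall>\<^sub>F t in at_right 0. expectation (\<lambda>\<omega>. min ?L \<bar>X t \<omega>\<bar>) / t \<le> expectation (\<lambda>\<omega>. min ?L (path_range t \<omega>)) / t"
      using eventually_at_right_less[of 0]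
      by eventually_elim (use L in \<open>auto intro!: divide_right_mono expectation_min_abs_le_path_range\<close>)
    show "\<forall>\<^sub>F t in at_right 0. expectation (\<lambda>\<omega>. min ?L (path_range t \<omega>)) / t \<le> C"
      using eventually_at_right_less[of 0]
    proof eventually_elim
      case (elim t)
      then show ?case using le[of t] by (simp add: divide_le_eq)
    qed
  qed
  also have "C = stable_const \<alpha> * enn2real (fractional_perimeter \<alpha> {a<..<b})"
    using index(1) a ab by (simp add: C_def fractional_perimeter_interval)
  finally show ?thesis .
qed

end

theorem theorem1p1:
  fixes M :: "'a measure" and X :: "real \<Rightarrow> 'a \<Rightarrow> real" and \<alpha> a b :: real and \<Omega> :: "real set"
  assumes "symmetric_stable_process M X \<alpha>"
    and "a < b"
    and "\<Omega> = {a<..<b}"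
  shows "(1 < \<alpha> \<and> \<alpha> \<le> 2 \<longrightarrow>
            ((\<lambda>t. (measure lborel \<Omega> - spectral_heat_content M X \<Omega> t) / t powr (1 / \<alpha>))
               \<longlongrightarrow> 2 * prob_space.expectation M (\<lambda>\<omega>. SUP s\<in>{0..1}. X s \<omega>)) (at_right 0)) \<and>
         (\<alpha> = 1 \<longrightarrow>
            ((\<lambda>t. (measure lborel \<Omega> - spectral_heat_content M X \<Omega> t) / (t * ln (1 / t)))
               \<longlongrightarrow> 2 / pi) (at_right 0)) \<and>
         (0 < \<alpha> \<and> \<alpha> < 1 \<longrightarrow>
            ((\<lambda>t. (measure lborel \<Omega> - spectral_heat_content M X \<Omega> t) / t)
               \<longlongrightarrow> stable_const \<alpha> * enn2real (fractional_perimeter \<alpha> \<Omega>)) (at_right 0))"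
proof -
  interpret symmetric_stable_process M X \<alpha> by (rule assms(1))
  \<comment> \<open>The three parts differ only in the normalization \<open>g\<close> and the limit
    \<open>l\<close>, so the heat loss is replaced by the truncated expected range once for all of
    them.\<close>
  have *: "((\<lambda>t. (measure lborel \<Omega> - spectral_heat_content M X \<Omega> t) / g t) \<longlongrightarrow> l) (at_right 0)"
    if "((\<lambda>t. expectation (\<lambda>\<omega>. min (b - a) (path_range t \<omega>)) / g t) \<longlongrightarrow> l) (at_right 0)" for g l
    using that
  proof (rule Lim_transform_eventually)
    show "\<forall>\<^sub>F t in at_right 0. expectation (\<lambda>\<omega>. min (b - a) (path_range t \<omega>)) / g t =
        (measure lborel \<Omega> - spectral_heat_content M X \<Omega> t) / g t"
      using eventually_at_right_less[of 0]
      by eventually_elim (use assms(2,3) in \<open>simp add: spectral_heat_content_interval\<close>)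
  qed
  have sup: "(\<lambda>\<omega>. SUP s\<in>{0..1}. X s \<omega>) = run_max 1 1"
    by (simp add: run_max_def fun_eq_iff)
  show ?thesis
    unfolding sup
    by (intro conjI impI; rule *)
      (use heat_loss_supercritical[of "b - a"] heat_loss_critical[of "b - a"] heat_loss_subcritical[of a b] assms(2,3)
       in simp_all)
qed

end
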